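(* Let $\mathcal{H}$ be a Hilbert space, let $G$ be a group, let $H$ be a subgroup of $G$, and let $\Gamma\subseteq G/H$ be symmetric and Archimedian. Let $\varphi:\Gamma\to\mathbf{B}(\mathcal{H})$. The map $\varphi$ is a partially defined completely positive definite function if and only if there exist a representation of class one $\pi$ of $G$ and an isometry $V$ from $\mathcal{H}$ into the space of $\pi$ such that the range of $V$ is a subspace of the $H$-invariant vectors of $\pi$ and $$\varphi(g/H)=V^*\pi(g)V\qquad\text{for all }g\in G\text{ with }g/H\in\Gamma.$$
   Context: $\mathbf{B}(\mathcal{H})$ is the algebra of bounded operators on $\mathcal{H}$, and $g/H$ denotes the left coset $gH$. $\Gamma\subseteq G/H$ is symmetric if $g/H\in\Gamma$ implies $g^{-1}/H\in\Gamma$, and Archimedian if $e/H\in\Gamma$, where $e$ is the identity of $G$. The group algebra $\mathbb{C}[G]$ consists of finite formal sums $\sum a_ig_i$ ($a_i\in\mathbb{C}$, $g_i\in G$) with conjugate linear involution satisfying $g^*=g^{-1}$; for $G$ a locally compact group it is normed by $\|\sum a_ig_i\|=\sup_\pi\|\sum a_i\pi(g_i)\|$, the supremum being over all continuous unitary representations $\pi$ of $G$, and $\overline{\mathbb{C}[G]}$ is its completion. $\mathbb{C}[\Gamma]\subseteq\mathbb{C}[G]$ is the linear span of the $g\in G$ with $g/H\in\Gamma$. A linear map $\Phi:\mathbb{C}[\Gamma]\to\mathbf{B}(\mathcal{H})$ is completely positive if $[\Phi(x_{ij})]_{i,j}$ is positive semidefinite whenever $[x_{ij}]_{i,j}$ is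 a square matrix of any finite size with entries in $\mathbb{C}[\Gamma]$ that is positive semidefinite as a matrix over $\overline{\mathbb{C}[G]}$. $\varphi:\Gamma\to\mathbf{B}(\mathcal{H})$ is a partially defined completely positive definite function if the induced linear map on $\mathbb{C}[\Gamma]$ satisfying $g\mapsto\varphi(g/H)$ is completely positive. A representation of class one of $G$ (with respect to $H$) is a unitary representation, not necessarily irreducible, whose subspace of $H$-fixed vectors is nontrivial.
   Formalization: As stated the claim fails for φ = 0; the proved version adds φ(e/H) = I to the completely-positive side of the equivalence. G is taken as a discrete group, and representation spaces are closed subspaces of an arbitrarily large ℓ² space. *)

theory Defs
  imports "HOL-Analysis.Analysis" "HOL-Algebra.Coset" "HOL-Library.Poly_Mapping"
begin

section \<open>Complex Hilbert spaces\<close>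

class scaleC =
  fixes scaleC :: "complex \<Rightarrow> 'a \<Rightarrow> 'a"  (infixr \<open>*\<^sub>C\<close> 75)

class complex_vector = real_vector + scaleC +
  assumes scaleC_add_right: "a *\<^sub>C (x + y) = a *\<^sub>C x + a *\<^sub>C y"
    and scaleC_add_left: "(a + b) *\<^sub>C x = a *\<^sub>C x + b *\<^sub>C x"
    and scaleC_scaleC: "a *\<^sub>C b *\<^sub>C x = (a * b) *\<^sub>C x"
    and scaleC_one: "1 *\<^sub>C x = x"
    and scaleR_scaleC: "r *\<^sub>R x = complex_of_real r *\<^sub>C x"

text \<open>The complex inner product is linear in its second argument. Norm and topology are those of
  the underlying real inner product space.\<close>

class complex_inner = complex_vector + real_inner +
  fixes cinner :: "'a \<Rightarrow> 'a \<Rightarrow> complex"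
  assumes cinner_commute: "cinner x y = cnj (cinner y x)"
    and cinner_add_right: "cinner x (y + z) = cinner x y + cinner x z"
    and cinner_scaleC_right: "cinner x (c *\<^sub>C y) = c * cinner x y"
    and inner_Re_cinner: "inner x y = Re (cinner x y)"

class chilbert_space = complex_inner + complete_space


section \<open>The Hilbert space of square-summable families\<close>

typedef 'i ell2 = "{f :: 'i \<Rightarrow> complex. (\<lambda>i. (cmod (f i))\<^sup>2) summable_on UNIV}"
  morphisms ell2_coord Abs_ell2
  by (rule exI[of _ "\<lambda>_. 0"]) simp

setup_lifting type_definition_ell2

lemma ell2_summable_add:
  fixes f g :: "'i \<Rightarrow> complex"
  assumes f: "(\<lambda>i. (cmod (f i))\<^sup>2) summable_on UNIV" and g: "(\<lambda>i. (cmod (g i))\<^sup>2) summable_on UNIV"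
  shows "(\<lambda>i. (cmod (f i + g i))\<^sup>2) summable_on UNIV"
proof (rule summable_on_comparison_test)
  show "(\<lambda>i. 2 * (cmod (f i))\<^sup>2 + 2 * (cmod (g i))\<^sup>2) summable_on UNIV"
    by (intro summable_on_add summable_on_cmult_right f g)
  fix i
  have "(cmod (f i + g i))\<^sup>2 \<le> (cmod (f i) + cmod (g i))\<^sup>2"
    by (intro power_mono norm_triangle_ineq) simp
  also have "\<dots> \<le> 2 * (cmod (f i))\<^sup>2 + 2 * (cmod (g i))\<^sup>2"
    using zero_le_power2[of "cmod (f i) - cmod (g i)"] by (simp add: power2_eq_square algebra_simps)
  finally show "(cmod (f i + g i))\<^sup>2 \<le> 2 * (cmod (f i))\<^sup>2 + 2 * (cmod (g i))\<^sup>2" .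
qed simp

lemma ell2_summable_scale:
  fixes f :: "'i \<Rightarrow> complex"
  assumes "(\<lambda>i. (cmod (f i))\<^sup>2) summable_on UNIV"
  shows "(\<lambda>i. (cmod (c * f i))\<^sup>2) summable_on UNIV"
  using summable_on_cmult_right[OF assms, of "(cmod c)\<^sup>2"] by (simp add: norm_mult power_mult_distrib)

lemma ell2_summable_uminus:
  fixes f :: "'i \<Rightarrow> complex"
  assumes "(\<lambda>i. (cmod (f i))\<^sup>2) summable_on UNIV"
  shows "(\<lambda>i. (cmod (- f i))\<^sup>2) summable_on UNIV"
  using assms by simp

lemma ell2_summable_mult:
  fixes f g :: "'i \<Rightarrow> complex"
  assumes f: "(\<lambda>i. (cmod (f i))\<^sup>2) summable_on UNIV" and g: "(\<lambda>i. (cmod (g i))\<^sup>2) summable_on UNIV"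
  shows "(\<lambda>i. cnj (f i) * g i) summable_on UNIV"
proof -
  have "(\<lambda>i. cmod (cnj (f i) * g i)) summable_on UNIV"
  proof (rule summable_on_comparison_test)
    show "(\<lambda>i. (cmod (f i))\<^sup>2 + (cmod (g i))\<^sup>2) summable_on UNIV"
      by (intro summable_on_add f g)
    fix i
    have "2 * (cmod (f i) * cmod (g i)) \<le> (cmod (f i))\<^sup>2 + (cmod (g i))\<^sup>2"
      using zero_le_power2[of "cmod (f i) - cmod (g i)"]
      by (simp add: power2_eq_square algebra_simps)
    moreover have "0 \<le> cmod (f i) * cmod (g i)" by simp
    ultimately show "cmod (cnj (f i) * g i) \<le> (cmod (f i))\<^sup>2 + (cmod (g i))\<^sup>2"
      unfolding norm_mult complex_mod_cnj by linarith
  qed simp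
  then show ?thesis by (rule abs_summable_summable)
qed

instantiation ell2 :: (type) complex_inner
begin

lift_definition zero_ell2 :: "'a ell2" is "\<lambda>_. 0" by simp
lift_definition plus_ell2 :: "'a ell2 \<Rightarrow> 'a ell2 \<Rightarrow> 'a ell2" is "\<lambda>f g i. f i + g i"
  by (rule ell2_summable_add)
lift_definition uminus_ell2 :: "'a ell2 \<Rightarrow> 'a ell2" is "\<lambda>f i. - f i"
  by (rule ell2_summable_uminus)
lift_definition minus_ell2 :: "'a ell2 \<Rightarrow> 'a ell2 \<Rightarrow> 'a ell2" is "\<lambda>f g i. f i - g i"
  using ell2_summable_add[OF _ ell2_summable_uminus] by auto
lift_definition scaleC_ell2 :: "complex \<Rightarrow> 'a ell2 \<Rightarrow> 'a ell2" is "\<lambda>c f i. c * f i"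
  by (rule ell2_summable_scale)
definition scaleR_ell2 :: "real \<Rightarrow> 'a ell2 \<Rightarrow> 'a ell2"
  where "scaleR_ell2 r x = complex_of_real r *\<^sub>C x"
definition cinner_ell2 :: "'a ell2 \<Rightarrow> 'a ell2 \<Rightarrow> complex"
  where "cinner_ell2 x y = (\<Sum>\<^sub>\<infinity>i. cnj (ell2_coord x i) * ell2_coord y i)"
definition inner_ell2 :: "'a ell2 \<Rightarrow> 'a ell2 \<Rightarrow> real"
  where "inner_ell2 x y = Re (cinner x y)"
definition norm_ell2 :: "'a ell2 \<Rightarrow> real"
  where "norm_ell2 x = sqrt (inner x x)"
definition sgn_ell2 :: "'a ell2 \<Rightarrow> 'a ell2"
  where "sgn_ell2 x = scaleR (inverse (norm x)) x"
definition dist_ell2 :: "'a ell2 \<Rightarrow> 'a ell2 \<Rightarrow> real"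
  where "dist_ell2 x y = norm (x - y)"
definition uniformity_ell2 :: "('a ell2 \<times> 'a ell2) filter"
  where "uniformity_ell2 = (INF e\<in>{0 <..}. principal {(x, y). dist x y < e})"
definition open_ell2 :: "'a ell2 set \<Rightarrow> bool"
  where "open_ell2 S = (\<forall>x\<in>S. \<forall>\<^sub>F (x', y) in uniformity. x' = x \<longrightarrow> y \<in> S)"

lemma ell2_coord_square: "(\<lambda>i. (cmod (ell2_coord x i))\<^sup>2) summable_on UNIV"
  using ell2_coord by blast

lemma ell2_coord_mult: "(\<lambda>i. cnj (ell2_coord x i) * ell2_coord y i) summable_on UNIV"
  by (intro ell2_summable_mult ell2_coord_square)

lemma ell2_inner_self: "inner x x = (\<Sum>\<^sub>\<infinity>i. (cmod (ell2_coord x i))\<^sup>2)" for x :: "'a ell2"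
proof -
  have eq: "cnj (ell2_coord x i) * ell2_coord x i = complex_of_real ((cmod (ell2_coord x i))\<^sup>2)" for i
    by (simp add: complex_norm_square mult.commute del: of_real_power)
  have "((\<lambda>i. complex_of_real ((cmod (ell2_coord x i))\<^sup>2)) has_sum
      complex_of_real (\<Sum>\<^sub>\<infinity>i. (cmod (ell2_coord x i))\<^sup>2)) UNIV"
    by (intro has_sum_of_real has_sum_infsum ell2_coord_square)
  then show ?thesis
    unfolding inner_ell2_def cinner_ell2_def eq by (simp add: infsumI)
qed

instance
proof
  fix x y z :: "'a ell2" and a b :: complex and r s :: real
  show "x + y + z = x + (y + z)" by transfer (auto simp: algebra_simps)
  show "x + y = y + x" by transfer (auto simp: algebra_simps)
  show "0 + x = x" by transfer simp
  show "- x + x = 0" by transfer simp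
  show "x - y = x + - y" by transfer simp
  show C1: "a *\<^sub>C (x + y) = a *\<^sub>C x + a *\<^sub>C y" for a and x y :: "'a ell2"
    by transfer (simp add: algebra_simps)
  show C2: "(a + b) *\<^sub>C x = a *\<^sub>C x + b *\<^sub>C x" for a b by transfer (simp add: algebra_simps)
  show C3: "a *\<^sub>C b *\<^sub>C x = (a * b) *\<^sub>C x" for a b by transfer (simp add: algebra_simps)
  show C4: "1 *\<^sub>C x = x" by transfer simp
  show "r *\<^sub>R x = complex_of_real r *\<^sub>C x" by (rule scaleR_ell2_def)
  show "r *\<^sub>R (x + y) = r *\<^sub>R x + r *\<^sub>R y"
       "(r + s) *\<^sub>R x = r *\<^sub>R x + s *\<^sub>R x"
       "r *\<^sub>R s *\<^sub>R x = (r * s) *\<^sub>R x"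
       "1 *\<^sub>R x = x"
    by (simp_all add: scaleR_ell2_def C1 C2 C3 C4)
  show "sgn x = scaleR (inverse (norm x)) x" by (rule sgn_ell2_def)
  show "dist x y = norm (x - y)" by (rule dist_ell2_def)
  show "uniformity = (INF e\<in>{0 <..}. principal {(x :: 'a ell2, y). dist x y < e})"
    by (rule uniformity_ell2_def)
  show "open S = (\<forall>x\<in>S. \<forall>\<^sub>F (x', y) in uniformity. x' = x \<longrightarrow> y \<in> S)" for S :: "'a ell2 set"
    by (rule open_ell2_def)
  have I1: "cinner x y = cnj (cinner y x)" for x y :: "'a ell2"
    unfolding cinner_ell2_def infsum_cnj[symmetric] by (simp add: mult.commute)
  then show "cinner x y = cnj (cinner y x)" .
  have I2: "cinner x (y + z) = cinner x y + cinner x z" for x y z :: "'a ell2"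
    unfolding cinner_ell2_def plus_ell2.rep_eq distrib_left
    by (intro infsum_add ell2_coord_mult)
  then show "cinner x (y + z) = cinner x y + cinner x z" .
  have I3: "cinner x (c *\<^sub>C y) = c * cinner x y" for c and x y :: "'a ell2"
  proof -
    have "cinner x (c *\<^sub>C y) = (\<Sum>\<^sub>\<infinity>i. c * (cnj (ell2_coord x i) * ell2_coord y i))"
      unfolding cinner_ell2_def scaleC_ell2.rep_eq by (simp add: mult.left_commute)
    also have "\<dots> = c * cinner x y"
      unfolding cinner_ell2_def by (intro infsum_cmult_right ell2_coord_mult)
    finally show ?thesis .
  qed
  then show "cinner x (a *\<^sub>C y) = a * cinner x y" .
  show "inner x y = Re (cinner x y)" by (rule inner_ell2_def)
  have sym: "inner x y = inner y x" for x y :: "'a ell2"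
    unfolding inner_ell2_def by (subst I1) simp
  then show "inner x y = inner y x" .
  show "inner (x + y) z = inner x z + inner y z"
    by (simp add: sym[of _ z]) (simp add: inner_ell2_def I2)
  show "inner (r *\<^sub>R x) y = r * inner x y"
    by (simp add: sym[of _ y]) (simp add: inner_ell2_def scaleR_ell2_def I3)
  show "0 \<le> inner x x"
    unfolding ell2_inner_self by (intro infsum_nonneg) simp
  show "(inner x x = 0) = (x = 0)"
  proof
    assume "inner x x = 0"
    then have "ell2_coord x i = 0" for i
      using nonneg_infsum_le_0D[of "\<lambda>i. (cmod (ell2_coord x i))\<^sup>2" UNIV i] ell2_coord_square[of x]
      by (simp add: ell2_inner_self)
    then show "x = 0" by transfer auto
  next
    assume "x = 0"
    then show "inner x x = 0" by (simp add: ell2_inner_self zero_ell2.rep_eq)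
  qed
  show "norm x = sqrt (inner x x)" by (rule norm_ell2_def)
qed

end

lemma ell2_norm_square: "(norm x)\<^sup>2 = (\<Sum>\<^sub>\<infinity>i. (cmod (ell2_coord x i))\<^sup>2)"
  by (simp only: power2_norm_eq_inner[of x] ell2_inner_self)

lemma ell2_finite_sum_le:
  assumes "finite F"
  shows "(\<Sum>i\<in>F. (cmod (ell2_coord x i))\<^sup>2) \<le> (norm x)\<^sup>2"
  unfolding ell2_norm_square
  by (rule finite_sum_le_infsum[OF ell2_coord_square assms]) auto

instance ell2 :: (type) chilbert_space
proof
  fix X :: "nat \<Rightarrow> 'a ell2"
  assume X: "Cauchy X"
  have coord_le: "cmod (ell2_coord x i) \<le> norm x" for x :: "'a ell2" and i
    using ell2_finite_sum_le[of "{i}" x] by (simp add: power2_le_iff_abs_le)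
  have "Cauchy (\<lambda>n. ell2_coord (X n) i)" for i
  proof (rule metric_CauchyI)
    fix e :: real assume "e > 0"
    then obtain N where N: "\<And>m n. m \<ge> N \<Longrightarrow> n \<ge> N \<Longrightarrow> dist (X m) (X n) < e"
      using metric_CauchyD[OF X] by blast
    have "dist (ell2_coord (X m) i) (ell2_coord (X n) i) < e" if "m \<ge> N" "n \<ge> N" for m n
      using coord_le[of "X m - X n" i] N[OF that] by (simp add: dist_norm minus_ell2.rep_eq)
    then show "\<exists>M. \<forall>m\<ge>M. \<forall>n\<ge>M. dist (ell2_coord (X m) i) (ell2_coord (X n) i) < e" by blast
  qed
  then have "\<exists>l. (\<lambda>n. ell2_coord (X n) i) \<longlonglongrightarrow> l" for i
    by (simp add: Cauchy_convergent_iff convergent_def)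
  then obtain L where L: "\<And>i. (\<lambda>n. ell2_coord (X n) i) \<longlonglongrightarrow> L i"
    by metis
  have bound: "(\<Sum>i\<in>F. (cmod (ell2_coord (X n) i - L i))\<^sup>2) \<le> e\<^sup>2"
    if N: "\<And>m n. m \<ge> N \<Longrightarrow> n \<ge> N \<Longrightarrow> dist (X m) (X n) < e" and n: "n \<ge> N" and F: "finite F"
    for e N n F
  proof (rule LIMSEQ_le_const2)
    show "(\<lambda>m. \<Sum>i\<in>F. (cmod (ell2_coord (X n) i - ell2_coord (X m) i))\<^sup>2)
        \<longlonglongrightarrow> (\<Sum>i\<in>F. (cmod (ell2_coord (X n) i - L i))\<^sup>2)"
      by (intro tendsto_intros L)
    have "(\<Sum>i\<in>F. (cmod (ell2_coord (X n) i - ell2_coord (X m) i))\<^sup>2) \<le> e\<^sup>2" if "m \<ge> N" for m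
    proof -
      have "(\<Sum>i\<in>F. (cmod (ell2_coord (X n) i - ell2_coord (X m) i))\<^sup>2) \<le> (norm (X n - X m))\<^sup>2"
        using ell2_finite_sum_le[OF F, of "X n - X m"] by (simp add: minus_ell2.rep_eq)
      also have "\<dots> \<le> e\<^sup>2"
        using N[OF n that] by (intro power_mono) (auto simp: dist_norm)
      finally show ?thesis .
    qed
    then show "\<exists>M. \<forall>m\<ge>M. (\<Sum>i\<in>F. (cmod (ell2_coord (X n) i - ell2_coord (X m) i))\<^sup>2) \<le> e\<^sup>2"
      by blast
  qed
  have diff: "(\<lambda>i. (cmod (ell2_coord (X n) i - L i))\<^sup>2) summable_on UNIV"
    if N: "\<And>m n. m \<ge> N \<Longrightarrow> n \<ge> N \<Longrightarrow> dist (X m) (X n) < e" and n: "n \<ge> N" for e N n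
    using bound[OF N n]
    by (intro nonneg_bdd_above_summable_on) (auto simp: bdd_above_def intro!: exI[of _ "e\<^sup>2"])
  obtain N1 where N1: "\<And>m n. m \<ge> N1 \<Longrightarrow> n \<ge> N1 \<Longrightarrow> dist (X m) (X n) < 1"
    using metric_CauchyD[OF X, of 1] by auto
  have "(\<lambda>i. (cmod (ell2_coord (X N1) i + - (ell2_coord (X N1) i - L i)))\<^sup>2) summable_on UNIV"
    by (intro ell2_summable_add ell2_summable_uminus ell2_coord_square) (rule diff[OF N1 order.refl])
  then have Lmem: "(\<lambda>i. (cmod (L i))\<^sup>2) summable_on UNIV" by simp
  then have coordL: "ell2_coord (Abs_ell2 L) = L"
    by (simp add: Abs_ell2_inverse)
  have "X \<longlonglongrightarrow> Abs_ell2 L"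
  proof (rule metric_LIMSEQ_I)
    fix e :: real assume e: "e > 0"
    then obtain N where N: "\<And>m n. m \<ge> N \<Longrightarrow> n \<ge> N \<Longrightarrow> dist (X m) (X n) < e/2"
      using metric_CauchyD[OF X, of "e/2"] by auto
    have "dist (X n) (Abs_ell2 L) < e" if n: "n \<ge> N" for n
    proof -
      have "(norm (X n - Abs_ell2 L))\<^sup>2 \<le> (e/2)\<^sup>2"
        unfolding ell2_norm_square minus_ell2.rep_eq coordL
        by (rule infsum_le_finite_sums[OF diff[OF N n]]) (auto intro!: bound[OF N n])
      then have "norm (X n - Abs_ell2 L) \<le> e/2"
        using e by (simp add: power2_le_iff_abs_le)
      then show ?thesis using e by (simp add: dist_norm)
    qed
    then show "\<exists>N. \<forall>n\<ge>N. dist (X n) (Abs_ell2 L) < e" by blast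
  qed
  then show "convergent X" by (auto simp: convergent_def)
qed


section \<open>Operators\<close>

definition clinear_on :: "'a::complex_vector set \<Rightarrow> ('a \<Rightarrow> 'b::complex_vector) \<Rightarrow> bool"
  where "clinear_on K T \<longleftrightarrow>
    (\<forall>x\<in>K. \<forall>y\<in>K. T (x + y) = T x + T y) \<and> (\<forall>c. \<forall>x\<in>K. T (c *\<^sub>C x) = c *\<^sub>C T x)"

definition bounded_clinear :: "('a::complex_inner \<Rightarrow> 'b::complex_inner) \<Rightarrow> bool"
  where "bounded_clinear T \<longleftrightarrow> clinear_on UNIV T \<and> (\<exists>B. \<forall>x. norm (T x) \<le> B * norm x)"

definition linear_isometry :: "('a::complex_inner \<Rightarrow> 'b::complex_inner) \<Rightarrow> bool"
  where "linear_isometry V \<longleftrightarrow> clinear_on UNIV V \<and> (\<forall>x. norm (V x) = norm x)"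

text \<open>If the range of \<^term>\<open>V\<close> lies in a closed subspace \<^term>\<open>K\<close>, the restriction of
  \<^term>\<open>cadjoint V\<close> to \<^term>\<open>K\<close> is the adjoint of \<^term>\<open>V\<close> regarded as an operator into
  \<^term>\<open>K\<close>.\<close>

definition cadjoint :: "('a::complex_inner \<Rightarrow> 'b::complex_inner) \<Rightarrow> 'b \<Rightarrow> 'a"
  where "cadjoint V = (THE W. \<forall>x y. cinner (W y) x = cinner y (V x))"

definition closed_csubspace :: "'a::complex_inner set \<Rightarrow> bool"
  where "closed_csubspace K \<longleftrightarrow> closed K \<and> 0 \<in> K \<and>
    (\<forall>x\<in>K. \<forall>y\<in>K. x + y \<in> K) \<and> (\<forall>c. \<forall>x\<in>K. c *\<^sub>C x \<in> K)"

definition unitary_on :: "'a::complex_inner set \<Rightarrow> ('a \<Rightarrow> 'a) \<Rightarrow> bool"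
  where "unitary_on K U \<longleftrightarrow> clinear_on K U \<and> U ` K = K \<and>
    (\<forall>x\<in>K. \<forall>y\<in>K. cinner (U x) (U y) = cinner x y)"

definition op_norm_on :: "'a::complex_inner set \<Rightarrow> ('a \<Rightarrow> 'a) \<Rightarrow> real"
  where "op_norm_on K T = Sup {norm (T v) | v. v \<in> K \<and> norm v \<le> 1}"

text \<open>An \<open>n\<close> by \<open>n\<close> matrix of operators, acting on the \<open>n\<close>-fold direct sum of the Hilbert space.\<close>

definition op_matrix_psd :: "nat \<Rightarrow> (nat \<Rightarrow> nat \<Rightarrow> 'a::complex_inner \<Rightarrow> 'a) \<Rightarrow> bool"
  where "op_matrix_psd n T \<longleftrightarrow>
    (\<forall>u :: nat \<Rightarrow> 'a. (\<Sum>i<n. \<Sum>j<n. cinner (u i) (T i j (u j))) \<in> \<real>\<^sub>\<ge>\<^sub>0)"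


section \<open>Unitary representations\<close>

text \<open>HOL has no quantification over types, so the Hilbert spaces of representations are closed
  subspaces of a Hilbert space type \<^typ>\<open>'u\<close>, the universe. Up to unitary equivalence, these
  are all the Hilbert spaces whose dimension is at most that of \<^typ>\<open>'u\<close>.\<close>

definition unitary_rep ::
  "('g, 'b) monoid_scheme \<Rightarrow> 'u::chilbert_space set \<Rightarrow> ('g \<Rightarrow> 'u \<Rightarrow> 'u) \<Rightarrow> bool"
  where "unitary_rep G K \<pi> \<longleftrightarrow> closed_csubspace K \<and>
    (\<forall>g\<in>carrier G. unitary_on K (\<pi> g)) \<and>
    (\<forall>g\<in>carrier G. \<forall>h\<in>carrier G. \<forall>v\<in>K. \<pi> (g \<otimes>\<^bsub>G\<^esub> h) v = \<pi> g (\<pi> h v))"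

definition invariant_vectors :: "'g set \<Rightarrow> 'u set \<Rightarrow> ('g \<Rightarrow> 'u \<Rightarrow> 'u) \<Rightarrow> 'u set"
  where "invariant_vectors H K \<pi> = {v \<in> K. \<forall>h\<in>H. \<pi> h v = v}"

definition class_one_rep ::
  "('g, 'b) monoid_scheme \<Rightarrow> 'g set \<Rightarrow> 'u::chilbert_space set \<Rightarrow> ('g \<Rightarrow> 'u \<Rightarrow> 'u) \<Rightarrow> bool"
  where "class_one_rep G H K \<pi> \<longleftrightarrow> unitary_rep G K \<pi> \<and> invariant_vectors H K \<pi> \<noteq> {0}"


section \<open>The group algebra and its completion\<close>

text \<open>The group algebra consists of the finitely supported functions of type
  \<^typ>\<open>'g \<Rightarrow>\<^sub>0 complex\<close> whose support lies in the carrier. Its product is not the product of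
  \<^typ>\<open>'g \<Rightarrow>\<^sub>0 complex\<close> in the library, which refers to the additive structure of the type
  \<^typ>\<open>'g\<close>.\<close>

definition group_algebra :: "('g, 'b) monoid_scheme \<Rightarrow> ('g \<Rightarrow>\<^sub>0 complex) set"
  where "group_algebra G = {x. Poly_Mapping.keys x \<subseteq> carrier G}"

definition ga_mult ::
  "('g, 'b) monoid_scheme \<Rightarrow> ('g \<Rightarrow>\<^sub>0 complex) \<Rightarrow> ('g \<Rightarrow>\<^sub>0 complex) \<Rightarrow> ('g \<Rightarrow>\<^sub>0 complex)"
  where "ga_mult G x y = (\<Sum>g\<in>Poly_Mapping.keys x. \<Sum>h\<in>Poly_Mapping.keys y.
    Poly_Mapping.single (g \<otimes>\<^bsub>G\<^esub> h) (Poly_Mapping.lookup x g * Poly_Mapping.lookup y h))"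

definition ga_star :: "('g, 'b) monoid_scheme \<Rightarrow> ('g \<Rightarrow>\<^sub>0 complex) \<Rightarrow> ('g \<Rightarrow>\<^sub>0 complex)"
  where "ga_star G x = (\<Sum>g\<in>Poly_Mapping.keys x.
    Poly_Mapping.single (inv\<^bsub>G\<^esub> g) (cnj (Poly_Mapping.lookup x g)))"

definition lin_ext ::
  "('g \<Rightarrow> 'a \<Rightarrow> 'a::complex_vector) \<Rightarrow> ('g \<Rightarrow>\<^sub>0 complex) \<Rightarrow> 'a \<Rightarrow> 'a"
  where "lin_ext f x v = (\<Sum>g\<in>Poly_Mapping.keys x. Poly_Mapping.lookup x g *\<^sub>C f g v)"

text \<open>Here \<^term>\<open>G\<close> carries the discrete topology, so all unitary representations are
  continuous. The norm of \<^term>\<open>x\<close> in a representation is a supremum of its norms in cyclic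
  subrepresentations, whose dimension is at most \<open>|G|\<close> times the cardinality of
  \<^typ>\<open>nat\<close>; once the dimension of the universe is that large, the supremum below is
  the one over all unitary representations.\<close>

definition ga_norm ::
  "'u::chilbert_space itself \<Rightarrow> ('g, 'b) monoid_scheme \<Rightarrow> ('g \<Rightarrow>\<^sub>0 complex) \<Rightarrow> real"
  where "ga_norm U G x =
    Sup {op_norm_on K (lin_ext \<pi> x) | (K :: 'u set) \<pi>. unitary_rep G K \<pi>}"

text \<open>An element of the completion is the class of a Cauchy sequence of the group algebra modulo
  null sequences.\<close>

definition ga_Cauchy ::
  "'u::chilbert_space itself \<Rightarrow> ('g, 'b) monoid_scheme \<Rightarrow> (nat \<Rightarrow> 'g \<Rightarrow>\<^sub>0 complex) \<Rightarrow> bool"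
  where "ga_Cauchy U G s \<longleftrightarrow> range s \<subseteq> group_algebra G \<and>
    (\<forall>e>0. \<exists>N. \<forall>k\<ge>N. \<forall>l\<ge>N. ga_norm U G (s k - s l) < e)"

text \<open>A matrix \<open>x\<close> over a C*-algebra is positive semidefinite if \<open>x = y\<^sup>* y\<close> for some square
  matrix \<open>y\<close> over the same algebra. Here the entries of \<open>y\<close> are elements of the completion,
  given by Cauchy sequences, and \<open>x\<close> is equated with \<open>y\<^sup>* y\<close> in the completion.\<close>

definition ga_matrix_psd ::
  "'u::chilbert_space itself \<Rightarrow> ('g, 'b) monoid_scheme \<Rightarrow> nat \<Rightarrow>
    (nat \<Rightarrow> nat \<Rightarrow> 'g \<Rightarrow>\<^sub>0 complex) \<Rightarrow> bool"
  where "ga_matrix_psd U G n x \<longleftrightarrow>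
    (\<exists>y. (\<forall>i<n. \<forall>j<n. ga_Cauchy U G (y i j)) \<and>
      (\<forall>i<n. \<forall>j<n.
        (\<lambda>k. ga_norm U G (x i j - (\<Sum>l<n. ga_mult G (ga_star G (y l i k)) (y l j k))))
          \<longlonglongrightarrow> 0))"


section \<open>Partially defined completely positive definite functions\<close>

definition left_cosets :: "('g, 'b) monoid_scheme \<Rightarrow> 'g set \<Rightarrow> 'g set set"
  where "left_cosets G H = {g <#\<^bsub>G\<^esub> H | g. g \<in> carrier G}"

definition symmetric_cosets :: "('g, 'b) monoid_scheme \<Rightarrow> 'g set \<Rightarrow> 'g set set \<Rightarrow> bool"
  where "symmetric_cosets G H \<Gamma> \<longleftrightarrow>
    (\<forall>g\<in>carrier G. g <#\<^bsub>G\<^esub> H \<in> \<Gamma> \<longrightarrow> inv\<^bsub>G\<^esub> g <#\<^bsub>G\<^esub> H \<in> \<Gamma>)"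

definition archimedian_cosets :: "('g, 'b) monoid_scheme \<Rightarrow> 'g set \<Rightarrow> 'g set set \<Rightarrow> bool"
  where "archimedian_cosets G H \<Gamma> \<longleftrightarrow> \<one>\<^bsub>G\<^esub> <#\<^bsub>G\<^esub> H \<in> \<Gamma>"

text \<open>The linear span of the group elements whose coset lies in \<^term>\<open>\<Gamma>\<close>.\<close>

definition coset_algebra ::
  "('g, 'b) monoid_scheme \<Rightarrow> 'g set \<Rightarrow> 'g set set \<Rightarrow> ('g \<Rightarrow>\<^sub>0 complex) set"
  where "coset_algebra G H \<Gamma> = {x \<in> group_algebra G. \<forall>g\<in>Poly_Mapping.keys x. g <#\<^bsub>G\<^esub> H \<in> \<Gamma>}"

definition completely_positive ::
  "'u::chilbert_space itself \<Rightarrow> ('g, 'b) monoid_scheme \<Rightarrow> ('g \<Rightarrow>\<^sub>0 complex) set \<Rightarrow>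
    (('g \<Rightarrow>\<^sub>0 complex) \<Rightarrow> 'h \<Rightarrow> 'h::chilbert_space) \<Rightarrow> bool"
  where "completely_positive U G S \<Phi> \<longleftrightarrow>
    (\<forall>n x. (\<forall>i<n. \<forall>j<n. x i j \<in> S) \<and> ga_matrix_psd U G n x \<longrightarrow>
      op_matrix_psd n (\<lambda>i j. \<Phi> (x i j)))"

definition cp_definite ::
  "'u::chilbert_space itself \<Rightarrow> ('g, 'b) monoid_scheme \<Rightarrow> 'g set \<Rightarrow> 'g set set \<Rightarrow>
    ('g set \<Rightarrow> 'h \<Rightarrow> 'h::chilbert_space) \<Rightarrow> bool"
  where "cp_definite U G H \<Gamma> \<phi> \<longleftrightarrow>
    completely_positive U G (coset_algebra G H \<Gamma>) (lin_ext (\<lambda>g. \<phi> (g <#\<^bsub>G\<^esub> H)))"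

text \<open>This does not force \<^term>\<open>\<phi> (\<one>\<^bsub>G\<^esub> <#\<^bsub>G\<^esub> H) = id\<close>: the zero function satisfies it. A function
  of the form \<open>V\<^sup>* \<pi>(g) V\<close> with an isometry \<open>V\<close> is always normalized in this sense, so the
  normalization has to be stated separately.\<close>

text \<open>A universe for a group on the type \<^typ>\<open>'g\<close> and a Hilbert space \<^typ>\<open>'h\<close>: its dimension
  is at least \<open>|G|\<close> times the cardinality of \<^typ>\<open>'h \<times> nat\<close>, and it is arbitrarily large
  because \<^typ>\<open>'k\<close> is arbitrary.\<close>

type_synonym ('g, 'h, 'k) universe = "('g \<times> 'h \<times> nat \<times> 'k) ell2"

end

theory Submission
  imports Defs
begin

text \<open>Extend \<open>\<phi>\<close> to a completely positive definite function on all of \<open>G\<close>; its Gram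
  decomposition then carries a unitary representation of \<open>G\<close>, and \<open>V u\<close> is the vector at
  \<open>(e, u)\<close>. It is \<open>H\<close>-invariant because \<open>\<phi>(h/H) = 1\<close> forces
  \<open>\<parallel>\<pi>(h) V u - V u\<parallel> = 0\<close>.

  This needs neither Arveson's extension theorem nor the completed group algebra: only a positive
  semidefinite kernel on \<open>G \<times> \<H>\<close>, with \<open>\<H>\<close> treated as a mere index set, has to be found, and this
  is an extension of a positive functional (M. Riesz) from the elements supported in \<open>\<Gamma>\<close> to the free
  complex vector space on \<open>G \<times> \<H> \<times> \<H>\<close>, with the cone of sums of squares. Linearity in \<open>\<H>\<close> need not be
  extended: \<open>V\<close> is linear as soon as it preserves inner products. The extension is a minimal
  sublinear functional, and the Gram decomposition takes place in the given universe by a transfinite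
  Cholesky factorization.\<close>

section \<open>Complex Hilbert spaces\<close>

text \<open>A positive functional extends only if every element of the large space is dominated by
  one supported in \<Gamma>. This is where the Archimedian condition enters: the square of the row
  with entry 1 at \<open>(e, u)\<close> and entry \<open>-c\<close> at \<open>(g, v)\<close> has its
  diagonal part at \<open>e\<close>, so diagonal entries at the identity dominate every single
  entry. Symmetry of \<Gamma> keeps adjoints inside, so a real functional can be tested on
  \<open>w + w*\<close> and a complex one recovered from it.

  Complete positivity is evaluated at the very vectors of \<open>\<H>\<close> that label the rows
  and columns of a matrix; for this reason \<open>\<H>\<close> itself is the index set. The matrices
  tested are finite sums of squares over the group algebra, whose positivity holds exactly, whereas
  the converse has to pass to limits in the norm of the group algebra. Normalization at the identity
  coset is what makes \<open>V\<close> isometric. A zero space \<open>\<H>\<close> stands apart: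
  \<open>V\<close> then yields no nonzero invariant vector.\<close>

lemma cinner_add_left: "cinner (x + y) z = cinner x z + cinner y z"
  by (metis cinner_add_right cinner_commute complex_cnj_add)

lemma cinner_scaleC_left: "cinner (c *\<^sub>C x) y = cnj c * cinner x y"
  by (metis cinner_scaleC_right cinner_commute complex_cnj_mult)

lemma cinner_self: "cinner x x = complex_of_real ((norm x)\<^sup>2)"
proof (rule complex_eqI)
  show "Re (cinner x x) = Re (complex_of_real ((norm x)\<^sup>2))"
    by (simp only: inner_Re_cinner[symmetric] power2_norm_eq_inner Re_complex_of_real)
  have "cnj (cinner x x) = cinner x x"
    by (rule cinner_commute[symmetric])
  then show "Im (cinner x x) = Im (complex_of_real ((norm x)\<^sup>2))"
    by (metis Im_complex_of_real Reals_cnj_iff complex_is_Real_iff)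
qed

lemma Im_cinner: "Im (cinner x y) = inner (\<i> *\<^sub>C x) y"
  by (simp add: inner_Re_cinner cinner_scaleC_left)

lemma norm_scaleC: "norm (c *\<^sub>C x) = cmod c * norm (x :: 'a::complex_inner)"
proof -
  have "complex_of_real ((norm (c *\<^sub>C x))\<^sup>2) = complex_of_real ((cmod c * norm x)\<^sup>2)"
    unfolding cinner_self[symmetric] cinner_scaleC_left cinner_scaleC_right
    by (simp add: cinner_self complex_norm_square power_mult_distrib mult.assoc[symmetric] mult.commute
        del: of_real_power)
  then show ?thesis
    unfolding of_real_eq_iff by (simp add: power2_eq_iff_nonneg)
qed

text \<open>Multiplying \<open>x\<close> by the phase of \<open>cinner x y\<close> makes the inner
  product real and nonnegative, which reduces the claim to the real Cauchy-Schwarz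
  inequality.\<close>

lemma cmod_cinner_le: "cmod (cinner x y) \<le> norm x * norm y"
proof (cases "cinner x y = 0")
  case False
  define c where "c = cinner x y / of_real (cmod (cinner x y))"
  have c: "cmod c = 1" using False by (simp add: c_def norm_divide)
  have "cinner (c *\<^sub>C x) y = of_real (cmod (cinner x y))"
    using False complex_norm_square[of "cinner x y"]
    by (simp add: c_def cinner_scaleC_left power2_eq_square field_simps)
  then have "cmod (cinner x y) = inner (c *\<^sub>C x) y"
    by (simp add: inner_Re_cinner)
  also have "\<dots> \<le> norm (c *\<^sub>C x) * norm y"
    by (rule norm_cauchy_schwarz)
  finally show ?thesis by (simp add: norm_scaleC c)
qed simp

interpretation cinner: bounded_bilinear cinner
proof
  show "cinner (r *\<^sub>R x) y = r *\<^sub>R cinner x y" "cinner x (r *\<^sub>R y) = r *\<^sub>R cinner x y"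
    for r and x y :: 'a
    by (simp_all add: scaleR_scaleC cinner_scaleC_left cinner_scaleC_right scaleR_conv_of_real)
  show "\<exists>K. \<forall>x y :: 'a. cmod (cinner x y) \<le> norm x * norm y * K"
    by (rule exI[of _ 1]) (simp add: cmod_cinner_le)
qed (simp_all add: cinner_add_left cinner_add_right)

interpretation scaleC: bounded_bilinear "scaleC :: complex \<Rightarrow> 'a \<Rightarrow> 'a::complex_inner"
proof
  show "(r *\<^sub>R c) *\<^sub>C x = r *\<^sub>R c *\<^sub>C x" "c *\<^sub>C r *\<^sub>R x = r *\<^sub>R c *\<^sub>C x" for r c and x :: 'a
    by (simp_all add: scaleR_scaleC scaleC_scaleC scaleR_conv_of_real mult.commute)
  show "\<exists>K. \<forall>c (x :: 'a). norm (c *\<^sub>C x) \<le> norm c * norm x * K"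
    by (rule exI[of _ 1]) (simp add: norm_scaleC)
qed (simp_all add: scaleC_add_left scaleC_add_right)

lemma cinner_ext:
  assumes "\<And>x. cinner x y = cinner x z"
  shows "y = z"
proof -
  have "cinner (y - z) (y - z) = 0"
    using assms by (simp add: cinner.diff_right)
  then show ?thesis by (simp add: cinner_self)
qed

lemma closed_csubspace_closure:
  assumes "0 \<in> S" and add: "\<And>x y. x \<in> S \<Longrightarrow> y \<in> S \<Longrightarrow> x + y \<in> S"
    and scale: "\<And>c x. x \<in> S \<Longrightarrow> c *\<^sub>C x \<in> S"
  shows "closed_csubspace (closure S)"
  unfolding closed_csubspace_def
proof (intro conjI ballI allI)
  show "closed (closure S)" by simp
  show "0 \<in> closure S" using assms(1) closure_subset by blast
  fix x y assume "x \<in> closure S" "y \<in> closure S"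
  then obtain X Y where "\<And>n. X n \<in> S" "X \<longlonglongrightarrow> x" "\<And>n. Y n \<in> S" "Y \<longlonglongrightarrow> y"
    unfolding closure_sequential by blast
  then show "x + y \<in> closure S"
    unfolding closure_sequential by (intro exI[of _ "\<lambda>n. X n + Y n"]) (auto intro: add tendsto_add)
next
  fix c x assume "x \<in> closure S"
  then obtain X where "\<And>n. X n \<in> S" "X \<longlonglongrightarrow> x"
    unfolding closure_sequential by blast
  then show "c *\<^sub>C x \<in> closure S"
    unfolding closure_sequential
    by (intro exI[of _ "\<lambda>n. c *\<^sub>C X n"]) (auto intro: scale scaleC.tendsto)
qed

text \<open>Riesz representation on the closure of the range of a linear map: the representing vector is
  the limit of a minimizing sequence of \<open>\<parallel>T c\<parallel>\<^sup>2 - 2 L c\<close>.\<close>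

lemma real_representer:
  fixes T :: "'e::real_vector \<Rightarrow> 'u::{real_inner,complete_space}" and L :: "'e \<Rightarrow> real"
  assumes T: "linear T" and L: "linear L" and M: "0 \<le> M" "\<And>c. \<bar>L c\<bar> \<le> M * norm (T c)"
  obtains \<eta> where "\<eta> \<in> closure (range T)" "\<And>c. inner \<eta> (T c) = L c" "norm \<eta> \<le> M"
proof -
  define \<Phi> where "\<Phi> c = (norm (T c))\<^sup>2 - 2 * L c" for c
  define m where "m = Inf (range \<Phi>)"
  \<comment> \<open>Completing the square bounds \<Phi> from below, so the infimum \<open>m\<close>
    is meaningful.\<close>
  have "- M\<^sup>2 \<le> \<Phi> c" for c
  proof -
    have "0 \<le> (norm (T c) - M)\<^sup>2" by simp
    also have "\<dots> = (norm (T c))\<^sup>2 - 2 * (M * norm (T c)) + M\<^sup>2"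
      by (simp add: power2_diff)
    finally show ?thesis using M(2)[of c] by (simp add: \<Phi>_def)
  qed
  then have bdd: "bdd_below (range \<Phi>)" by (auto simp: bdd_below_def)
  have m_le: "m \<le> \<Phi> c" for c
    unfolding m_def by (rule cInf_lower[OF _ bdd]) simp
  have "\<exists>c. \<Phi> c < m + e" if "e > 0" for e
    using cInf_lessD[of "range \<Phi>" "m + e"] that by (auto simp: m_def)
  then have "\<exists>c. \<Phi> c < m + 1 / Suc n" for n by simp
  then obtain d where d: "\<And>n. \<Phi> (d n) < m + 1 / Suc n" by metis
  \<comment> \<open>Parallelogram law at the midpoint of \<open>a\<close> and \<open>b\<close>: the
    linear terms cancel, and \<Phi> at the midpoint is at least \<open>m\<close>. Hence the images
    of a minimizing sequence are Cauchy.\<close>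
  have par: "(norm (T a - T b))\<^sup>2 \<le> 2 * \<Phi> a + 2 * \<Phi> b - 4 * m" for a b
  proof -
    define c where "c = (1/2) *\<^sub>R (a + b)"
    have "2 * L c = L a + L b"
      by (simp add: c_def linear_cmul[OF L] linear_add[OF L])
    moreover have "4 * (norm (T c))\<^sup>2 = (norm (T a + T b))\<^sup>2"
      by (simp add: c_def linear_cmul[OF T] linear_add[OF T] power_divide)
    moreover have "(norm (T a + T b))\<^sup>2 + (norm (T a - T b))\<^sup>2
        = 2 * (norm (T a))\<^sup>2 + 2 * (norm (T b))\<^sup>2"
      by (simp add: power2_norm_eq_inner inner_add_left inner_add_right inner_diff_left
          inner_diff_right inner_commute)
    ultimately show ?thesis
      using m_le[of c] unfolding \<Phi>_def by argo
  qed
  have "Cauchy (\<lambda>n. T (d n))"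
  proof (rule metric_CauchyI)
    fix e :: real assume "e > 0"
    then obtain N where N: "1 / Suc N < e\<^sup>2 / 4"
      using reals_Archimedean[of "e\<^sup>2 / 4"] by (auto simp: inverse_eq_divide)
    have "dist (T (d k)) (T (d l)) < e" if "k \<ge> N" "l \<ge> N" for k l
    proof -
      have small: "\<Phi> (d j) < m + e\<^sup>2 / 4" if "j \<ge> N" for j
        using d[of j] N that by (smt (verit) frac_le of_nat_0_less_iff of_nat_mono Suc_le_mono zero_less_Suc)
      have "(dist (T (d k)) (T (d l)))\<^sup>2 < e\<^sup>2"
        using par[of "d k" "d l"] small[OF that(1)] small[OF that(2)] by (simp add: dist_norm)
      then show ?thesis using \<open>e > 0\<close> by (simp add: power2_less_imp_less)
    qed
    then show "\<exists>M. \<forall>k\<ge>M. \<forall>l\<ge>M. dist (T (d k)) (T (d l)) < e" by blast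
  qed
  then obtain \<eta> where \<eta>: "(\<lambda>n. T (d n)) \<longlonglongrightarrow> \<eta>"
    using Cauchy_convergent convergent_def by blast
  have "(\<lambda>n. 1 / real (Suc n)) \<longlonglongrightarrow> 0" by (rule LIMSEQ_Suc[OF lim_1_over_n])
  then have lim0: "(\<lambda>n. m + 1 / real (Suc n)) \<longlonglongrightarrow> m"
    using tendsto_add[OF tendsto_const[of m]] by fastforce
  \<comment> \<open>The first variation at the minimum. \<Phi> lives on the domain of
    \<open>T\<close>, where the minimizer need not have a preimage, so the inequality is proved at
    \<open>d n\<close> up to the error \<open>1 / Suc n\<close> and passed to the limit.\<close>
  have stat: "0 \<le> t\<^sup>2 * (norm (T c))\<^sup>2 + 2 * t * (inner \<eta> (T c) - L c)" for t c
  proof -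
    have "m - (m + 1 / real (Suc n)) \<le> t\<^sup>2 * (norm (T c))\<^sup>2 + 2 * t * (inner (T (d n)) (T c) - L c)" for n
    proof -
      have "\<Phi> (d n + t *\<^sub>R c) - \<Phi> (d n)
          = t\<^sup>2 * (norm (T c))\<^sup>2 + 2 * t * (inner (T (d n)) (T c) - L c)"
        unfolding \<Phi>_def linear_add[OF T] linear_add[OF L] linear_cmul[OF T] linear_cmul[OF L]
          power2_norm_eq_inner
        by (simp add: inner_add_left inner_add_right inner_commute power2_eq_square algebra_simps)
      then show ?thesis using m_le[of "d n + t *\<^sub>R c"] d[of n] by linarith
    qed
    moreover have "(\<lambda>n. m - (m + 1 / real (Suc n))) \<longlonglongrightarrow> m - m"
      by (intro tendsto_diff tendsto_const lim0)
    moreover have "(\<lambda>n. t\<^sup>2 * (norm (T c))\<^sup>2 + 2 * t * (inner (T (d n)) (T c) - L c))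
        \<longlonglongrightarrow> t\<^sup>2 * (norm (T c))\<^sup>2 + 2 * t * (inner \<eta> (T c) - L c)"
      by (intro tendsto_intros \<eta>)
    ultimately show ?thesis
      using LIMSEQ_le[of _ "m - m"] by auto
  qed
  have eq: "inner \<eta> (T c) = L c" for c
  proof (rule ccontr)
    define b where "b = inner \<eta> (T c) - L c"
    \<comment> \<open>The summand 1 keeps \<open>a\<close> positive even if \<open>T c = 0\<close>;
      at \<open>t = - (b / a)\<close> the first variation becomes
      \<open>- (b\<^sup>2 / a) - (b / a)\<^sup>2\<close>, which is negative.\<close>
    define a where "a = (norm (T c))\<^sup>2 + 1"
    assume "inner \<eta> (T c) \<noteq> L c"
    then have b: "b \<noteq> 0" by (simp add: b_def)
    have a: "a > 0" by (simp add: a_def add_nonneg_pos)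
    have neg: "- x - y < 0" if "0 < x" "0 < y" for x y :: real
      using that by simp
    have "0 \<le> (b / a)\<^sup>2 * (a - 1) - 2 * (b / a) * b"
      using stat[of "- (b / a)" c] by (simp add: a_def b_def)
    also have "\<dots> = - (b\<^sup>2 / a) - (b / a)\<^sup>2"
      using a by (simp add: field_simps power2_eq_square)
    also have "\<dots> < 0"
      using a b by (intro neg) simp_all
    finally show False by simp
  qed
  show ?thesis
  proof (rule that)
    show "\<eta> \<in> closure (range T)"
      unfolding closure_sequential using \<eta> by (intro exI[of _ "\<lambda>n. T (d n)"]) simp
    show "inner \<eta> (T c) = L c" for c by (rule eq)
    have "inner \<eta> \<eta> \<le> M * norm \<eta>"
    proof (rule LIMSEQ_le)
      show "(\<lambda>n. inner \<eta> (T (d n))) \<longlonglongrightarrow> inner \<eta> \<eta>" by (intro tendsto_intros \<eta>)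
      show "(\<lambda>n. M * norm (T (d n))) \<longlonglongrightarrow> M * norm \<eta>" by (intro tendsto_intros \<eta>)
      have "inner \<eta> (T (d n)) \<le> M * norm (T (d n))" for n
        unfolding eq by (rule order.trans[OF abs_ge_self M(2)])
      then show "\<exists>N. \<forall>n\<ge>N. inner \<eta> (T (d n)) \<le> M * norm (T (d n))" by blast
    qed
    then have "norm \<eta> * norm \<eta> \<le> M * norm \<eta>"
      unfolding power2_norm_eq_inner[symmetric] power2_eq_square .
    then show "norm \<eta> \<le> M"
      using M(1) mult_right_le_imp_le[of "norm \<eta>" "norm \<eta>" M] by (cases "\<eta> = 0") auto
  qed
qed

section \<open>Adjoints and inner products preserved by isometries\<close>

lemma clinear_on_UNIV_linear:
  assumes "clinear_on UNIV T"
  shows "linear T"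
  using assms by (intro linearI) (auto simp: clinear_on_def scaleR_scaleC)

text \<open>Representing \<open>inner y (V x)\<close> with \<open>T = id\<close> gives the adjoint
  for real parts, and replacing \<open>x\<close> by \<open>\<i> *\<^sub>C x\<close> gives the
  imaginary parts. Uniqueness is nondegeneracy of \<open>cinner\<close>, so the description
  \<open>THE W\<close> in \<open>cadjoint\<close> denotes this map.\<close>

lemma cinner_cadjoint:
  fixes V :: "'a::chilbert_space \<Rightarrow> 'b::complex_inner"
  assumes V: "bounded_clinear V"
  shows "cinner (cadjoint V y) x = cinner y (V x)"
proof -
  have lin: "clinear_on UNIV V" and "\<exists>B. \<forall>x. norm (V x) \<le> B * norm x"
    using V by (auto simp: bounded_clinear_def)
  then obtain B where B: "\<And>x. norm (V x) \<le> B * norm x" by blast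
  have "\<exists>w. \<forall>x. cinner w x = cinner y (V x)" for y
  proof -
    have "linear (id :: 'a \<Rightarrow> 'a)" by (rule linear_id)
    moreover have "linear (\<lambda>x. inner y (V x))"
      using clinear_on_UNIV_linear[OF lin]
      by (intro linearI) (simp_all add: linear_add linear_cmul inner_add_right)
    moreover have "\<bar>inner y (V x)\<bar> \<le> norm y * \<bar>B\<bar> * norm (id x)" for x
    proof -
      have "\<bar>inner y (V x)\<bar> \<le> norm y * norm (V x)" by (rule Cauchy_Schwarz_ineq2)
      also have "\<dots> \<le> norm y * (\<bar>B\<bar> * norm x)"
        using B[of x] mult_right_mono[OF abs_ge_self[of B], of "norm x"]
        by (intro mult_left_mono) auto
      finally show ?thesis by (simp add: mult.assoc)
    qed
    ultimately obtain w where w: "\<And>x. inner w (id x) = inner y (V x)"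
      using real_representer[of "id :: 'a \<Rightarrow> 'a" "\<lambda>x. inner y (V x)" "norm y * \<bar>B\<bar>"]
      by (metis abs_ge_zero mult_nonneg_nonneg norm_ge_zero)
    have "cinner w x = cinner y (V x)" for x
    proof (rule complex_eqI)
      show "Re (cinner w x) = Re (cinner y (V x))"
        using w[of x] by (simp add: inner_Re_cinner)
      have "V (\<i> *\<^sub>C x) = \<i> *\<^sub>C V x" using lin by (simp add: clinear_on_def)
      then show "Im (cinner w x) = Im (cinner y (V x))"
        using w[of "\<i> *\<^sub>C x"] by (simp add: inner_Re_cinner cinner_scaleC_right)
    qed
    then show ?thesis by blast
  qed
  then obtain W where W: "\<And>y x. cinner (W y) x = cinner y (V x)" by metis
  have "cadjoint V = W"
    unfolding cadjoint_def
  proof (rule the_equality)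
    show "\<forall>x y. cinner (W y) x = cinner y (V x)" using W by blast
    fix W' assume "\<forall>x y. cinner (W' y) x = cinner y (V x)"
    then show "W' = W"
      by (intro ext cinner_ext) (metis W cinner_commute)
  qed
  then show ?thesis by (simp add: W)
qed

lemma linear_isometry_bounded_clinear: "linear_isometry V \<Longrightarrow> bounded_clinear V"
  unfolding linear_isometry_def bounded_clinear_def by (auto intro: exI[of _ 1])

text \<open>Polarization: expanding the norm of \<open>x + y\<close> gives the real part, and
  \<open>\<i> *\<^sub>C x\<close> in place of \<open>x\<close> the imaginary part. The set
  \<open>K\<close> allows for operators that are unitary only on a subspace.\<close>

lemma norm_preserving_cinner:
  assumes K: "\<And>x y. x \<in> K \<Longrightarrow> y \<in> K \<Longrightarrow> x + y \<in> K" "\<And>c x. x \<in> K \<Longrightarrow> c *\<^sub>C x \<in> K"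
    and lin: "clinear_on K U" and norm: "\<And>x. x \<in> K \<Longrightarrow> norm (U x) = norm x"
    and xy: "x \<in> K" "y \<in> K"
  shows "cinner (U x) (U y) = cinner x y"
proof -
  have *: "inner (U x) (U y) = inner x y" if "x \<in> K" "y \<in> K" for x y
  proof -
    have "U (x + y) = U x + U y" using lin that by (simp add: clinear_on_def)
    then have "(norm (U x + U y))\<^sup>2 = (norm (x + y))\<^sup>2"
      using norm[of "x + y"] K(1)[OF that] by simp
    moreover have "inner (U x) (U x) = inner x x" "inner (U y) (U y) = inner y y"
      using norm that by (simp_all add: power2_norm_eq_inner[symmetric])
    ultimately show ?thesis
      by (simp add: power2_norm_eq_inner inner_add_left inner_add_right inner_commute)
  qed
  have "U (\<i> *\<^sub>C x) = \<i> *\<^sub>C U x" using lin xy by (simp add: clinear_on_def)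
  then show ?thesis
    using *[OF xy] *[OF K(2)[OF xy(1), of \<i>] xy(2)]
    by (intro complex_eqI) (simp_all add: inner_Re_cinner[symmetric] Im_cinner)
qed

section \<open>Extension of positive functionals\<close>

text \<open>Homogeneity is an inequality because infima inherit it directly; equality is recovered
  by rescaling with \<open>1/t\<close>.\<close>

definition sublinear :: "('w::real_vector \<Rightarrow> real) \<Rightarrow> bool"
  where "sublinear q \<longleftrightarrow> (\<forall>x y. q (x + y) \<le> q x + q y) \<and> (\<forall>t\<ge>0. \<forall>x. q (t *\<^sub>R x) \<le> t * q x)"

lemma sublinear_zero:
  assumes "sublinear q"
  shows "q 0 = 0"
proof -
  have "q (0 + 0) \<le> q 0 + q 0" "q (0 *\<^sub>R 0) \<le> 0 * q 0"
    using assms unfolding sublinear_def by blast+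
  then show ?thesis by simp
qed

lemma sublinear_ge:
  assumes "sublinear q"
  shows "- q (- x) \<le> q x"
proof -
  have "q (x + - x) \<le> q x + q (- x)"
    using assms unfolding sublinear_def by blast
  then show ?thesis using sublinear_zero[OF assms] by simp
qed

lemma sublinear_scaleR:
  assumes "sublinear q" "0 \<le> t"
  shows "q (t *\<^sub>R x) = t * q x"
proof (cases "t = 0")
  case True then show ?thesis by (simp add: sublinear_zero[OF assms(1)])
next
  case False
  then have t: "t > 0" using assms(2) by simp
  have "q ((1/t) *\<^sub>R t *\<^sub>R x) \<le> (1/t) * q (t *\<^sub>R x)"
    using assms t unfolding sublinear_def by (metis less_imp_le divide_nonneg_pos zero_le_one)
  then have "t * q x \<le> q (t *\<^sub>R x)" using t by (simp add: field_simps)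
  then show ?thesis using assms unfolding sublinear_def by (simp add: order.antisym)
qed

text \<open>All members lie above \<open>- p (- x)\<close>, by subadditivity and domination by
  \<open>p\<close>, so the infima are finite. Subadditivity of the infimum compares two members
  \<open>q\<close> and \<open>r\<close>, and in a chain the smaller of them serves for both.\<close>

lemma sublinear_INF_chain:
  assumes "C \<noteq> {}" and sub: "\<And>q. q \<in> C \<Longrightarrow> sublinear q"
    and chain: "\<And>q r. q \<in> C \<Longrightarrow> r \<in> C \<Longrightarrow> q \<le> r \<or> r \<le> q"
    and p: "\<And>q. q \<in> C \<Longrightarrow> q \<le> p"
  shows "sublinear (\<lambda>x. INF q\<in>C. q x)" "\<And>q. q \<in> C \<Longrightarrow> (\<lambda>x. INF q\<in>C. q x) \<le> q"
proof -
  have "- p (- x) \<le> q x" if "q \<in> C" for q x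
    using sublinear_ge[OF sub[OF that], of x] le_funD[OF p[OF \<open>q \<in> C\<close>], of "- x"] by linarith
  then have bdd: "bdd_below ((\<lambda>q. q x) ` C)" for x
    by (auto simp: bdd_below_def)
  have le: "(INF q\<in>C. q x) \<le> q x" if "q \<in> C" for q x
    by (rule cINF_lower[OF bdd that])
  show "(\<lambda>x. INF q\<in>C. q x) \<le> q" if "q \<in> C" for q
    using le[OF that] by (simp add: le_fun_def)
  have greatest: "z \<le> (INF q\<in>C. q x)" if "\<And>q. q \<in> C \<Longrightarrow> z \<le> q x" for z x
    using cINF_greatest[OF assms(1) that] .
  show "sublinear (\<lambda>x. INF q\<in>C. q x)"
    unfolding sublinear_def
  proof (intro conjI allI impI)
    fix x y
    have "(INF q\<in>C. q (x + y)) \<le> q x + r y" if qr: "q \<in> C" "r \<in> C" for q r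
    proof -
      obtain s where s: "s \<in> C" "s \<le> q" "s \<le> r"
        using chain[OF qr] qr by blast
      have "s (x + y) \<le> s x + s y" using sub[OF s(1)] by (simp add: sublinear_def)
      also have "\<dots> \<le> q x + r y" using s by (intro add_mono) (auto simp: le_fun_def)
      finally show ?thesis using le[OF s(1), of "x + y"] by linarith
    qed
    note H = this
    have "(INF q\<in>C. q (x + y)) - q x \<le> (INF r\<in>C. r y)" if "q \<in> C" for q
      by (intro greatest) (subst diff_le_eq, rule order.trans[OF H[OF that]], assumption, simp)
    then have "(INF q\<in>C. q (x + y)) - (INF r\<in>C. r y) \<le> (INF q\<in>C. q x)"
      by (intro greatest) (simp add: algebra_simps)
    then show "(INF q\<in>C. q (x + y)) \<le> (INF q\<in>C. q x) + (INF q\<in>C. q y)" by simp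
  next
    fix t :: real and x assume t: "0 \<le> t"
    show "(INF q\<in>C. q (t *\<^sub>R x)) \<le> t * (INF q\<in>C. q x)"
    proof (cases "t = 0")
      case True
      obtain q where "q \<in> C" using assms(1) by blast
      then show ?thesis using le[of q 0] sublinear_zero[OF sub] True by force
    next
      case False
      have "(INF q\<in>C. q (t *\<^sub>R x)) / t \<le> q x" if "q \<in> C" for q
        using le[OF that, of "t *\<^sub>R x"] sublinear_scaleR[OF sub[OF that] t, of x] False t
        by (simp add: field_simps)
      then have "(INF q\<in>C. q (t *\<^sub>R x)) / t \<le> (INF q\<in>C. q x)" by (rule greatest)
      then show ?thesis using False t by (simp add: field_simps)
    qed
  qed
qed

text \<open>For fixed \<open>y\<close>, the infimum over \<open>t \<ge> 0\<close> of
  \<open>q (x + t *\<^sub>R y) - t * q y\<close> is a sublinear functional of \<open>x\<close> below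
  \<open>q\<close>. Minimality makes it equal to \<open>q\<close>, and the term \<open>t = 1\<close>
  then gives \<open>q x + q y \<le> q (x + y)\<close>.\<close>

lemma minimal_sublinear_linear:
  assumes q: "sublinear q" and min: "\<And>r. sublinear r \<Longrightarrow> r \<le> q \<Longrightarrow> r = q"
  shows "linear q"
proof -
  have sub: "q (x + y) \<le> q x + q y" for x y using q by (simp add: sublinear_def)
  have "q (x + y) = q x + q y" for x y
  proof -
    define r where "r x = (INF t\<in>{0..}. q (x + t *\<^sub>R y) - t * q y)" for x
    have bdd: "bdd_below ((\<lambda>t. q (x + t *\<^sub>R y) - t * q y) ` {0..})" for x
    proof -
      have "- q (- x) \<le> q (x + t *\<^sub>R y) - t * q y" if "t \<ge> 0" for t
        using sub[of "x + t *\<^sub>R y" "- x"] sublinear_scaleR[OF q that, of y] by simp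
      then show ?thesis by (auto simp: bdd_below_def)
    qed
    have r_le: "r x \<le> q (x + t *\<^sub>R y) - t * q y" if "t \<ge> 0" for x t
      unfolding r_def using that by (intro cINF_lower[OF bdd]) simp
    have r_ge: "z \<le> r x" if "\<And>t. t \<ge> 0 \<Longrightarrow> z \<le> q (x + t *\<^sub>R y) - t * q y" for z x
      unfolding r_def using that by (intro cINF_greatest) auto
    have "sublinear r"
      unfolding sublinear_def
    proof (intro conjI allI impI)
      fix a b
      have "r (a + b) \<le> (q (a + t *\<^sub>R y) - t * q y) + (q (b + s *\<^sub>R y) - s * q y)"
        if "t \<ge> 0" "s \<ge> 0" for t s
        using r_le[of "t + s" "a + b"] sub[of "a + t *\<^sub>R y" "b + s *\<^sub>R y"] that
        by (simp add: algebra_simps)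
      note H = this
      have "r (a + b) - (q (a + t *\<^sub>R y) - t * q y) \<le> r b" if "t \<ge> 0" for t
        by (intro r_ge) (subst diff_le_eq, rule order.trans[OF H[OF that]], assumption, simp)
      then have "r (a + b) - r b \<le> r a"
        by (intro r_ge) (simp add: algebra_simps)
      then show "r (a + b) \<le> r a + r b" by simp
    next
      fix c :: real and x assume c: "0 \<le> c"
      show "r (c *\<^sub>R x) \<le> c * r x"
      proof (cases "c = 0")
        case True
        then show ?thesis using r_le[of 0 0] sublinear_zero[OF q] by simp
      next
        case False
        have "r (c *\<^sub>R x) / c \<le> q (x + t *\<^sub>R y) - t * q y" if "t \<ge> 0" for t
        proof -
          have "r (c *\<^sub>R x) \<le> q (c *\<^sub>R (x + t *\<^sub>R y)) - c * t * q y"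
            using r_le[of "c * t" "c *\<^sub>R x"] c that by (simp add: scaleR_add_right)
          also have "\<dots> = c * (q (x + t *\<^sub>R y) - t * q y)"
            unfolding sublinear_scaleR[OF q c] by (simp add: algebra_simps)
          finally show ?thesis using c False by (simp add: field_simps)
        qed
        then have "r (c *\<^sub>R x) / c \<le> r x" by (rule r_ge)
        then show ?thesis using c False by (simp add: field_simps)
      qed
    qed
    moreover have "r \<le> q" using r_le[of 0] by (simp add: le_fun_def)
    ultimately have "r = q" by (rule min)
    then show ?thesis using r_le[of 1 x] sub[of x y] by simp
  qed
  note add = this
  have minus: "q (- x) = - q x" for x
    using add[of x "- x"] sublinear_zero[OF q] by simp
  show ?thesis
  proof (rule linearI)
    fix c x show "q (c *\<^sub>R x) = c *\<^sub>R q x"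
    proof (cases "c \<ge> 0")
      case True then show ?thesis using sublinear_scaleR[OF q] by simp
    next
      case False
      then have "q ((- c) *\<^sub>R x) = (- c) * q x" by (intro sublinear_scaleR[OF q]) simp
      then show ?thesis using minus[of "c *\<^sub>R x"] by simp
    qed
  qed (rule add)
qed

lemma linear_below_sublinear:
  fixes p :: "'w::real_vector \<Rightarrow> real"
  assumes p: "sublinear p"
  obtains F where "linear F" "F \<le> p"
proof -
  define A where "A = {q. sublinear q \<and> q \<le> p}"
  \<comment> \<open>The order is reversed so that the maximal element provided by Zorn's lemma is a
    minimal functional.\<close>
  let ?P = "\<lambda>q r. r \<le> (q :: 'w \<Rightarrow> real)"
  have "\<exists>m\<in>A. \<forall>a\<in>A. ?P m a \<longrightarrow> a = m"
  proof (rule predicate_Zorn)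
    show "partial_order_on A (relation_of ?P A)"
      by (rule partial_order_on_relation_ofI) auto
    fix C assume C: "C \<in> Chains (relation_of ?P A)"
    then have CA: "C \<subseteq> A" and chain: "\<And>q r. q \<in> C \<Longrightarrow> r \<in> C \<Longrightarrow> q \<le> r \<or> r \<le> q"
      by (auto simp: Chains_def relation_of_def)
    show "\<exists>u\<in>A. \<forall>a\<in>C. u \<le> a"
    proof (cases "C = {}")
      case True then show ?thesis using p by (auto simp: A_def)
    next
      case False
      have "sublinear (\<lambda>x. INF q\<in>C. q x)" "\<And>q. q \<in> C \<Longrightarrow> (\<lambda>x. INF q\<in>C. q x) \<le> q"
        using sublinear_INF_chain[of C p] False CA chain by (auto simp: A_def)
      moreover obtain q where "q \<in> C" using False by blast
      ultimately show ?thesis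
        using CA by (intro bexI[of _ "\<lambda>x. INF q\<in>C. q x"]) (auto simp: A_def intro: order.trans)
    qed
  qed
  then obtain m where "m \<in> A" "\<And>a. a \<in> A \<Longrightarrow> a \<le> m \<Longrightarrow> a = m" by blast
  then have "linear m" "m \<le> p"
    by (auto simp: A_def intro!: minimal_sublinear_linear intro: order.trans)
  then show ?thesis by (rule that)
qed

text \<open>The sublinear majorant at \<open>w\<close> is the infimum of \<open>f s\<close> over the
  \<open>s\<close> in \<open>S\<close> that dominate \<open>w\<close> in the order given by
  \<open>C\<close>. A linear \<open>F\<close> below it satisfies \<open>F \<le> f\<close> on
  \<open>S\<close>, with equality because \<open>S\<close> contains negatives, and
  \<open>F (- w) \<le> f 0 = 0\<close> for \<open>w\<close> in \<open>C\<close>, because 0 dominates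
  \<open>- w\<close>.\<close>

theorem positive_extension:
  fixes f :: "'w::real_vector \<Rightarrow> real"
  assumes S: "subspace S" and f: "linear f"
    and C0: "0 \<in> C" and Cadd: "\<And>x y. x \<in> C \<Longrightarrow> y \<in> C \<Longrightarrow> x + y \<in> C"
    and Cscale: "\<And>t x. t \<ge> 0 \<Longrightarrow> x \<in> C \<Longrightarrow> t *\<^sub>R x \<in> C"
    and dom: "\<And>w. \<exists>s\<in>S. s - w \<in> C"
    and pos: "\<And>s. s \<in> S \<Longrightarrow> s \<in> C \<Longrightarrow> 0 \<le> f s"
  obtains F where "linear F" "\<And>s. s \<in> S \<Longrightarrow> F s = f s" "\<And>w. w \<in> C \<Longrightarrow> 0 \<le> F w"
proof -
  define p where "p w = Inf (f ` {s \<in> S. s - w \<in> C})" for w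
  have bdd: "bdd_below (f ` {s \<in> S. s - w \<in> C})" for w
  proof -
    \<comment> \<open>An upper bound of \<open>- w\<close> is, up to sign, a lower bound for all
      \<open>s\<close> that dominate \<open>w\<close>: the sum \<open>s + s'\<close> is in the
      cone.\<close>
    obtain s' where s': "s' \<in> S" "s' - (- w) \<in> C" using dom by blast
    have "- f s' \<le> f s" if "s \<in> S" "s - w \<in> C" for s
    proof -
      have "s + s' \<in> C" using Cadd[OF that(2) s'(2)] by simp
      then have "0 \<le> f (s + s')" using that s' S by (intro pos) (auto simp: subspace_add)
      then show ?thesis by (simp add: linear_add[OF f])
    qed
    then show ?thesis by (auto simp: bdd_below_def)
  qed
  have p_le: "p w \<le> f s" if "s \<in> S" "s - w \<in> C" for s w
    unfolding p_def using that by (intro cInf_lower bdd) auto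
  have p_ge: "z \<le> p w" if "\<And>s. s \<in> S \<Longrightarrow> s - w \<in> C \<Longrightarrow> z \<le> f s" for z w
    unfolding p_def using that dom[of w] by (intro cInf_greatest) auto
  have "sublinear p"
    unfolding sublinear_def
  proof (intro conjI allI impI)
    fix x y
    have "p (x + y) \<le> f s + f s'" if "s \<in> S" "s - x \<in> C" "s' \<in> S" "s' - y \<in> C" for s s'
      using p_le[of "s + s'" "x + y"] Cadd[OF that(2,4)] that S
      by (simp add: subspace_add linear_add[OF f] algebra_simps)
    note H = this
    have "p (x + y) - f s \<le> p y" if "s \<in> S" "s - x \<in> C" for s
      by (intro p_ge) (subst diff_le_eq, rule order.trans[OF H[OF that]], assumption, assumption, simp)
    then have "p (x + y) - p y \<le> p x"
      by (intro p_ge) (simp add: algebra_simps)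
    then show "p (x + y) \<le> p x + p y" by simp
  next
    fix t :: real and x assume t: "0 \<le> t"
    show "p (t *\<^sub>R x) \<le> t * p x"
    proof (cases "t = 0")
      case True
      then show ?thesis using p_le[of 0 0] C0 S by (simp add: subspace_0 linear_0[OF f])
    next
      case False
      have "p (t *\<^sub>R x) / t \<le> f s" if "s \<in> S" "s - x \<in> C" for s
        using p_le[of "t *\<^sub>R s" "t *\<^sub>R x"] Cscale[OF t that(2)] that S t False
        by (simp add: subspace_scale linear_cmul[OF f] scaleR_diff_right field_simps)
      then have "p (t *\<^sub>R x) / t \<le> p x" by (rule p_ge)
      then show ?thesis using t False by (simp add: field_simps)
    qed
  qed
  then obtain F where F: "linear F" "F \<le> p" by (rule linear_below_sublinear)
  have le: "F s \<le> f s" if "s \<in> S" for s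
    using F(2) p_le[OF that, of s] C0 by (auto simp: le_fun_def intro: order.trans)
  show ?thesis
  proof (rule that[OF F(1)])
    fix s assume "s \<in> S"
    moreover from this have "- s \<in> S" using S by (rule subspace_neg[rotated])
    ultimately show "F s = f s"
      using le[of s] le[of "- s"] by (simp add: linear_neg[OF F(1)] linear_neg[OF f])
  next
    fix w assume "w \<in> C"
    then have "p (- w) \<le> 0"
      using p_le[of 0 "- w"] S by (simp add: subspace_0 linear_0[OF f])
    then have "F (- w) \<le> 0" using F(2) by (auto simp: le_fun_def intro: order.trans)
    then show "0 \<le> F w" by (simp add: linear_neg[OF F(1)])
  qed
qed

section \<open>Linear combinations\<close>

text \<open>A summand may depend on its coefficient in any way, so the same rules cover
  complex-linear, conjugate-linear and merely real-linear maps; adjoints such as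
  \<open>ga_star\<close> are of this kind.\<close>

definition pm_sum :: "('x \<Rightarrow> 'c::zero \<Rightarrow> 'w::comm_monoid_add) \<Rightarrow> ('x \<Rightarrow>\<^sub>0 'c) \<Rightarrow> 'w"
  where "pm_sum k w = (\<Sum>x\<in>Poly_Mapping.keys w. k x (Poly_Mapping.lookup w x))"

lemma pm_sum_superset:
  assumes "finite A" "Poly_Mapping.keys w \<subseteq> A" "\<And>x. k x 0 = 0"
  shows "pm_sum k w = (\<Sum>x\<in>A. k x (Poly_Mapping.lookup w x))"
  unfolding pm_sum_def using assms
  by (intro sum.mono_neutral_left) (auto simp: not_in_keys_iff_lookup_eq_zero)

lemma pm_sum_cong:
  "(\<And>x. x \<in> Poly_Mapping.keys w \<Longrightarrow> k x (Poly_Mapping.lookup w x) = l x (Poly_Mapping.lookup w x))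
    \<Longrightarrow> pm_sum k w = pm_sum l w"
  unfolding pm_sum_def by (rule sum.cong) auto

lemma pm_sum_single:
  assumes "k x 0 = 0"
  shows "pm_sum k (Poly_Mapping.single x c) = k x c"
  using assms by (cases "c = 0") (simp_all add: pm_sum_def)

lemma pm_sum_single_additive:
  fixes k :: "'x \<Rightarrow> 'c::ab_group_add \<Rightarrow> 'w::ab_group_add"
  shows "Modules.additive (k x) \<Longrightarrow> pm_sum k (Poly_Mapping.single x c) = k x c"
  by (rule pm_sum_single) (rule Modules.additive.zero)

lemma additive_pm_sum:
  fixes k :: "'x \<Rightarrow> 'c::ab_group_add \<Rightarrow> 'w::ab_group_add"
  assumes "\<And>x. Modules.additive (k x)"
  shows "Modules.additive (pm_sum k)"
proof (rule Modules.additive.intro)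
  fix v w :: "'x \<Rightarrow>\<^sub>0 'c"
  let ?A = "Poly_Mapping.keys v \<union> Poly_Mapping.keys w"
  have "pm_sum k (v + w) = (\<Sum>x\<in>?A. k x (Poly_Mapping.lookup (v + w) x))"
    using keys_add[of v w] by (intro pm_sum_superset) (auto simp: Modules.additive.zero[OF assms])
  also have "\<dots> = (\<Sum>x\<in>?A. k x (Poly_Mapping.lookup v x)) + (\<Sum>x\<in>?A. k x (Poly_Mapping.lookup w x))"
    by (simp add: lookup_add Modules.additive.add[OF assms] sum.distrib)
  also have "\<dots> = pm_sum k v + pm_sum k w"
    by (subst (1 2) pm_sum_superset[symmetric]) (auto simp: Modules.additive.zero[OF assms])
  finally show "pm_sum k (v + w) = pm_sum k v + pm_sum k w" .
qed

lemma pm_sum_comp: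
  fixes f :: "'v::ab_group_add \<Rightarrow> 'w::ab_group_add"
  assumes "Modules.additive f"
  shows "f (pm_sum k w) = pm_sum (\<lambda>x c. f (k x c)) w"
  unfolding pm_sum_def by (rule Modules.additive.sum[OF assms])

lemma pm_sum_pm_sum:
  fixes k :: "'x \<Rightarrow> 'c::ab_group_add \<Rightarrow> 'w::ab_group_add"
  assumes "\<And>x. Modules.additive (k x)"
  shows "pm_sum k (pm_sum l w) = pm_sum (\<lambda>y d. pm_sum k (l y d)) w"
  by (rule pm_sum_comp) (rule additive_pm_sum[OF assms])

lemma pm_sum_swap:
  "pm_sum (\<lambda>x c. pm_sum (\<lambda>y d. k x c y d) b) a = pm_sum (\<lambda>y d. pm_sum (\<lambda>x c. k x c y d) a) b"
  unfolding pm_sum_def by (rule sum.swap)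

lemma pm_sum_sum:
  "pm_sum (\<lambda>x c. \<Sum>i\<in>I. k i x c) w = (\<Sum>i\<in>I. pm_sum (k i) w)"
  unfolding pm_sum_def by (rule sum.swap)

lemma pm_sum_add:
  "pm_sum (\<lambda>x c. k x c + l x c) w = pm_sum k w + pm_sum l w"
  unfolding pm_sum_def by (rule sum.distrib)

lemma pm_sum_zero [simp]: "pm_sum k 0 = 0"
  by (simp add: pm_sum_def)

lemma pm_sum_single_id: "pm_sum Poly_Mapping.single w = (w :: 'x \<Rightarrow>\<^sub>0 'c::comm_monoid_add)"
proof (rule poly_mapping_eqI)
  fix x
  have "Poly_Mapping.lookup (pm_sum Poly_Mapping.single w) x
      = (\<Sum>y\<in>Poly_Mapping.keys w. if y = x then Poly_Mapping.lookup w y else 0)"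
    by (simp add: pm_sum_def lookup_sum lookup_single when_def)
  also have "\<dots> = Poly_Mapping.lookup w x"
    by (simp add: sum.delta' not_in_keys_iff_lookup_eq_zero)
  finally show "Poly_Mapping.lookup (pm_sum Poly_Mapping.single w) x = Poly_Mapping.lookup w x" .
qed

lemma keys_pm_sum:
  "Poly_Mapping.keys (pm_sum k w)
    \<subseteq> (\<Union>x\<in>Poly_Mapping.keys w. Poly_Mapping.keys (k x (Poly_Mapping.lookup w x)))"
  for k :: "'x \<Rightarrow> 'c::zero \<Rightarrow> 'y \<Rightarrow>\<^sub>0 'd::comm_monoid_add"
  unfolding pm_sum_def by (rule keys_sum)

lemma poly_mapping_additive_induct:
  fixes w :: "'x \<Rightarrow>\<^sub>0 'c::comm_monoid_add"
  assumes "P 0" "\<And>x c. P (Poly_Mapping.single x c)" "\<And>v w. P v \<Longrightarrow> P w \<Longrightarrow> P (v + w)"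
  shows "P w"
proof -
  have "P (\<Sum>x\<in>A. Poly_Mapping.single x (Poly_Mapping.lookup w x))" for A
    by (induction A rule: infinite_finite_induct) (use assms in auto)
  then show ?thesis
    using pm_sum_single_id[of w] unfolding pm_sum_def by metis
qed

text \<open>Makes \<open>positive_extension\<close> applicable to finitely supported functions. That
  theorem is about real vector spaces; complex scalars act through the coefficients.\<close>

instantiation poly_mapping :: (type, real_vector) real_vector
begin

lift_definition scaleR_poly_mapping :: "real \<Rightarrow> ('a \<Rightarrow>\<^sub>0 'b) \<Rightarrow> 'a \<Rightarrow>\<^sub>0 'b"
  is "\<lambda>r f x. r *\<^sub>R f x"
  by (rule finite_subset[rotated]) auto

instance
  by standard (transfer; auto simp: scaleR_add_right scaleR_add_left)+

end

lemma lookup_scaleR: "Poly_Mapping.lookup (r *\<^sub>R w) x = r *\<^sub>R Poly_Mapping.lookup w x"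
  by transfer simp

lemma scaleR_single: "r *\<^sub>R Poly_Mapping.single x c = Poly_Mapping.single x (r *\<^sub>R c)"
  by (rule poly_mapping_eqI) (simp add: lookup_scaleR lookup_single when_def)

lemma keys_scaleR: "Poly_Mapping.keys (r *\<^sub>R w) \<subseteq> Poly_Mapping.keys w"
  by (auto simp: in_keys_iff lookup_scaleR)

lemma linear_imp_additive: "linear f \<Longrightarrow> Modules.additive f"
  by (rule Modules.additive.intro) (rule linear_add)

lemma linear_pm_sum:
  fixes k :: "'x \<Rightarrow> 'c::real_vector \<Rightarrow> 'w::real_vector"
  assumes "\<And>x. linear (k x)"
  shows "linear (pm_sum k)"
proof (rule linearI)
  show "pm_sum k (v + w) = pm_sum k v + pm_sum k w" for v w
    using Modules.additive.add[OF additive_pm_sum] linear_imp_additive[OF assms] by blast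
  show "pm_sum k (r *\<^sub>R w) = r *\<^sub>R pm_sum k w" for r w
  proof -
    have "pm_sum k (r *\<^sub>R w)
        = (\<Sum>x\<in>Poly_Mapping.keys w. k x (Poly_Mapping.lookup (r *\<^sub>R w) x))"
      by (rule pm_sum_superset) (auto simp: keys_scaleR linear_0[OF assms])
    then show ?thesis
      by (simp add: lookup_scaleR linear_cmul[OF assms] scaleR_sum_right pm_sum_def)
  qed
qed

definition comb :: "('x \<Rightarrow> 'u::complex_vector) \<Rightarrow> ('x \<Rightarrow>\<^sub>0 complex) \<Rightarrow> 'u"
  where "comb \<xi> = pm_sum (\<lambda>x c. c *\<^sub>C \<xi> x)"

lemma linear_comb: "linear (comb \<xi>)"
  unfolding comb_def
  by (intro linear_pm_sum linearI) (simp_all add: scaleC_add_left scaleR_scaleC scaleC_scaleC scaleR_conv_of_real)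

lemma comb_single: "comb \<xi> (Poly_Mapping.single x c) = c *\<^sub>C (\<xi> x :: 'u::complex_inner)"
  unfolding comb_def by (rule pm_sum_single) (rule scaleC.zero_left)

lemma lin_ext_comb: "lin_ext f x v = comb (\<lambda>g. f g v) x"
  by (simp add: lin_ext_def comb_def pm_sum_def)

text \<open>\<open>linear_comb\<close> records real linearity only; moving the complex scalar into
  the coefficients shows that the range of \<open>comb\<close> is a complex subspace.\<close>

lemma scaleC_comb:
  "c *\<^sub>C comb \<xi> w = comb \<xi> (pm_sum (\<lambda>x d. Poly_Mapping.single x (c * d)) w)"
  for \<xi> :: "'x \<Rightarrow> 'u::complex_inner"
proof -
  have "comb \<xi> (pm_sum (\<lambda>x d. Poly_Mapping.single x (c * d)) w) = pm_sum (\<lambda>x d. (c * d) *\<^sub>C \<xi> x) w"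
    by (subst pm_sum_comp[OF linear_imp_additive[OF linear_comb]]) (simp add: comb_single)
  also have "\<dots> = c *\<^sub>C comb \<xi> w"
    by (simp add: comb_def pm_sum_def scaleC.sum_right scaleC_scaleC)
  finally show ?thesis by simp
qed

definition sesq_form :: "('x \<Rightarrow> 'x \<Rightarrow> complex) \<Rightarrow> ('x \<Rightarrow>\<^sub>0 complex) \<Rightarrow> ('x \<Rightarrow>\<^sub>0 complex) \<Rightarrow> complex"
  where "sesq_form K v w = pm_sum (\<lambda>x c. pm_sum (\<lambda>y d. cnj c * d * K x y) w) v"

lemma linear_sesq_form_right: "linear (sesq_form K v)"
proof (rule linearI)
  have "linear (pm_sum (\<lambda>y d. cnj c * d * K x y))" for c x
    by (intro linear_pm_sum linearI) (simp_all add: algebra_simps)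
  note lin = linear_add[OF this] linear_cmul[OF this]
  show "sesq_form K v (w + w') = sesq_form K v w + sesq_form K v w'" for w w'
    unfolding sesq_form_def lin by (rule pm_sum_add)
  show "sesq_form K v (r *\<^sub>R w) = r *\<^sub>R sesq_form K v w" for r w
    unfolding sesq_form_def lin by (simp add: pm_sum_def scaleR_sum_right)
qed

lemma linear_sesq_form_left: "linear (\<lambda>v. sesq_form K v w)"
  unfolding sesq_form_def
  by (intro linear_pm_sum linearI) (simp_all add: pm_sum_def algebra_simps sum.distrib scaleR_sum_right)

lemma sesq_form_single:
  "sesq_form K (Poly_Mapping.single x c) (Poly_Mapping.single y d) = cnj c * d * K x y"
  unfolding sesq_form_def by (subst pm_sum_single; simp add: pm_sum_def)+

lemma cinner_comb:
  "cinner (comb \<xi> v) (comb \<xi> w) = sesq_form (\<lambda>x y. cinner (\<xi> x) (\<xi> y)) v w"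
  unfolding comb_def sesq_form_def pm_sum_def
  by (simp only: cinner.sum_left, simp only: cinner.sum_right)
    (simp add: cinner_scaleC_left cinner_scaleC_right mult.assoc mult.left_commute)

section \<open>Positive semidefinite kernels\<close>

definition psd_kernel :: "('x \<Rightarrow> 'x \<Rightarrow> complex) \<Rightarrow> bool"
  where "psd_kernel K \<longleftrightarrow> (\<forall>w. sesq_form K w w \<in> \<real>\<^sub>\<ge>\<^sub>0)"

lemma psd_kernel_diag:
  assumes "psd_kernel K"
  shows "0 \<le> Re (K x x)" "Im (K x x) = 0"
proof -
  have "sesq_form K (Poly_Mapping.single x 1) (Poly_Mapping.single x 1) \<in> \<real>\<^sub>\<ge>\<^sub>0"
    using assms by (simp add: psd_kernel_def)
  then show "0 \<le> Re (K x x)" "Im (K x x) = 0"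
    by (auto simp: sesq_form_single complex_nonneg_Reals_iff)
qed

lemma psd_kernel_expand:
  assumes "psd_kernel K"
  shows "cnj a * a * K x x + cnj a * b * K x y + cnj b * a * K y x + cnj b * b * K y y \<in> \<real>\<^sub>\<ge>\<^sub>0"
proof -
  let ?w = "Poly_Mapping.single x a + Poly_Mapping.single y b"
  have "sesq_form K ?w ?w \<in> \<real>\<^sub>\<ge>\<^sub>0" using assms by (simp add: psd_kernel_def)
  also have "sesq_form K ?w ?w =
      cnj a * a * K x x + cnj a * b * K x y + cnj b * a * K y x + cnj b * b * K y y"
    by (simp add: linear_add[OF linear_sesq_form_left] linear_add[OF linear_sesq_form_right]
        sesq_form_single)
  finally show ?thesis .
qed

text \<open>The form is real at the combinations of \<open>x\<close> and \<open>y\<close> with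
  coefficients \<open>1, 1\<close> and \<open>1, \<i>\<close>. As the diagonal is real, the two
  conditions fix the imaginary and the real part of \<open>K y x\<close>.\<close>

lemma psd_kernel_hermitian:
  assumes K: "psd_kernel K"
  shows "K y x = cnj (K x y)"
  using psd_kernel_expand[OF K, of 1 x 1 y] psd_kernel_expand[OF K, of 1 x \<i> y]
    psd_kernel_diag(2)[OF K]
  by (intro complex_eqI) (auto simp: complex_nonneg_Reals_iff)

text \<open>The discriminant argument for the quadratic polynomial in \<open>t\<close> given by the
  form at \<open>t *\<^sub>R v + w\<close>. The form may be degenerate, so a vanishing leading
  coefficient has to be treated separately.\<close>

lemma psd_kernel_Cauchy_Schwarz:
  assumes K: "psd_kernel K"
  shows "(Re (sesq_form K v w))\<^sup>2 \<le> Re (sesq_form K v v) * Re (sesq_form K w w)"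
proof -
  have herm: "sesq_form K w v = cnj (sesq_form K v w)" for v w
    unfolding sesq_form_def pm_sum_def cnj_sum
    by (subst sum.swap) (simp add: psd_kernel_hermitian[OF K, symmetric] mult.commute mult.left_commute)
  define A B C where "A = Re (sesq_form K v v)" and "B = Re (sesq_form K v w)"
    and "C = Re (sesq_form K w w)"
  have pos: "0 \<le> t\<^sup>2 * A + 2 * (t * B) + C" for t
  proof -
    have "0 \<le> Re (sesq_form K (t *\<^sub>R v + w) (t *\<^sub>R v + w))"
      using K by (simp add: psd_kernel_def complex_nonneg_Reals_iff)
    also have "\<dots> = t\<^sup>2 * A + 2 * (t * B) + C"
      by (simp add: linear_add[OF linear_sesq_form_left] linear_add[OF linear_sesq_form_right]
          linear_cmul[OF linear_sesq_form_left] linear_cmul[OF linear_sesq_form_right]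
          herm[of w v] A_def B_def C_def power2_eq_square algebra_simps)
    finally show ?thesis .
  qed
  have "B\<^sup>2 \<le> A * C"
  proof (cases "A = 0")
    case True
    have "B = 0"
    proof (rule ccontr)
      assume "B \<noteq> 0"
      \<comment> \<open>With \<open>A = 0\<close> the polynomial is \<open>2 * (t * B) + C\<close>,
        and this \<open>t\<close> gives it the value -1.\<close>
      then have "2 * ((- (C + 1) / (2 * B)) * B) = - (C + 1)" by simp
      then show False using pos[of "- (C + 1) / (2 * B)"] True by simp
    qed
    then show ?thesis by (simp add: True)
  next
    case False
    then have A: "A > 0"
      using K by (simp add: A_def psd_kernel_def complex_nonneg_Reals_iff order_less_le)
    have "0 \<le> A * ((- (B / A))\<^sup>2 * A + 2 * (- (B / A) * B) + C)"
      using pos[of "- (B / A)"] A by (intro mult_nonneg_nonneg) simp_all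
    also have "\<dots> = A * C - B\<^sup>2"
      using A by (simp add: field_simps power2_eq_square)
    finally show ?thesis by simp
  qed
  then show ?thesis by (simp add: A_def B_def C_def)
qed

section \<open>Gram vectors for a kernel in a space of square-summable families\<close>

lift_definition ell2_basis :: "'i \<Rightarrow> 'i ell2" is "\<lambda>i j. if j = i then 1 else 0"
proof -
  fix i :: 'i
  have "(\<lambda>j. (cmod (if j = i then 1 else 0))\<^sup>2) summable_on {i}" by simp
  then show "(\<lambda>j. (cmod (if j = i then 1 else 0))\<^sup>2) summable_on UNIV"
    by (rule summable_on_cong_neutral[THEN iffD1, rotated -1]) auto
qed

lemma cinner_ell2_basis: "cinner (ell2_basis i) v = ell2_coord v i"
proof -
  have "cinner (ell2_basis i) v
      = (\<Sum>\<^sub>\<infinity>j\<in>{i}. cnj (ell2_coord (ell2_basis i) j) * ell2_coord v j)"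
    unfolding cinner_ell2_def
    by (rule infsum_cong_neutral) (auto simp: ell2_basis.rep_eq)
  then show ?thesis by (simp add: ell2_basis.rep_eq)
qed

lemma closed_ell2_coord_zero: "closed {v. ell2_coord v i = 0}"
proof -
  have "closed {v. cinner (ell2_basis i) v = 0}"
    by (intro closed_Collect_eq cinner.continuous_on continuous_intros)
  then show ?thesis by (simp add: cinner_ell2_basis)
qed

text \<open>Cholesky factorization along a well-order: \<open>\<xi> x\<close> is the sum of a vector in the closed span of
  the earlier \<open>\<xi> y\<close>, determined by the values \<open>K x y\<close>, and a multiple of a new basis vector.\<close>

theorem psd_kernel_gram:
  fixes K :: "'x \<Rightarrow> 'x \<Rightarrow> complex" and \<iota> :: "'x \<Rightarrow> 'i"
  assumes K: "psd_kernel K" and \<iota>: "inj \<iota>"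
  obtains \<xi> :: "'x \<Rightarrow> 'i ell2" where "\<And>x y. cinner (\<xi> x) (\<xi> y) = K x y"
proof -
  obtain r :: "'x rel" where r: "well_order_on UNIV r" using well_order_on by blast
  define R where "R = r - Id"
  have wf: "wf R" using r by (simp add: well_order_on_def R_def)
  have tot: "(x, y) \<in> R \<or> x = y \<or> (y, x) \<in> R" for x y
    using r by (auto simp: R_def well_order_on_def linear_order_on_def total_on_def)
  have trans: "(x, z) \<in> R" if "(x, y) \<in> R" "(y, z) \<in> R" for x y z
    using r that
    by (auto simp: R_def well_order_on_def linear_order_on_def partial_order_on_def
        preorder_on_def antisym_def dest: transD)
  have irrefl: "(x, x) \<notin> R" for x by (simp add: R_def)
  \<comment> \<open>The last clause reserves a coordinate for every later index, so that a fresh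
    basis vector orthogonal to everything built so far is available at each stage, limit stages
    included.\<close>
  define P where "P f x v \<longleftrightarrow> (\<forall>y. (y, x) \<in> R \<longrightarrow> cinner v (f y) = K x y) \<and> cinner v v = K x x \<and>
      (\<forall>z. (x, z) \<in> R \<longrightarrow> ell2_coord v (\<iota> z) = 0)" for f x and v :: "'i ell2"
  have "\<exists>f. \<forall>x. P f x (f x)"
  proof (rule dependent_wf_choice[OF wf])
    show "P f x v = P g x v" if "\<And>z. (z, x) \<in> R \<Longrightarrow> f z = g z" for f g x v
      using that by (auto simp: P_def)
    fix x f assume IH: "\<And>y. (y, x) \<in> R \<Longrightarrow> P f y (f y)"
    \<comment> \<open>Only the values of \<open>f\<close> before \<open>x\<close> are known.
      Extending them by 0, with \<open>rs\<close> deleting the other coefficients, lets combinations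
      range over a full linear space of coefficients.\<close>
    define \<zeta> where "\<zeta> y = (if (y, x) \<in> R then f y else 0)" for y
    define rs :: "('x \<Rightarrow>\<^sub>0 complex) \<Rightarrow> 'x \<Rightarrow>\<^sub>0 complex"
      where "rs = pm_sum (\<lambda>y d. if (y, x) \<in> R then Poly_Mapping.single y d else 0)"
    have lin_rs: "linear rs"
      unfolding rs_def
      by (intro linear_pm_sum linearI) (simp_all add: single_add scaleR_single)
    have keys_rs: "Poly_Mapping.keys (rs c) \<subseteq> {y. (y, x) \<in> R}" for c
      unfolding rs_def by (rule order.trans[OF keys_pm_sum]) (auto split: if_splits)
    have gram: "cinner (f y) (f z) = K y z" if "(y, x) \<in> R" "(z, x) \<in> R" for y z
    proof -
      consider "(z, y) \<in> R" | "z = y" | "(y, z) \<in> R" using tot by blast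
      then show ?thesis
      proof cases
        case 3
        then have "cinner (f z) (f y) = K z y" using IH[OF that(2)] by (simp add: P_def)
        then show ?thesis
          using cinner_commute[of "f y"] psd_kernel_hermitian[OF K, of y z] by simp
      qed (use IH[OF that(1)] in \<open>simp_all add: P_def\<close>)
    qed
    have comb_rs: "comb \<zeta> c = comb f (rs c)" for c
      unfolding rs_def pm_sum_comp[OF linear_imp_additive[OF linear_comb]]
      unfolding comb_def \<zeta>_def
      by (intro pm_sum_cong) (auto simp: comb_def[symmetric] comb_single linear_0[OF linear_comb]
          scaleC.zero_right)
    have norm_comb: "(norm (comb \<zeta> c))\<^sup>2 = Re (sesq_form K (rs c) (rs c))" for c
    proof -
      have "complex_of_real ((norm (comb \<zeta> c))\<^sup>2) = sesq_form (\<lambda>y z. cinner (f y) (f z)) (rs c) (rs c)"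
        by (simp only: cinner_self[symmetric] comb_rs cinner_comb)
      also have "\<dots> = sesq_form K (rs c) (rs c)"
        unfolding sesq_form_def using keys_rs[of c]
        by (intro pm_sum_cong) (simp add: gram subset_iff)
      finally show ?thesis by (metis Re_complex_of_real)
    qed
    define \<delta> where "\<delta> = Poly_Mapping.single x (1 :: complex)"
    \<comment> \<open>The real part of the inner products that the new vector must have with
      combinations of the earlier ones. Cauchy-Schwarz for \<open>K\<close> bounds it by their
      norms, which also makes it independent of how a vector is written as a combination.\<close>
    define L where "L c = Re (sesq_form K \<delta> (rs c))" for c
    have "linear L"
      unfolding L_def
      by (intro linearI)
        (simp_all add: linear_add[OF lin_rs] linear_cmul[OF lin_rs]
          linear_add[OF linear_sesq_form_right] linear_cmul[OF linear_sesq_form_right])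
    moreover have "\<bar>L c\<bar> \<le> sqrt (Re (K x x)) * norm (comb \<zeta> c)" for c
    proof -
      have "(L c)\<^sup>2 \<le> Re (K x x) * (norm (comb \<zeta> c))\<^sup>2"
        using psd_kernel_Cauchy_Schwarz[OF K, of \<delta> "rs c"]
        by (simp add: L_def norm_comb \<delta>_def sesq_form_single)
      then have "sqrt ((L c)\<^sup>2) \<le> sqrt (Re (K x x) * (norm (comb \<zeta> c))\<^sup>2)"
        by (rule real_sqrt_le_mono)
      then show ?thesis by (simp add: real_sqrt_mult)
    qed
    ultimately obtain \<eta> where \<eta>: "\<eta> \<in> closure (range (comb \<zeta>))"
        "\<And>c. inner \<eta> (comb \<zeta> c) = L c" "norm \<eta> \<le> sqrt (Re (K x x))"
      using real_representer[OF linear_comb] psd_kernel_diag(1)[OF K, of x]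
      by (metis real_sqrt_ge_zero)
    have \<eta>f: "cinner \<eta> (f y) = K x y" if y: "(y, x) \<in> R" for y
    proof -
      have *: "Re (c * cinner \<eta> (f y)) = Re (c * K x y)" for c
      proof -
        have "rs (Poly_Mapping.single y c) = Poly_Mapping.single y c"
          unfolding rs_def using y by (subst pm_sum_single) auto
        then have "L (Poly_Mapping.single y c) = Re (c * K x y)"
          by (simp add: L_def \<delta>_def sesq_form_single)
        then show ?thesis
          using \<eta>(2)[of "Poly_Mapping.single y c"] y
          by (simp add: comb_single \<zeta>_def inner_Re_cinner cinner_scaleC_right)
      qed
      show ?thesis using *[of 1] *[of \<i>] by (intro complex_eqI) simp_all
    qed
    \<comment> \<open>For \<open>z = x\<close> this makes the new basis vector orthogonal to \<eta>;
      for later \<open>z\<close> it preserves the vanishing clause of \<open>P\<close>. Both pass to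
      the closure because vanishing of a coordinate is a closed condition.\<close>
    have \<eta>0: "ell2_coord \<eta> (\<iota> z) = 0" if z: "z = x \<or> (x, z) \<in> R" for z
    proof -
      have "ell2_coord (\<zeta> y) (\<iota> z) = 0" for y
      proof (cases "(y, x) \<in> R")
        case True
        then have "(y, z) \<in> R" using z trans by blast
        then show ?thesis using IH[OF True] True by (simp add: \<zeta>_def P_def)
      qed (simp add: \<zeta>_def zero_ell2.rep_eq)
      then have "cinner (ell2_basis (\<iota> z)) (comb \<zeta> c) = 0" for c
        by (simp add: comb_def pm_sum_def cinner.sum_right cinner_scaleC_right cinner_ell2_basis)
      then have "closure (range (comb \<zeta>)) \<subseteq> {v. ell2_coord v (\<iota> z) = 0}"
        by (intro closure_minimal closed_ell2_coord_zero) (auto simp: cinner_ell2_basis)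
      then show ?thesis using \<eta>(1) by blast
    qed
    \<comment> \<open>The Cholesky pivot: what \<eta> lacks of the prescribed squared norm
      \<open>K x x\<close>. It is real because the representing vector obeys the bound of
      \<open>L\<close>.\<close>
    define s where "s = sqrt (Re (K x x) - (norm \<eta>)\<^sup>2)"
    have "(norm \<eta>)\<^sup>2 \<le> Re (K x x)"
      using power_mono[OF \<eta>(3), of 2] psd_kernel_diag(1)[OF K, of x] by simp
    then have s2: "s\<^sup>2 = Re (K x x) - (norm \<eta>)\<^sup>2" by (simp add: s_def)
    define v where "v = \<eta> + complex_of_real s *\<^sub>C ell2_basis (\<iota> x)"
    have v_left: "cinner v w = cinner \<eta> w + s * ell2_coord w (\<iota> x)" for w
      by (simp add: v_def cinner_add_left cinner_scaleC_left cinner_ell2_basis)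
    have "P f x v"
      unfolding P_def
    proof (intro conjI allI impI)
      fix y assume y: "(y, x) \<in> R"
      then have "ell2_coord (f y) (\<iota> x) = 0" using IH[OF y] by (simp add: P_def)
      then show "cinner v (f y) = K x y" by (simp add: v_left \<eta>f[OF y])
    next
      have "ell2_coord v (\<iota> x) = s"
        using \<eta>0[of x] by (simp add: v_def plus_ell2.rep_eq scaleC_ell2.rep_eq ell2_basis.rep_eq)
      moreover have "cinner \<eta> v = (norm \<eta>)\<^sup>2"
      proof -
        have "cinner \<eta> (ell2_basis (\<iota> x)) = 0"
          using \<eta>0[of x] cinner_commute[of \<eta>] by (simp add: cinner_ell2_basis)
        then show ?thesis
          by (simp add: v_def cinner_add_right cinner_scaleC_right cinner_self)
      qed
      ultimately have "cinner v v = complex_of_real ((norm \<eta>)\<^sup>2 + s\<^sup>2)"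
        unfolding v_left by (simp add: power2_eq_square)
      then show "cinner v v = K x x"
        using psd_kernel_diag(2)[OF K, of x] by (simp add: s2 complex_eq_iff)
    next
      fix z assume z: "(x, z) \<in> R"
      then have "\<iota> z \<noteq> \<iota> x" using \<iota> irrefl by (auto dest: injD)
      then show "ell2_coord v (\<iota> z) = 0"
        using \<eta>0[of z] z by (simp add: v_def plus_ell2.rep_eq scaleC_ell2.rep_eq ell2_basis.rep_eq)
    qed
    then show "\<exists>v. P f x v" by blast
  qed
  then obtain f where f: "\<And>x. P f x (f x)" by blast
  show ?thesis
  proof (rule that)
    fix x y
    consider "(y, x) \<in> R" | "x = y" | "(x, y) \<in> R" using tot by blast
    then show "cinner (f x) (f y) = K x y"
    proof cases
      case 3
      then have "cinner (f y) (f x) = K y x" using f[of y] by (simp add: P_def)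
      then show ?thesis
        using cinner_commute[of "f x"] psd_kernel_hermitian[OF K, of x y] by simp
    qed (use f[of x] in \<open>simp_all add: P_def\<close>)
  qed
qed

section \<open>Unitary representations\<close>

lemma comb_compose:
  "comb (\<lambda>x. \<xi> (a x)) w = comb \<xi> (pm_sum (\<lambda>x d. Poly_Mapping.single (a x) d) w)"
  for \<xi> :: "'x \<Rightarrow> 'u::complex_inner"
  by (subst pm_sum_comp[OF linear_imp_additive[OF linear_comb]])
    (simp add: comb_single, simp add: comb_def)

lemma closed_csubspace_closure_comb:
  "closed_csubspace (closure (range (comb (\<xi> :: 'x \<Rightarrow> 'u::complex_inner))))"
proof (rule closed_csubspace_closure)
  show "0 \<in> range (comb \<xi>)" by (rule range_eqI[of _ _ 0]) (simp add: comb_def)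
  show "x + y \<in> range (comb \<xi>)" if "x \<in> range (comb \<xi>)" "y \<in> range (comb \<xi>)" for x y
    using that by (auto simp: linear_add[OF linear_comb, symmetric])
  show "c *\<^sub>C x \<in> range (comb \<xi>)" if "x \<in> range (comb \<xi>)" for c x
    using that by (auto simp: scaleC_comb)
qed

lemma in_closure_range_comb: "(\<xi> x :: 'u::complex_inner) \<in> closure (range (comb \<xi>))"
proof -
  have "comb \<xi> (Poly_Mapping.single x 1) \<in> closure (range (comb \<xi>))"
    by (intro subsetD[OF closure_subset] rangeI)
  then show ?thesis by (simp add: comb_single scaleC_one)
qed

text \<open>The difference lies in the closed span of the \<xi> \<open>x\<close> and is orthogonal
  to all of it, hence to itself.\<close>

lemma closure_range_comb_ext:
  fixes \<xi> :: "'x \<Rightarrow> 'u::complex_inner"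
  assumes v: "v \<in> closure (range (comb \<xi>))" and w: "w \<in> closure (range (comb \<xi>))"
    and eq: "\<And>x. cinner v (\<xi> x) = cinner w (\<xi> x)"
  shows "v = w"
proof -
  have "cinner (v - w) (comb \<xi> c) = 0" for c
    by (simp add: comb_def pm_sum_def cinner.sum_right cinner_scaleC_right cinner.diff_left eq)
  then have "closure (range (comb \<xi>)) \<subseteq> {u. cinner (v - w) u = 0}"
    by (intro closure_minimal closed_Collect_eq cinner.continuous_on continuous_intros) auto
  then have "cinner (v - w) v = 0" "cinner (v - w) w = 0" using v w by auto
  then have "cinner (v - w) (v - w) = 0" by (simp add: cinner.diff_right)
  then show ?thesis by (simp add: cinner_self)
qed

text \<open>Equal Gram matrices define an isometry between the closed spans that takes \<xi>
  \<open>x\<close> to \<xi>' \<open>x\<close>. The vector \<open>w\<close> is the image under it of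
  the projection of \<open>v\<close>; representing the functional
  \<open>comb \<xi>' c \<mapsto> inner v (comb \<xi> c)\<close> produces it in one stroke, well
  defined because the two combinations have equal norms.\<close>

lemma gram_transport:
  fixes \<xi> \<xi>' :: "'x \<Rightarrow> 'u::chilbert_space"
  assumes gram: "\<And>x y. cinner (\<xi>' x) (\<xi>' y) = cinner (\<xi> x) (\<xi> y)"
  obtains w where "w \<in> closure (range (comb \<xi>'))" "\<And>x. cinner w (\<xi>' x) = cinner v (\<xi> x)"
    "norm w \<le> norm v"
proof -
  have norm_eq: "norm (comb \<xi>' c) = norm (comb \<xi> c)" for c
  proof -
    have "complex_of_real ((norm (comb \<xi>' c))\<^sup>2) = complex_of_real ((norm (comb \<xi> c))\<^sup>2)"
      by (simp only: cinner_self[symmetric] cinner_comb gram)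
    then show ?thesis unfolding of_real_eq_iff by (simp add: power2_eq_iff_nonneg)
  qed
  have "linear (\<lambda>c. inner v (comb \<xi> c))"
    by (intro linearI) (simp_all add: linear_add[OF linear_comb] linear_cmul[OF linear_comb] inner_add_right)
  moreover have "\<bar>inner v (comb \<xi> c)\<bar> \<le> norm v * norm (comb \<xi>' c)" for c
    unfolding norm_eq by (rule Cauchy_Schwarz_ineq2)
  ultimately obtain w where w: "w \<in> closure (range (comb \<xi>'))"
      "\<And>c. inner w (comb \<xi>' c) = inner v (comb \<xi> c)" "norm w \<le> norm v"
    using real_representer[OF linear_comb _ norm_ge_zero] by metis
  have "cinner w (\<xi>' x) = cinner v (\<xi> x)" for x
  proof -
    have "Re (c * cinner w (\<xi>' x)) = Re (c * cinner v (\<xi> x))" for c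
      using w(2)[of "Poly_Mapping.single x c"]
      by (simp add: comb_single inner_Re_cinner cinner_scaleC_right)
    from this[of 1] this[of \<i>] show ?thesis by (intro complex_eqI) simp_all
  qed
  then show ?thesis using w that by blast
qed

text \<open>\<open>\<pi> g v\<close> is specified by its inner products with the generators \<xi>
  \<open>(act g x)\<close>, which run through all generators since \<open>g\<close> acts
  bijectively. Existence is \<open>gram_transport\<close>; uniqueness turns multiplicativity,
  linearity and the values on generators into comparisons of inner products.\<close>

theorem unitary_rep_of_invariant_gram:
  fixes G :: "('g, 'b) monoid_scheme" and \<xi> :: "'x \<Rightarrow> 'u::chilbert_space"
  assumes "group G"
    and act_mult: "\<And>g h x. g \<in> carrier G \<Longrightarrow> h \<in> carrier G \<Longrightarrow> act (g \<otimes>\<^bsub>G\<^esub> h) x = act g (act h x)"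
    and act_one: "\<And>x. act \<one>\<^bsub>G\<^esub> x = x"
    and gram: "\<And>g x y. g \<in> carrier G \<Longrightarrow> cinner (\<xi> (act g x)) (\<xi> (act g y)) = cinner (\<xi> x) (\<xi> y)"
  obtains K \<pi> where "unitary_rep G K \<pi>" "\<And>x. \<xi> x \<in> K"
    "\<And>g x. g \<in> carrier G \<Longrightarrow> \<pi> g (\<xi> x) = \<xi> (act g x)"
proof -
  interpret group G by fact
  define K where "K = closure (range (comb \<xi>))"
  define \<pi> where "\<pi> g v = (THE w. w \<in> K \<and> (\<forall>x. cinner w (\<xi> (act g x)) = cinner v (\<xi> x)))" for g v
  have K: "closed_csubspace K"
    unfolding K_def by (rule closed_csubspace_closure_comb)
  have K_add: "x + y \<in> K" if "x \<in> K" "y \<in> K" for x y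
    using K that by (simp add: closed_csubspace_def)
  have K_scale: "c *\<^sub>C x \<in> K" if "x \<in> K" for c x
    using K that by (simp add: closed_csubspace_def)
  have ext: "v = w" if "v \<in> K" "w \<in> K" "g \<in> carrier G"
      "\<And>x. cinner v (\<xi> (act g x)) = cinner w (\<xi> (act g x))" for v w g
  proof (rule closure_range_comb_ext)
    fix x
    have "act g (act (inv\<^bsub>G\<^esub> g) x) = x"
      using act_mult[of g "inv\<^bsub>G\<^esub> g" x] that(3) by (simp add: act_one)
    then show "cinner v (\<xi> x) = cinner w (\<xi> x)" using that(4)[of "act (inv\<^bsub>G\<^esub> g) x"] by simp
  qed (use that in \<open>simp_all add: K_def\<close>)
  have ex: "\<exists>w\<in>K. (\<forall>x. cinner w (\<xi> (act g x)) = cinner v (\<xi> x)) \<and> norm w \<le> norm v"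
    if g: "g \<in> carrier G" for g v
  proof -
    obtain w where w: "w \<in> closure (range (comb (\<lambda>x. \<xi> (act g x))))"
        "\<And>x. cinner w (\<xi> (act g x)) = cinner v (\<xi> x)" "norm w \<le> norm v"
      using gram_transport[of "\<lambda>x. \<xi> (act g x)" \<xi> v] gram[OF g] by metis
    have "range (comb (\<lambda>x. \<xi> (act g x))) \<subseteq> range (comb \<xi>)"
      unfolding comb_compose by blast
    then have "w \<in> K" unfolding K_def by (rule subsetD[OF closure_mono w(1)])
    then show ?thesis using w by blast
  qed
  have eqI: "\<pi> g v = w" if "g \<in> carrier G" "w \<in> K" "\<And>x. cinner w (\<xi> (act g x)) = cinner v (\<xi> x)" for g v w
    unfolding \<pi>_def
  proof (rule the_equality)
    show "w \<in> K \<and> (\<forall>x. cinner w (\<xi> (act g x)) = cinner v (\<xi> x))" using that by blast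
    fix w' assume "w' \<in> K \<and> (\<forall>x. cinner w' (\<xi> (act g x)) = cinner v (\<xi> x))"
    then show "w' = w" using that by (intro ext[of _ _ g]) auto
  qed
  have \<pi>: "\<pi> g v \<in> K" "cinner (\<pi> g v) (\<xi> (act g x)) = cinner v (\<xi> x)" "norm (\<pi> g v) \<le> norm v"
    if "g \<in> carrier G" for g v x
    using ex[OF that, of v] eqI[OF that] by metis+
  have mult: "\<pi> (g \<otimes>\<^bsub>G\<^esub> h) v = \<pi> g (\<pi> h v)" if "g \<in> carrier G" "h \<in> carrier G" for g h v
    using that by (intro eqI) (simp_all add: \<pi> act_mult)
  have one: "\<pi> \<one>\<^bsub>G\<^esub> v = v" if "v \<in> K" for v
    using that by (intro eqI) (simp_all add: act_one)
  have inv: "\<pi> g (\<pi> (inv\<^bsub>G\<^esub> g) v) = v" "\<pi> (inv\<^bsub>G\<^esub> g) (\<pi> g v) = v" if "g \<in> carrier G" "v \<in> K" for g v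
    using that mult[symmetric] one by simp_all
  have lin: "clinear_on K (\<pi> g)" if "g \<in> carrier G" for g
    unfolding clinear_on_def
    by (intro conjI ballI allI eqI that)
      (simp_all add: \<pi> that K_add K_scale cinner_add_left cinner_scaleC_left)
  \<comment> \<open>Both \<open>\<pi> g\<close> and its inverse are contractions.\<close>
  have norm: "norm (\<pi> g v) = norm v" if "g \<in> carrier G" "v \<in> K" for g v
    using \<pi>(3)[OF that(1), of v] \<pi>(3)[of "inv\<^bsub>G\<^esub> g" "\<pi> g v"] inv(2)[OF that] that by simp
  have "unitary_on K (\<pi> g)" if "g \<in> carrier G" for g
    unfolding unitary_on_def
  proof (intro conjI ballI)
    show "clinear_on K (\<pi> g)" using that by (rule lin)
    have "v \<in> \<pi> g ` K" if "v \<in> K" for v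
      using \<pi>(1)[of "inv\<^bsub>G\<^esub> g" v] inv(1)[OF \<open>g \<in> carrier G\<close> that] \<open>g \<in> carrier G\<close> by (metis imageI inv_closed)
    then show "\<pi> g ` K = K" using \<pi>(1)[OF that] by blast
    show "cinner (\<pi> g x) (\<pi> g y) = cinner x y" if "x \<in> K" "y \<in> K" for x y
      using K_add K_scale lin[OF \<open>g \<in> carrier G\<close>] norm[OF \<open>g \<in> carrier G\<close>] that
      by (rule norm_preserving_cinner)
  qed
  then have "unitary_rep G K \<pi>"
    using K mult by (simp add: unitary_rep_def)
  moreover have \<xi>K: "\<xi> x \<in> K" for x
    unfolding K_def by (rule in_closure_range_comb)
  moreover have "\<pi> g (\<xi> x) = \<xi> (act g x)" if "g \<in> carrier G" for g x
    by (intro eqI that \<xi>K gram)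
  ultimately show ?thesis by (rule that)
qed

section \<open>The action of the group algebra in a unitary representation\<close>

lemma unitary_repD:
  assumes "unitary_rep G K \<pi>" "g \<in> carrier G"
  shows "clinear_on K (\<pi> g)" "\<pi> g ` K = K"
    "\<And>v w. v \<in> K \<Longrightarrow> w \<in> K \<Longrightarrow> cinner (\<pi> g v) (\<pi> g w) = cinner v w"
    "\<And>v. v \<in> K \<Longrightarrow> \<pi> g v \<in> K" "\<And>v. v \<in> K \<Longrightarrow> norm (\<pi> g v) = norm v"
    "\<And>h v. h \<in> carrier G \<Longrightarrow> v \<in> K \<Longrightarrow> \<pi> (g \<otimes>\<^bsub>G\<^esub> h) v = \<pi> g (\<pi> h v)"
proof -
  have U: "unitary_on K (\<pi> g)" using assms by (simp add: unitary_rep_def)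
  then show 1: "clinear_on K (\<pi> g)" "\<pi> g ` K = K"
    "\<And>v w. v \<in> K \<Longrightarrow> w \<in> K \<Longrightarrow> cinner (\<pi> g v) (\<pi> g w) = cinner v w"
    by (simp_all add: unitary_on_def)
  then show "\<And>v. v \<in> K \<Longrightarrow> \<pi> g v \<in> K" by blast
  show "norm (\<pi> g v) = norm v" if "v \<in> K" for v
    using 1(3)[OF that that] unfolding cinner_self of_real_eq_iff by (simp add: power2_eq_iff_nonneg)
  show "\<And>h v. h \<in> carrier G \<Longrightarrow> v \<in> K \<Longrightarrow> \<pi> (g \<otimes>\<^bsub>G\<^esub> h) v = \<pi> g (\<pi> h v)"
    using assms by (simp add: unitary_rep_def)
qed

text \<open>Multiplicativity makes the operator of the identity idempotent, and unitarity makes it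
  surjective on \<open>K\<close>.\<close>

lemma unitary_rep_one:
  assumes "group G" "unitary_rep G K \<pi>" "v \<in> K"
  shows "\<pi> \<one>\<^bsub>G\<^esub> v = v"
proof -
  interpret group G by fact
  note U = unitary_repD[OF assms(2) one_closed]
  obtain w where "w \<in> K" "v = \<pi> \<one>\<^bsub>G\<^esub> w" using U(2) assms(3) by blast
  then show ?thesis using U(6)[OF one_closed, of w] by simp
qed

lemma cinner_unitary_rep_inv:
  assumes "group G" "unitary_rep G K \<pi>" "g \<in> carrier G" "v \<in> K" "w \<in> K"
  shows "cinner (\<pi> (inv\<^bsub>G\<^esub> g) v) w = cinner v (\<pi> g w)"
proof -
  interpret group G by fact
  have "\<pi> g (\<pi> (inv\<^bsub>G\<^esub> g) v) = v"
    using unitary_repD(6)[OF assms(2,3), of "inv\<^bsub>G\<^esub> g" v] unitary_rep_one[OF assms(1,2,4)] assms by simp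
  then show ?thesis
    using unitary_repD(3)[OF assms(2,3), of "\<pi> (inv\<^bsub>G\<^esub> g) v" w] unitary_repD(4)[OF assms(2), of "inv\<^bsub>G\<^esub> g" v]
      assms by simp
qed

lemma csubspace_comb:
  assumes "closed_csubspace K" "\<And>x. x \<in> Poly_Mapping.keys w \<Longrightarrow> \<xi> x \<in> K"
  shows "comb \<xi> w \<in> K"
proof -
  have "(\<Sum>x\<in>A. Poly_Mapping.lookup w x *\<^sub>C \<xi> x) \<in> K" if "A \<subseteq> Poly_Mapping.keys w" for A
    using finite_subset[OF that finite_keys] that
    by (induction A rule: finite_induct) (use assms in \<open>auto simp: closed_csubspace_def\<close>)
  then show ?thesis by (simp add: comb_def pm_sum_def)
qed

lemma clinear_on_comb:
  fixes \<xi> :: "'x \<Rightarrow> 'a::complex_inner" and T :: "'a \<Rightarrow> 'b::complex_inner"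
  assumes K: "closed_csubspace K" and T: "clinear_on K T"
    and \<xi>: "\<And>x. x \<in> Poly_Mapping.keys w \<Longrightarrow> \<xi> x \<in> K"
  shows "T (comb \<xi> w) = comb (\<lambda>x. T (\<xi> x)) w"
proof -
  have T0: "T 0 = 0"
  proof -
    have "T (0 *\<^sub>C 0) = 0 *\<^sub>C T 0"
      using K T by (simp only: clinear_on_def closed_csubspace_def)
    then show ?thesis by (simp add: scaleC.zero_left)
  qed
  have "(\<Sum>x\<in>A. Poly_Mapping.lookup w x *\<^sub>C \<xi> x) \<in> K \<and>
      T (\<Sum>x\<in>A. Poly_Mapping.lookup w x *\<^sub>C \<xi> x) = (\<Sum>x\<in>A. Poly_Mapping.lookup w x *\<^sub>C T (\<xi> x))"
    if "A \<subseteq> Poly_Mapping.keys w" for A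
    using finite_subset[OF that finite_keys] that
    by (induction A rule: finite_induct)
      (use K T T0 \<xi> in \<open>auto simp: closed_csubspace_def clinear_on_def\<close>)
  then show ?thesis by (simp add: comb_def pm_sum_def)
qed

lemma lin_ext_unitary_rep_closed:
  assumes "unitary_rep G K \<pi>" "x \<in> group_algebra G" "v \<in> K"
  shows "lin_ext \<pi> x v \<in> K"
  unfolding lin_ext_comb using assms
  by (intro csubspace_comb)
    (auto simp: unitary_rep_def group_algebra_def subset_iff intro!: unitary_repD(4)[OF assms(1)])

lemma ga_mult_pm_sum:
  "ga_mult G x y = pm_sum (\<lambda>g c. pm_sum (\<lambda>h d. Poly_Mapping.single (g \<otimes>\<^bsub>G\<^esub> h) (c * d)) y) x"
  by (simp add: ga_mult_def pm_sum_def)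

lemma ga_star_pm_sum:
  "ga_star G x = pm_sum (\<lambda>g c. Poly_Mapping.single (inv\<^bsub>G\<^esub> g) (cnj c)) x"
  by (simp add: ga_star_def pm_sum_def)

lemma ga_star_closed:
  assumes "group G" "x \<in> group_algebra G"
  shows "ga_star G x \<in> group_algebra G"
  unfolding group_algebra_def ga_star_pm_sum
  using assms by (auto simp: group_algebra_def group.inv_closed dest!: subsetD[OF keys_pm_sum] split: if_splits)

lemma lin_ext_ga_mult:
  assumes "unitary_rep G K \<pi>" "x \<in> group_algebra G" "y \<in> group_algebra G" "v \<in> K"
  shows "lin_ext \<pi> (ga_mult G x y) v = lin_ext \<pi> x (lin_ext \<pi> y v)"
proof -
  have K: "closed_csubspace K" using assms by (simp add: unitary_rep_def)
  have "lin_ext \<pi> (ga_mult G x y) v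
      = pm_sum (\<lambda>g c. pm_sum (\<lambda>h d. (c * d) *\<^sub>C \<pi> (g \<otimes>\<^bsub>G\<^esub> h) v) y) x"
    unfolding lin_ext_comb ga_mult_pm_sum pm_sum_comp[OF linear_imp_additive[OF linear_comb]] comb_single ..
  also have "\<dots> = pm_sum (\<lambda>g c. c *\<^sub>C \<pi> g (comb (\<lambda>h. \<pi> h v) y)) x"
  proof (rule pm_sum_cong)
    fix g assume "g \<in> Poly_Mapping.keys x"
    then have g: "g \<in> carrier G" using assms by (auto simp: group_algebra_def)
    note U = unitary_repD[OF assms(1) g]
    have y: "h \<in> carrier G" if "h \<in> Poly_Mapping.keys y" for h
      using that assms by (auto simp: group_algebra_def)
    have "\<pi> g (comb (\<lambda>h. \<pi> h v) y) = comb (\<lambda>h. \<pi> g (\<pi> h v)) y"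
      using y assms by (intro clinear_on_comb[OF K U(1)]) (auto intro: unitary_repD(4)[OF assms(1)])
    also have "\<dots> = pm_sum (\<lambda>h d. d *\<^sub>C \<pi> (g \<otimes>\<^bsub>G\<^esub> h) v) y"
      unfolding comb_def using y assms by (intro pm_sum_cong) (simp add: U(6))
    finally show "pm_sum (\<lambda>h d. (Poly_Mapping.lookup x g * d) *\<^sub>C \<pi> (g \<otimes>\<^bsub>G\<^esub> h) v) y
        = Poly_Mapping.lookup x g *\<^sub>C \<pi> g (comb (\<lambda>h. \<pi> h v) y)"
      by (simp add: pm_sum_def scaleC.sum_right scaleC_scaleC)
  qed
  finally show ?thesis by (simp add: lin_ext_comb comb_def)
qed

lemma cinner_lin_ext_ga_star:
  assumes "group G" "unitary_rep G K \<pi>" "x \<in> group_algebra G" "v \<in> K" "w \<in> K"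
  shows "cinner v (lin_ext \<pi> (ga_star G x) w) = cinner (lin_ext \<pi> x v) w"
proof -
  have "cinner v (lin_ext \<pi> (ga_star G x) w) = pm_sum (\<lambda>g c. cnj c * cinner v (\<pi> (inv\<^bsub>G\<^esub> g) w)) x"
    unfolding lin_ext_comb ga_star_pm_sum pm_sum_comp[OF linear_imp_additive[OF linear_comb]] comb_single
    by (simp add: pm_sum_def cinner.sum_right cinner_scaleC_right)
  also have "\<dots> = pm_sum (\<lambda>g c. cnj c * cinner (\<pi> g v) w) x"
  proof (rule pm_sum_cong)
    fix g assume "g \<in> Poly_Mapping.keys x"
    then have "g \<in> carrier G" using assms by (auto simp: group_algebra_def)
    then have "cinner v (\<pi> (inv\<^bsub>G\<^esub> g) w) = cinner (\<pi> g v) w"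
      using cinner_unitary_rep_inv[OF assms(1,2) _ assms(5,4)] by (metis cinner_commute)
    then show "cnj (Poly_Mapping.lookup x g) * cinner v (\<pi> (inv\<^bsub>G\<^esub> g) w)
        = cnj (Poly_Mapping.lookup x g) * cinner (\<pi> g v) w" by simp
  qed
  finally show ?thesis
    by (simp add: lin_ext_comb comb_def pm_sum_def cinner.sum_left cinner_scaleC_left)
qed

text \<open>A bound that depends on neither the representation nor the space. It shows that the
  suprema in \<open>op_norm_on\<close> and \<open>ga_norm\<close> are taken over bounded sets,
  without which \<open>Sup\<close> would be unspecified.\<close>

lemma norm_lin_ext_le_l1:
  assumes "unitary_rep G K \<pi>" "x \<in> group_algebra G" "v \<in> K"
  shows "norm (lin_ext \<pi> x v) \<le> pm_sum (\<lambda>g c. cmod c) x * norm v"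
proof -
  have "norm (lin_ext \<pi> x v) \<le> (\<Sum>g\<in>Poly_Mapping.keys x. norm (Poly_Mapping.lookup x g *\<^sub>C \<pi> g v))"
    unfolding lin_ext_def by (rule norm_sum)
  also have "\<dots> = (\<Sum>g\<in>Poly_Mapping.keys x. cmod (Poly_Mapping.lookup x g) * norm v)"
    using assms by (intro sum.cong refl)
      (auto simp: norm_scaleC group_algebra_def subset_iff unitary_repD(5)[OF assms(1)])
  finally show ?thesis by (simp add: pm_sum_def sum_distrib_right)
qed

lemma norm_lin_ext_le_op_norm:
  assumes "unitary_rep G K \<pi>" "x \<in> group_algebra G" "v \<in> K"
  shows "norm (lin_ext \<pi> x v) \<le> op_norm_on K (lin_ext \<pi> x) * norm v"
proof (cases "v = 0")
  case True
  then show ?thesis using norm_lin_ext_le_l1[OF assms] by simp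
next
  case False
  let ?c = "complex_of_real (1 / norm v)"
  have bdd: "bdd_above {norm (lin_ext \<pi> x v) | v. v \<in> K \<and> norm v \<le> 1}"
  proof (rule bdd_aboveI)
    fix r assume "r \<in> {norm (lin_ext \<pi> x v) | v. v \<in> K \<and> norm v \<le> 1}"
    then obtain v where v: "v \<in> K" "norm v \<le> 1" "r = norm (lin_ext \<pi> x v)" by blast
    have "r \<le> pm_sum (\<lambda>g c. cmod c) x * norm v"
      unfolding v(3) by (rule norm_lin_ext_le_l1[OF assms(1,2) v(1)])
    also have "\<dots> \<le> pm_sum (\<lambda>g c. cmod c) x * 1"
      using v(2) by (intro mult_left_mono) (simp_all add: pm_sum_def sum_nonneg)
    finally show "r \<le> pm_sum (\<lambda>g c. cmod c) x" by simp
  qed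
  have K: "closed_csubspace K" using assms by (simp add: unitary_rep_def)
  then have cv: "?c *\<^sub>C v \<in> K" using assms by (simp add: closed_csubspace_def)
  have "lin_ext \<pi> x (?c *\<^sub>C v) = (\<Sum>g\<in>Poly_Mapping.keys x. Poly_Mapping.lookup x g *\<^sub>C ?c *\<^sub>C \<pi> g v)"
    unfolding lin_ext_def using assms
    by (intro sum.cong refl)
      (auto simp: group_algebra_def subset_iff unitary_repD(1)[OF assms(1), unfolded clinear_on_def])
  also have "\<dots> = ?c *\<^sub>C lin_ext \<pi> x v"
    by (simp add: lin_ext_def scaleC.sum_right scaleC_scaleC mult.commute)
  finally have "norm (lin_ext \<pi> x v) / norm v = norm (lin_ext \<pi> x (?c *\<^sub>C v))"
    by (simp add: norm_scaleC norm_divide)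
  also have "\<dots> \<le> op_norm_on K (lin_ext \<pi> x)"
    unfolding op_norm_on_def using cv False
    by (intro cSup_upper bdd) (auto intro!: exI[of _ "?c *\<^sub>C v"] simp: norm_scaleC norm_divide)
  finally show ?thesis using False by (simp add: field_simps)
qed

lemma op_norm_on_le:
  assumes "0 \<in> K" "0 \<le> B" "\<And>v. v \<in> K \<Longrightarrow> norm (T v) \<le> B * norm v"
  shows "op_norm_on K T \<le> B"
  unfolding op_norm_on_def
proof (rule cSup_least)
  show "{norm (T v) |v. v \<in> K \<and> norm v \<le> 1} \<noteq> {}"
    using assms(1) by (auto intro!: exI[of _ 0])
  fix r assume "r \<in> {norm (T v) |v. v \<in> K \<and> norm v \<le> 1}"
  then obtain v where v: "v \<in> K" "norm v \<le> 1" "r = norm (T v)" by blast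
  then have "r \<le> B * norm v" using assms(3) by simp
  also have "\<dots> \<le> B * 1" using v assms(2) by (intro mult_left_mono) auto
  finally show "r \<le> B" by simp
qed

lemma norm_lin_ext_le_ga_norm:
  fixes K :: "'u::chilbert_space set"
  assumes "unitary_rep G K \<pi>" "x \<in> group_algebra G" "v \<in> K"
  shows "norm (lin_ext \<pi> x v) \<le> ga_norm TYPE('u) G x * norm v"
proof -
  let ?S = "{op_norm_on K (lin_ext \<pi> x) | (K :: 'u set) \<pi>. unitary_rep G K \<pi>}"
  have "op_norm_on K (lin_ext \<pi> x) \<le> pm_sum (\<lambda>g c. cmod c) x" if "unitary_rep G K \<pi>"
    for K :: "'u set" and \<pi>
    using that by (intro op_norm_on_le norm_lin_ext_le_l1[OF that assms(2)])
      (simp_all add: unitary_rep_def closed_csubspace_def pm_sum_def sum_nonneg)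
  then have "bdd_above ?S" by (auto simp: bdd_above_def)
  then have "op_norm_on K (lin_ext \<pi> x) \<le> ga_norm TYPE('u) G x"
    unfolding ga_norm_def using assms(1) by (intro cSup_upper) auto
  then have "op_norm_on K (lin_ext \<pi> x) * norm v \<le> ga_norm TYPE('u) G x * norm v"
    by (rule mult_right_mono) simp
  then show ?thesis using norm_lin_ext_le_op_norm[OF assms] by linarith
qed

text \<open>Shows that the supremum in \<open>ga_norm\<close> ranges over a nonempty set, and serves
  as the representation of class one when the space acted on by \<phi> is zero.\<close>

lemma unitary_rep_trivial: "unitary_rep G (UNIV :: 'u::chilbert_space set) (\<lambda>g v. v)"
  by (simp add: unitary_rep_def closed_csubspace_def unitary_on_def clinear_on_def)

lemma ga_norm_zero:
  fixes G :: "('g, 'b) monoid_scheme"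
  shows "ga_norm TYPE('u::chilbert_space) G 0 = 0"
proof -
  have "op_norm_on K (lin_ext \<pi> 0) = 0" if "unitary_rep G K \<pi>" for K :: "'u set" and \<pi>
  proof -
    have "{norm (lin_ext \<pi> 0 v) | v. v \<in> K \<and> norm v \<le> 1} = {0}"
      using that by (auto simp: lin_ext_def unitary_rep_def closed_csubspace_def intro!: exI[of _ 0])
    then show ?thesis by (simp add: op_norm_on_def)
  qed
  then have "{op_norm_on K (lin_ext \<pi> 0) | (K :: 'u set) \<pi>. unitary_rep G K \<pi>} \<subseteq> {0}" by auto
  moreover have "op_norm_on (UNIV :: 'u set) (lin_ext (\<lambda>(g :: 'g) v. v) 0)
      \<in> {op_norm_on K (lin_ext \<pi> 0) | (K :: 'u set) \<pi>. unitary_rep G K \<pi>}"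
    by (intro CollectI exI conjI) (rule refl, rule unitary_rep_trivial)
  ultimately have "{op_norm_on K (lin_ext \<pi> 0) | (K :: 'u set) \<pi>. unitary_rep G K \<pi>} = {0}"
    by (simp only: subset_singleton_iff) auto
  then show ?thesis by (simp add: ga_norm_def)
qed

lemma group_algebra_sum:
  "(\<And>i. i \<in> I \<Longrightarrow> x i \<in> group_algebra G) \<Longrightarrow> (\<Sum>i\<in>I. x i) \<in> group_algebra G"
  unfolding group_algebra_def using keys_sum[of x I] by blast

lemma group_algebra_diff:
  "x \<in> group_algebra G \<Longrightarrow> y \<in> group_algebra G \<Longrightarrow> x - y \<in> group_algebra G"
  unfolding group_algebra_def using keys_diff[of x y] by blast

lemma ga_mult_closed:
  assumes "group G" "x \<in> group_algebra G" "y \<in> group_algebra G"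
  shows "ga_mult G x y \<in> group_algebra G"
proof -
  interpret group G by fact
  show ?thesis
    using assms(2,3) unfolding ga_mult_def
    by (intro group_algebra_sum) (auto simp: group_algebra_def)
qed

text \<open>For an exact square \<open>y* y\<close> over the group algebra the double sum is the sum
  over \<open>l\<close> of the squared norms of the vectors obtained by applying row
  \<open>l\<close> of \<open>y\<close> to \<open>v\<close>. The norm of the group algebra dominates
  every representation in the universe, so these values converge to the value at \<open>x\<close>,
  and the nonnegative reals are closed.\<close>

theorem unitary_rep_ga_matrix_psd:
  fixes K :: "'u::chilbert_space set" and \<pi> :: "'g \<Rightarrow> 'u \<Rightarrow> 'u"
  assumes G: "group G" and \<pi>: "unitary_rep G K \<pi>"
    and x: "\<And>i j. i < n \<Longrightarrow> j < n \<Longrightarrow> x i j \<in> group_algebra G"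
    and psd: "ga_matrix_psd TYPE('u) G n x"
    and v: "\<And>i. i < n \<Longrightarrow> v i \<in> K"
  shows "(\<Sum>i<n. \<Sum>j<n. cinner (v i) (lin_ext \<pi> (x i j) (v j))) \<in> \<real>\<^sub>\<ge>\<^sub>0"
proof -
  obtain y where Cauchy: "\<forall>i<n. \<forall>j<n. ga_Cauchy TYPE('u) G (y i j)"
    and lim: "\<forall>i<n. \<forall>j<n. (\<lambda>k. ga_norm TYPE('u) G
      (x i j - (\<Sum>l<n. ga_mult G (ga_star G (y l i k)) (y l j k)))) \<longlonglongrightarrow> 0"
    using psd unfolding ga_matrix_psd_def by (elim exE conjE)
  have y: "y i j k \<in> group_algebra G" if "i < n" "j < n" for i j k
  proof -
    have "range (y i j) \<subseteq> group_algebra G" using Cauchy that by (simp add: ga_Cauchy_def)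
    then show ?thesis by (rule subsetD) (rule rangeI)
  qed
  define z where "z i j k = (\<Sum>l<n. ga_mult G (ga_star G (y l i k)) (y l j k))" for i j k
  have z: "z i j k \<in> group_algebra G" if "i < n" "j < n" for i j k
    unfolding z_def using that y by (intro group_algebra_sum ga_mult_closed ga_star_closed G) auto
  have lin: "linear (\<lambda>a. lin_ext \<pi> a w)" for w
    unfolding lin_ext_comb by (rule linear_comb)
  have "(\<lambda>k. cinner (v i) (lin_ext \<pi> (z i j k) (v j))) \<longlonglongrightarrow> cinner (v i) (lin_ext \<pi> (x i j) (v j))"
    if ij: "i < n" "j < n" for i j
  proof -
    have "(\<lambda>k. cinner (v i) (lin_ext \<pi> (z i j k) (v j)) - cinner (v i) (lin_ext \<pi> (x i j) (v j))) \<longlonglongrightarrow> 0"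
    proof (rule Lim_null_comparison)
      show "(\<lambda>k. norm (v i) * (ga_norm TYPE('u) G (x i j - z i j k) * norm (v j))) \<longlonglongrightarrow> 0"
        unfolding z_def
        by (intro tendsto_mult_right_zero tendsto_mult_left_zero lim[rule_format] ij)
      have "cmod (cinner (v i) (lin_ext \<pi> (z i j k) (v j)) - cinner (v i) (lin_ext \<pi> (x i j) (v j)))
          \<le> norm (v i) * (ga_norm TYPE('u) G (x i j - z i j k) * norm (v j))" for k
      proof -
        have "cmod (cinner (v i) (lin_ext \<pi> (x i j - z i j k) (v j)))
            \<le> norm (v i) * norm (lin_ext \<pi> (x i j - z i j k) (v j))"
          by (rule cmod_cinner_le)
        also have "\<dots> \<le> norm (v i) * (ga_norm TYPE('u) G (x i j - z i j k) * norm (v j))"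
          using ij by (intro mult_left_mono norm_lin_ext_le_ga_norm[OF \<pi>] group_algebra_diff x z v) auto
        finally show ?thesis
          by (simp add: linear_diff[OF lin] cinner.diff_right norm_minus_commute)
      qed
      then show "\<forall>\<^sub>F k in sequentially. norm (cinner (v i) (lin_ext \<pi> (z i j k) (v j)) -
          cinner (v i) (lin_ext \<pi> (x i j) (v j)))
          \<le> norm (v i) * (ga_norm TYPE('u) G (x i j - z i j k) * norm (v j))" by simp
    qed
    then show ?thesis by (rule LIM_zero_cancel)
  qed
  then have lim: "(\<lambda>k. \<Sum>i<n. \<Sum>j<n. cinner (v i) (lin_ext \<pi> (z i j k) (v j)))
      \<longlonglongrightarrow> (\<Sum>i<n. \<Sum>j<n. cinner (v i) (lin_ext \<pi> (x i j) (v j)))"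
    by (intro tendsto_sum) auto
  have "(\<Sum>i<n. \<Sum>j<n. cinner (v i) (lin_ext \<pi> (z i j k) (v j))) \<in> \<real>\<^sub>\<ge>\<^sub>0" for k
  proof -
    have "cinner (v i) (lin_ext \<pi> (z i j k) (v j))
        = (\<Sum>l<n. cinner (lin_ext \<pi> (y l i k) (v i)) (lin_ext \<pi> (y l j k) (v j)))"
      if ij: "i < n" "j < n" for i j
    proof -
      have "cinner (v i) (lin_ext \<pi> (ga_mult G (ga_star G (y l i k)) (y l j k)) (v j))
          = cinner (lin_ext \<pi> (y l i k) (v i)) (lin_ext \<pi> (y l j k) (v j))" if "l < n" for l
        using that ij
        by (simp add: lin_ext_ga_mult[OF \<pi>] cinner_lin_ext_ga_star[OF G \<pi>] y v ga_star_closed[OF G]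
            lin_ext_unitary_rep_closed[OF \<pi>])
      then show ?thesis by (simp add: z_def linear_sum[OF lin] cinner.sum_right)
    qed
    then have "(\<Sum>i<n. \<Sum>j<n. cinner (v i) (lin_ext \<pi> (z i j k) (v j)))
        = (\<Sum>i<n. \<Sum>j<n. \<Sum>l<n. cinner (lin_ext \<pi> (y l i k) (v i)) (lin_ext \<pi> (y l j k) (v j)))"
      by simp
    also have "\<dots> = (\<Sum>i<n. \<Sum>l<n. \<Sum>j<n. cinner (lin_ext \<pi> (y l i k) (v i)) (lin_ext \<pi> (y l j k) (v j)))"
      by (intro sum.cong refl sum.swap)
    also have "\<dots> = (\<Sum>l<n. \<Sum>i<n. \<Sum>j<n. cinner (lin_ext \<pi> (y l i k) (v i)) (lin_ext \<pi> (y l j k) (v j)))"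
      by (rule sum.swap)
    also have "\<dots> = (\<Sum>l<n. cinner (\<Sum>i<n. lin_ext \<pi> (y l i k) (v i)) (\<Sum>i<n. lin_ext \<pi> (y l i k) (v i)))"
      by (simp only: cinner.sum_left) (simp only: cinner.sum_right)
    also have "\<dots> \<in> \<real>\<^sub>\<ge>\<^sub>0"
      unfolding cinner_self of_real_sum[symmetric] nonneg_Reals_of_real_iff by (simp add: sum_nonneg)
    finally show ?thesis .
  qed
  then show ?thesis
    by (intro closed_sequentially[OF closed_nonneg_Reals_complex _ lim])
qed

section \<open>Extension of partially defined positive kernels\<close>

text \<open>A finitely supported function on \<open>G \<times> 'x \<times> 'x\<close> stands for a matrix over \<open>\<complex>[G]\<close> with rows and
  columns indexed by \<^typ>\<open>'x\<close>; a finitely supported function \<open>a\<close> on \<open>G \<times> 'x\<close> for a row, and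
  \<open>row_square G z a b\<close> for \<open>z a\<^sup>* b\<close>. Group components outside \<^term>\<open>carrier G\<close> count as zero.\<close>

definition row_square :: "('g, 'm) monoid_scheme \<Rightarrow> complex \<Rightarrow> ('g \<times> 'x \<Rightarrow>\<^sub>0 complex) \<Rightarrow>
    ('g \<times> 'x \<Rightarrow>\<^sub>0 complex) \<Rightarrow> ('g \<times> 'x \<times> 'x \<Rightarrow>\<^sub>0 complex)"
  where "row_square G z a b = pm_sum (\<lambda>x c. pm_sum (\<lambda>y d.
    if fst x \<in> carrier G \<and> fst y \<in> carrier G
    then Poly_Mapping.single (inv\<^bsub>G\<^esub> fst x \<otimes>\<^bsub>G\<^esub> fst y, snd x, snd y) (z * cnj c * d) else 0) b) a"

text \<open>The map \<open>w \<mapsto> w + w*\<close> for the involution of matrices over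
  \<complex>[G], twice the hermitian part. Ordering the real space by the condition that
  \<open>add_adjoint G w\<close> is a sum of squares forces positive functionals to vanish on
  antihermitian elements.\<close>

definition add_adjoint :: "('g, 'm) monoid_scheme \<Rightarrow> ('g \<times> 'x \<times> 'x \<Rightarrow>\<^sub>0 complex) \<Rightarrow>
    ('g \<times> 'x \<times> 'x \<Rightarrow>\<^sub>0 complex)"
  where "add_adjoint G = pm_sum (\<lambda>(g, u, v) c. if g \<in> carrier G
    then Poly_Mapping.single (g, u, v) c + Poly_Mapping.single (inv\<^bsub>G\<^esub> g, v, u) (cnj c) else 0)"

definition kernel_eval :: "('g \<Rightarrow> 'x \<Rightarrow> 'x \<Rightarrow> complex) \<Rightarrow> ('g \<times> 'x \<times> 'x \<Rightarrow>\<^sub>0 complex) \<Rightarrow> complex"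
  where "kernel_eval \<psi> = pm_sum (\<lambda>(g, u, v) c. c * \<psi> g u v)"

text \<open>Finite sums of squares of rows, without any closure. Nonnegative real scalars are
  absorbed into the rows through their square roots.\<close>

inductive_set square_cone :: "('g, 'm) monoid_scheme \<Rightarrow> ('g \<times> 'x \<times> 'x \<Rightarrow>\<^sub>0 complex) set"
  for G where
  zero: "0 \<in> square_cone G"
| add_square: "w \<in> square_cone G \<Longrightarrow> w + row_square G 1 a a \<in> square_cone G"

lemma linear_row_square_right: "linear (row_square G z a)"
proof (rule linearI)
  have lin: "linear (pm_sum (\<lambda>y d. if fst x \<in> carrier G \<and> fst y \<in> carrier G
      then Poly_Mapping.single (inv\<^bsub>G\<^esub> fst x \<otimes>\<^bsub>G\<^esub> fst y, snd x, snd y) (z * cnj c * d) else 0))"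
    for x :: "'a \<times> 'b" and c
    by (intro linear_pm_sum linearI) (simp_all add: algebra_simps single_add scaleR_single)
  show "row_square G z a (b + b') = row_square G z a b + row_square G z a b'" for b b'
    unfolding row_square_def linear_add[OF lin] by (rule pm_sum_add)
  show "row_square G z a (r *\<^sub>R b) = r *\<^sub>R row_square G z a b" for r b
    unfolding row_square_def linear_cmul[OF lin] by (simp add: pm_sum_def scaleR_sum_right)
qed

lemma linear_row_square_left: "linear (\<lambda>a. row_square G z a b)"
  unfolding row_square_def
proof (intro linear_pm_sum linearI)
  fix x :: "'a \<times> 'b" and c d :: complex and r :: real
  show "pm_sum (\<lambda>y e. if fst x \<in> carrier G \<and> fst y \<in> carrier G
          then Poly_Mapping.single (inv\<^bsub>G\<^esub> fst x \<otimes>\<^bsub>G\<^esub> fst y, snd x, snd y) (z * cnj (c + d) * e) else 0) b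
      = pm_sum (\<lambda>y e. if fst x \<in> carrier G \<and> fst y \<in> carrier G
          then Poly_Mapping.single (inv\<^bsub>G\<^esub> fst x \<otimes>\<^bsub>G\<^esub> fst y, snd x, snd y) (z * cnj c * e) else 0) b
      + pm_sum (\<lambda>y e. if fst x \<in> carrier G \<and> fst y \<in> carrier G
          then Poly_Mapping.single (inv\<^bsub>G\<^esub> fst x \<otimes>\<^bsub>G\<^esub> fst y, snd x, snd y) (z * cnj d * e) else 0) b"
    unfolding pm_sum_add[symmetric] by (intro pm_sum_cong) (simp add: algebra_simps single_add)
  show "pm_sum (\<lambda>y e. if fst x \<in> carrier G \<and> fst y \<in> carrier G
          then Poly_Mapping.single (inv\<^bsub>G\<^esub> fst x \<otimes>\<^bsub>G\<^esub> fst y, snd x, snd y) (z * cnj (r *\<^sub>R c) * e) else 0) b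
      = r *\<^sub>R pm_sum (\<lambda>y e. if fst x \<in> carrier G \<and> fst y \<in> carrier G
          then Poly_Mapping.single (inv\<^bsub>G\<^esub> fst x \<otimes>\<^bsub>G\<^esub> fst y, snd x, snd y) (z * cnj c * e) else 0) b"
    unfolding pm_sum_def scaleR_sum_right
    by (intro sum.cong refl) (simp add: scaleR_single algebra_simps)
qed

lemma row_square_single:
  assumes "g \<in> carrier G" "h \<in> carrier G"
  shows "row_square G z (Poly_Mapping.single (g, u) c) (Poly_Mapping.single (h, v) d)
    = Poly_Mapping.single (inv\<^bsub>G\<^esub> g \<otimes>\<^bsub>G\<^esub> h, u, v) (z * cnj c * d)"
proof -
  have "pm_sum (\<lambda>y d. if fst x \<in> carrier G \<and> fst y \<in> carrier G
      then Poly_Mapping.single (inv\<^bsub>G\<^esub> fst x \<otimes>\<^bsub>G\<^esub> fst y, snd x, snd y) (z * cnj c * d) else 0)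
      (Poly_Mapping.single (h, v) d)
    = (if fst x \<in> carrier G then Poly_Mapping.single (inv\<^bsub>G\<^esub> fst x \<otimes>\<^bsub>G\<^esub> h, snd x, v) (z * cnj c * d) else 0)"
    for x :: "'a \<times> 'c" and c
    using assms by (subst pm_sum_single) auto
  then show ?thesis
    unfolding row_square_def using assms by (simp add: pm_sum_single)
qed

text \<open>The two-term square from which everything about single entries is read off: with varying
  \<open>c\<close> it gives the hermitian symmetry of a positive function and the domination by
  diagonal entries at the identity.\<close>

lemma row_square_single_add:
  fixes G :: "('g, 'm) monoid_scheme" and u v :: 'x and c :: complex
  assumes "group G" "g \<in> carrier G"
  defines "a \<equiv> Poly_Mapping.single (\<one>\<^bsub>G\<^esub>, u) 1 + Poly_Mapping.single (g, v) c"
  shows "row_square G 1 a a =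
    Poly_Mapping.single (\<one>\<^bsub>G\<^esub>, u, u) 1 + Poly_Mapping.single (g, u, v) c +
    (Poly_Mapping.single (inv\<^bsub>G\<^esub> g, v, u) (cnj c) +
     Poly_Mapping.single (\<one>\<^bsub>G\<^esub>, v, v) (complex_of_real ((cmod c)\<^sup>2)))"
proof -
  interpret group G by fact
  have "cnj c * c = complex_of_real ((cmod c)\<^sup>2)"
    by (simp only: complex_norm_square mult.commute)
  then show ?thesis
    using assms(2)
    by (simp add: a_def linear_add[OF linear_row_square_left] linear_add[OF linear_row_square_right]
        row_square_single)
qed

lemma linear_add_adjoint: "linear (add_adjoint G)"
  unfolding add_adjoint_def
  by (intro linear_pm_sum linearI) (auto simp: single_add scaleR_single scaleR_add_right split: prod.split)

lemma add_adjoint_single: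
  "add_adjoint G (Poly_Mapping.single (g, u, v) c) = (if g \<in> carrier G
    then Poly_Mapping.single (g, u, v) c + Poly_Mapping.single (inv\<^bsub>G\<^esub> g, v, u) (cnj c) else 0)"
  unfolding add_adjoint_def by (subst pm_sum_single) auto

lemma linear_kernel_eval: "linear (kernel_eval \<psi>)"
  unfolding kernel_eval_def
  by (intro linear_pm_sum linearI) (auto simp: algebra_simps split: prod.split)

lemma kernel_eval_single: "kernel_eval \<psi> (Poly_Mapping.single (g, u, v) c) = c * \<psi> g u v"
  unfolding kernel_eval_def by (subst pm_sum_single) auto

lemma square_cone_add:
  assumes "w \<in> square_cone G" "w' \<in> square_cone G"
  shows "w + w' \<in> square_cone G"
  using assms(2,1)
  by induction (auto simp: add.assoc[symmetric] intro: square_cone.add_square)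

lemma row_square_in_square_cone: "row_square G 1 a a \<in> square_cone G"
  using square_cone.add_square[OF square_cone.zero] by simp

lemma square_cone_scaleR:
  assumes "w \<in> square_cone G" "0 \<le> t"
  shows "t *\<^sub>R w \<in> square_cone G"
  using assms(1)
proof induction
  case (add_square w a)
  have "row_square G 1 (sqrt t *\<^sub>R a) (sqrt t *\<^sub>R a) = t *\<^sub>R row_square G 1 a a"
    using assms(2)
    by (simp add: linear_cmul[OF linear_row_square_left] linear_cmul[OF linear_row_square_right])
  then show ?case
    using square_cone.add_square[OF add_square.IH, of "sqrt t *\<^sub>R a"] by (simp add: scaleR_add_right)
qed (simp add: square_cone.zero)

lemma square_cone_sum:
  assumes "w \<in> square_cone G"
  obtains n :: nat and a where "w = (\<Sum>k<n. row_square G 1 (a k) (a k))"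
proof -
  have "\<exists>(n :: nat) a. w = (\<Sum>k<n. row_square G 1 (a k) (a k))"
    using assms
  proof induction
    case zero
    show ?case by (rule exI[of _ 0]) simp
  next
    case (add_square w b)
    then obtain n :: nat and a where w: "w = (\<Sum>k<n. row_square G 1 (a k) (a k))" by blast
    have "(\<Sum>k<n. row_square G 1 (a k) (a k))
        = (\<Sum>k<n. row_square G 1 ((a(n := b)) k) ((a(n := b)) k))"
      by (intro sum.cong) auto
    then have "w + row_square G 1 b b = (\<Sum>k<Suc n. row_square G 1 ((a(n := b)) k) ((a(n := b)) k))"
      by (simp add: w)
    then show ?case by blast
  qed
  then show ?thesis using that by blast
qed

text \<open>The adjoint of \<open>z a* a\<close> is \<open>cnj z a* a\<close>. For
  \<open>z = 1\<close> the sum is twice a square; for \<open>z = \<i>\<close> it vanishes.\<close>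

lemma add_adjoint_row_square:
  assumes "group G"
  shows "add_adjoint G (row_square G z a a) = row_square G z a a + row_square G (cnj z) a a"
proof -
  interpret group G by fact
  let ?k = "\<lambda>z x c y d. if fst x \<in> carrier G \<and> fst y \<in> carrier G
      then Poly_Mapping.single (inv\<^bsub>G\<^esub> fst x \<otimes>\<^bsub>G\<^esub> fst y, snd x, snd y) (z * cnj c * d) else 0"
  note comp = pm_sum_comp[OF linear_imp_additive[OF linear_add_adjoint]]
  have "add_adjoint G (?k z x c y d) = ?k z x c y d + ?k (cnj z) y d x c" for x y :: "'a \<times> 'c" and c d
    by (simp add: add_adjoint_single linear_0[OF linear_add_adjoint] inv_mult_group mult.commute
        mult.left_commute)
  then have "add_adjoint G (row_square G z a a)
      = pm_sum (\<lambda>x c. pm_sum (\<lambda>y d. ?k z x c y d + ?k (cnj z) y d x c) a) a"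
    unfolding row_square_def comp by simp
  also have "\<dots> = row_square G z a a + pm_sum (\<lambda>x c. pm_sum (\<lambda>y d. ?k (cnj z) y d x c) a) a"
    unfolding row_square_def pm_sum_add ..
  also have "pm_sum (\<lambda>x c. pm_sum (\<lambda>y d. ?k (cnj z) y d x c) a) a = row_square G (cnj z) a a"
    unfolding row_square_def by (rule pm_sum_swap)
  finally show ?thesis .
qed

lemma row_square_minus: "row_square G (- z) a b = - row_square G z a b"
proof -
  have "Poly_Mapping.single k (- z * cnj c * d) = - Poly_Mapping.single k (z * cnj c * d)" for k :: "'a \<times> 'b \<times> 'b" and c d
    by (simp add: single_uminus)
  then show ?thesis
    unfolding row_square_def pm_sum_def
    by (simp add: sum_negf[symmetric] if_distrib[of uminus] cong: if_cong)
qed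

text \<open>Domination is additive in \<open>w\<close>, so it suffices to dominate a single entry,
  which a two-term square does.\<close>

lemma square_cone_dominates:
  assumes "group G" and S: "subspace S"
    and one: "\<And>u c. Poly_Mapping.single (\<one>\<^bsub>G\<^esub>, u, u) c \<in> S"
  shows "\<exists>s\<in>S. add_adjoint G (s - w) \<in> square_cone G"
proof (induction w rule: poly_mapping_additive_induct)
  case 1
  show ?case
    using subspace_0[OF S] by (intro bexI[of _ 0]) (simp_all add: linear_0[OF linear_add_adjoint] square_cone.zero)
next
  case (2 x c)
  interpret group G by fact
  obtain g u v where x: "x = (g, u, v)" by (cases x)
  show ?case
  proof (cases "g \<in> carrier G")
    case False
    then show ?thesis
      using subspace_0[OF S]
      by (intro bexI[of _ 0])
        (simp_all add: linear_neg[OF linear_add_adjoint] x add_adjoint_single square_cone.zero)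
  next
    case True
    \<comment> \<open>The diagonal of the square of the row with 1 at \<open>(\<one>, u)\<close> and
      \<open>- c\<close> at \<open>(g, v)\<close>. The entries are halved because
      \<open>add_adjoint\<close> doubles them.\<close>
    define s where "s = Poly_Mapping.single (\<one>\<^bsub>G\<^esub>, u, u) (1/2) +
      Poly_Mapping.single (\<one>\<^bsub>G\<^esub>, v, v) (complex_of_real ((cmod c)\<^sup>2) / 2)"
    have half: "Poly_Mapping.single k (d / 2) + Poly_Mapping.single k (d / 2) = Poly_Mapping.single k d"
      for k :: "'a \<times> 'c \<times> 'c" and d :: complex
      by (simp add: single_add[symmetric])
    have "add_adjoint G s = Poly_Mapping.single (\<one>\<^bsub>G\<^esub>, u, u) 1 +
        Poly_Mapping.single (\<one>\<^bsub>G\<^esub>, v, v) (complex_of_real ((cmod c)\<^sup>2))"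
      unfolding s_def linear_add[OF linear_add_adjoint] add_adjoint_single
      using half[of _ 1] half[of _ "complex_of_real ((cmod c)\<^sup>2)"] by (simp del: of_real_power)
    then have "add_adjoint G (s - Poly_Mapping.single x c) = row_square G 1
        (Poly_Mapping.single (\<one>\<^bsub>G\<^esub>, u) 1 + Poly_Mapping.single (g, v) (- c))
        (Poly_Mapping.single (\<one>\<^bsub>G\<^esub>, u) 1 + Poly_Mapping.single (g, v) (- c))"
      using True row_square_single_add[OF assms(1) True, of u v "- c"]
      by (simp add: linear_diff[OF linear_add_adjoint] x
          add_adjoint_single single_uminus del: of_real_power)
    then have "add_adjoint G (s - Poly_Mapping.single x c) \<in> square_cone G"
      by (simp only: row_square_in_square_cone)
    moreover have "s \<in> S" unfolding s_def by (intro subspace_add[OF S] one)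
    ultimately show ?thesis by blast
  qed
next
  case (3 v w)
  then obtain s t where "s \<in> S" "add_adjoint G (s - v) \<in> square_cone G"
      "t \<in> S" "add_adjoint G (t - w) \<in> square_cone G" by blast
  then show ?case
    using square_cone_add[of "add_adjoint G (s - v)" G "add_adjoint G (t - w)"]
    by (intro bexI[of _ "s + t"])
      (simp_all add: linear_add[OF linear_add_adjoint, symmetric] subspace_add[OF S] algebra_simps)
qed

text \<open>\<open>positive_extension\<close> is applied to the real part of the evaluation at
  \<psi>, on the functions supported in \<open>D\<close>. The form of the resulting kernel at a row
  \<open>a\<close> is the evaluation of \<theta> at \<open>a* a\<close>; outside the carrier the
  kernel is 0, in agreement with \<open>row_square\<close>.\<close>

theorem positive_kernel_extension:
  fixes G :: "('g, 'm) monoid_scheme" and \<psi> :: "'g \<Rightarrow> 'x \<Rightarrow> 'x \<Rightarrow> complex"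
  assumes G: "group G" and D: "D \<subseteq> carrier G" "\<one>\<^bsub>G\<^esub> \<in> D" "\<And>g. g \<in> D \<Longrightarrow> inv\<^bsub>G\<^esub> g \<in> D"
    and pos: "\<And>w. w \<in> square_cone G \<Longrightarrow> Poly_Mapping.keys w \<subseteq> D \<times> UNIV \<Longrightarrow> kernel_eval \<psi> w \<in> \<real>\<^sub>\<ge>\<^sub>0"
  obtains \<theta> :: "'g \<Rightarrow> 'x \<Rightarrow> 'x \<Rightarrow> complex"
  where "\<And>g u v. g \<in> D \<Longrightarrow> \<theta> g u v = \<psi> g u v"
    and "psd_kernel (\<lambda>(g, u) (h, v). if g \<in> carrier G \<and> h \<in> carrier G then \<theta> (inv\<^bsub>G\<^esub> g \<otimes>\<^bsub>G\<^esub> h) u v else 0)"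
proof -
  interpret group G by fact
  \<comment> \<open>Positivity on two-term squares makes their values real; the coefficients
    \<open>1\<close> and \<open>\<i>\<close> yield the two components of the identity.\<close>
  have herm: "\<psi> (inv\<^bsub>G\<^esub> g) v u = cnj (\<psi> g u v)" if g: "g \<in> D" for g u v
  proof -
    have gG: "g \<in> carrier G" using g D by blast
    have *: "\<psi> \<one>\<^bsub>G\<^esub> u u + c * \<psi> g u v + (cnj c * \<psi> (inv\<^bsub>G\<^esub> g) v u + (cmod c)\<^sup>2 * \<psi> \<one>\<^bsub>G\<^esub> v v) \<in> \<real>\<^sub>\<ge>\<^sub>0"
      for c u v
    proof -
      let ?a = "Poly_Mapping.single (\<one>\<^bsub>G\<^esub>, u) 1 + Poly_Mapping.single (g, v) c"
      have "Poly_Mapping.keys (row_square G 1 ?a ?a) \<subseteq> D \<times> UNIV"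
        unfolding row_square_single_add[OF G gG] using D g
        by (auto dest!: subsetD[OF keys_add] split: if_splits)
      then have "kernel_eval \<psi> (row_square G 1 ?a ?a) \<in> \<real>\<^sub>\<ge>\<^sub>0"
        by (intro pos row_square_in_square_cone)
      then show ?thesis
        unfolding row_square_single_add[OF G gG]
        by (simp add: linear_add[OF linear_kernel_eval] kernel_eval_single)
    qed
    have "Im (\<psi> \<one>\<^bsub>G\<^esub> u u) = 0" for u using *[of u 0 u] by (simp add: complex_nonneg_Reals_iff)
    then show ?thesis
      using *[of u 1 v] *[of u \<i> v] by (intro complex_eqI) (auto simp: complex_nonneg_Reals_iff)
  qed
  define S where "S = {w :: 'g \<times> 'x \<times> 'x \<Rightarrow>\<^sub>0 complex. Poly_Mapping.keys w \<subseteq> D \<times> UNIV}"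
  have S: "subspace S"
  proof (rule subspaceI)
    show "0 \<in> S" by (simp add: S_def)
    show "x + y \<in> S" if "x \<in> S" "y \<in> S" for x y
      using that keys_add[of x y] unfolding S_def by blast
    show "c *\<^sub>R x \<in> S" if "x \<in> S" for c x
      using that keys_scaleR[of c x] unfolding S_def by blast
  qed
  obtain F where F: "linear F" "\<And>s. s \<in> S \<Longrightarrow> F s = Re (kernel_eval \<psi> s)"
    and Fpos: "\<And>w. add_adjoint G w \<in> square_cone G \<Longrightarrow> 0 \<le> F w"
  proof (rule positive_extension[of S "\<lambda>w. Re (kernel_eval \<psi> w)" "{w. add_adjoint G w \<in> square_cone G}"])
    show "subspace S" by (rule S)
    show "linear (\<lambda>w. Re (kernel_eval \<psi> w))"
      by (intro linearI) (simp_all add: linear_add[OF linear_kernel_eval] linear_cmul[OF linear_kernel_eval])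
    show "0 \<in> {w. add_adjoint G w \<in> square_cone G}"
      by (simp add: linear_0[OF linear_add_adjoint] square_cone.zero)
    show "x + y \<in> {w. add_adjoint G w \<in> square_cone G}"
      if "x \<in> {w. add_adjoint G w \<in> square_cone G}" "y \<in> {w. add_adjoint G w \<in> square_cone G}" for x y
      using that by (simp add: linear_add[OF linear_add_adjoint] square_cone_add)
    show "t *\<^sub>R x \<in> {w. add_adjoint G w \<in> square_cone G}"
      if "0 \<le> t" "x \<in> {w. add_adjoint G w \<in> square_cone G}" for t x
      using that by (simp add: linear_cmul[OF linear_add_adjoint] square_cone_scaleR)
    show "\<exists>s\<in>S. s - w \<in> {w. add_adjoint G w \<in> square_cone G}" for w
      using square_cone_dominates[OF G S, of w] D by (simp add: S_def)
    fix s assume s: "s \<in> S" "s \<in> {w. add_adjoint G w \<in> square_cone G}"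
    have sD: "g \<in> D" "g \<in> carrier G" if "(g, u, v) \<in> Poly_Mapping.keys s" for g u v
      using that s(1) D(1) by (auto simp: S_def)
    have "Poly_Mapping.keys (add_adjoint G s) \<subseteq> D \<times> UNIV"
      unfolding add_adjoint_def using sD D(3)
      by (auto dest!: subsetD[OF keys_pm_sum] subsetD[OF keys_add] split: if_splits)
    then have "kernel_eval \<psi> (add_adjoint G s) \<in> \<real>\<^sub>\<ge>\<^sub>0"
      using s(2) by (intro pos) auto
    \<comment> \<open>Hermitian symmetry of \<psi> on \<open>D\<close> turns the value at
      \<open>s + s*\<close> into twice the real part at \<open>s\<close>, so positivity of \<psi> on
      squares passes to its real part in the new order.\<close>
    moreover have "kernel_eval \<psi> (add_adjoint G s) = kernel_eval \<psi> s + cnj (kernel_eval \<psi> s)"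
    proof -
      have "kernel_eval \<psi> (add_adjoint G s)
          = pm_sum (\<lambda>x c. (case x of (g, u, v) \<Rightarrow> c * \<psi> g u v) + cnj (case x of (g, u, v) \<Rightarrow> c * \<psi> g u v)) s"
        unfolding add_adjoint_def pm_sum_comp[OF linear_imp_additive[OF linear_kernel_eval]]
        using sD
        by (intro pm_sum_cong)
          (auto simp: linear_add[OF linear_kernel_eval] kernel_eval_single herm split: prod.split)
      then show ?thesis
        unfolding pm_sum_add by (simp add: kernel_eval_def pm_sum_def case_prod_unfold)
    qed
    ultimately show "0 \<le> Re (kernel_eval \<psi> s)" by (simp add: complex_nonneg_Reals_iff)
  next
    fix F assume F: "linear F" "\<And>s. s \<in> S \<Longrightarrow> F s = Re (kernel_eval \<psi> s)"
      "\<And>w. w \<in> {w. add_adjoint G w \<in> square_cone G} \<Longrightarrow> 0 \<le> F w"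
    show thesis by (rule that[OF F(1,2)]) (use F(3) in auto)
  qed
  \<comment> \<open>The usual recovery of a complex-linear functional from its real part:
    \<open>F w - \<i> F (\<i> w)\<close>.\<close>
  define \<theta> where "\<theta> g u v = Complex (F (Poly_Mapping.single (g, u, v) 1)) (- F (Poly_Mapping.single (g, u, v) \<i>))"
    for g u v
  have F_single: "F (Poly_Mapping.single x c)
      = Re c * F (Poly_Mapping.single x 1) + Im c * F (Poly_Mapping.single x \<i>)" for x c
  proof -
    have "c = Re c *\<^sub>R 1 + Im c *\<^sub>R \<i>" by (simp add: complex_eq_iff)
    then have "Poly_Mapping.single x c = Re c *\<^sub>R Poly_Mapping.single x 1 + Im c *\<^sub>R Poly_Mapping.single x \<i>"
      unfolding scaleR_single single_add[symmetric] by (rule arg_cong)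
    then have "F (Poly_Mapping.single x c)
        = F (Re c *\<^sub>R Poly_Mapping.single x 1 + Im c *\<^sub>R Poly_Mapping.single x \<i>)"
      by (rule arg_cong)
    then show ?thesis by (simp only: linear_add[OF F(1)] linear_cmul[OF F(1)] real_scaleR_def)
  qed
  have F_eval: "kernel_eval \<theta> w = Complex (F w) (- F (pm_sum (\<lambda>x c. Poly_Mapping.single x (\<i> * c)) w))" for w
  proof (rule complex_eqI)
    have "F w = pm_sum (\<lambda>x c. F (Poly_Mapping.single x c)) w"
      using pm_sum_comp[OF linear_imp_additive[OF F(1)], of Poly_Mapping.single w]
      unfolding pm_sum_single_id .
    also have "\<dots> = Re (kernel_eval \<theta> w)"
      unfolding kernel_eval_def pm_sum_def Re_sum
      by (intro sum.cong refl) (auto simp: F_single[of _ "Poly_Mapping.lookup w _"] \<theta>_def split: prod.split)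
    finally show "Re (kernel_eval \<theta> w) = Re (Complex (F w) (- F (pm_sum (\<lambda>x c. Poly_Mapping.single x (\<i> * c)) w)))"
      by simp
    have "F (pm_sum (\<lambda>x c. Poly_Mapping.single x (\<i> * c)) w) = - Im (kernel_eval \<theta> w)"
      unfolding pm_sum_comp[OF linear_imp_additive[OF F(1)]]
      unfolding kernel_eval_def pm_sum_def Im_sum sum_negf[symmetric]
      by (intro sum.cong refl) (auto simp: F_single[of _ "\<i> * Poly_Mapping.lookup w _"] \<theta>_def split: prod.split)
    then show "Im (kernel_eval \<theta> w) = Im (Complex (F w) (- F (pm_sum (\<lambda>x c. Poly_Mapping.single x (\<i> * c)) w)))"
      by simp
  qed
  show ?thesis
  proof (rule that)
    fix g u v assume "g \<in> D"
    then have "Poly_Mapping.single (g, u, v) c \<in> S" for c by (simp add: S_def)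
    then show "\<theta> g u v = \<psi> g u v"
      by (simp add: \<theta>_def F(2) kernel_eval_single complex_eq_iff)
  next
    let ?K = "\<lambda>(g, u) (h, v). if g \<in> carrier G \<and> h \<in> carrier G then \<theta> (inv\<^bsub>G\<^esub> g \<otimes>\<^bsub>G\<^esub> h) u v else 0"
    show "psd_kernel ?K"
      unfolding psd_kernel_def
    proof
      fix a :: "'g \<times> 'x \<Rightarrow>\<^sub>0 complex"
      have "sesq_form ?K a a = kernel_eval \<theta> (row_square G 1 a a)"
        unfolding sesq_form_def row_square_def pm_sum_comp[OF linear_imp_additive[OF linear_kernel_eval]]
        by (intro pm_sum_cong) (auto simp: kernel_eval_single linear_0[OF linear_kernel_eval] split: prod.split)
      moreover have "pm_sum (\<lambda>x c. Poly_Mapping.single x (\<i> * c)) (row_square G 1 a a) = row_square G \<i> a a"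
        unfolding row_square_def
        by (subst pm_sum_pm_sum, rule Modules.additive.intro, simp add: algebra_simps single_add)+
          (intro pm_sum_cong; simp add: pm_sum_single mult.assoc)
      \<comment> \<open>This is the imaginary part of the form, up to sign. Both the element and its
        negative have hermitian part 0 and so lie in the cone on which \<open>F\<close> is
        nonnegative.\<close>
      moreover have "F (row_square G \<i> a a) = 0"
      proof -
        have "add_adjoint G (row_square G \<i> a a) = 0"
          by (simp add: add_adjoint_row_square[OF G] row_square_minus)
        then have "0 \<le> F (row_square G \<i> a a)" "0 \<le> F (- row_square G \<i> a a)"
          by (auto intro!: Fpos simp: linear_neg[OF linear_add_adjoint] square_cone.zero)
        then show ?thesis by (simp add: linear_neg[OF F(1)])
      qed
      moreover have "0 \<le> F (row_square G 1 a a)"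
        by (intro Fpos) (simp add: add_adjoint_row_square[OF G] square_cone_add row_square_in_square_cone)
      ultimately show "sesq_form ?K a a \<in> \<real>\<^sub>\<ge>\<^sub>0"
        by (simp add: F_eval complex_nonneg_Reals_iff)
    qed
  qed
qed

section \<open>Dilations of completely positive definite functions\<close>

text \<open>The entry of the row \<open>a\<close> in column \<open>u\<close>. Components outside the
  carrier are discarded to match \<open>row_square\<close>.\<close>

definition row_entry :: "('g, 'm) monoid_scheme \<Rightarrow> 'x \<Rightarrow> ('g \<times> 'x \<Rightarrow>\<^sub>0 complex) \<Rightarrow> 'g \<Rightarrow>\<^sub>0 complex"
  where "row_entry G u a = pm_sum (\<lambda>(g, u') c.
    if g \<in> carrier G \<and> u' = u then Poly_Mapping.single g c else 0) a"

definition matrix_entry :: "'x \<Rightarrow> 'x \<Rightarrow> ('g \<times> 'x \<times> 'x \<Rightarrow>\<^sub>0 complex) \<Rightarrow> 'g \<Rightarrow>\<^sub>0 complex"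
  where "matrix_entry u v w = pm_sum (\<lambda>(g, u', v') c.
    if u' = u \<and> v' = v then Poly_Mapping.single g c else 0) w"

lemma row_entry_closed: "row_entry G u a \<in> group_algebra G"
  unfolding group_algebra_def row_entry_def
  by (auto dest!: subsetD[OF keys_pm_sum] split: if_splits)

lemma linear_matrix_entry: "linear (matrix_entry u v)"
  unfolding matrix_entry_def
  by (intro linear_pm_sum linearI) (auto simp: single_add scaleR_single split: prod.split)

lemma matrix_entry_row_square:
  assumes "group G"
  shows "matrix_entry u v (row_square G 1 a a) = ga_mult G (ga_star G (row_entry G u a)) (row_entry G v a)"
proof -
  interpret group G by fact
  let ?f = "\<lambda>x (c :: complex). if fst x \<in> carrier G \<and> snd x = u then Poly_Mapping.single (fst x) c else 0"
  let ?m = "\<lambda>x c y (d :: complex). Poly_Mapping.single (x \<otimes>\<^bsub>G\<^esub> y) (c * d :: complex)"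
  let ?r = "\<lambda>y (d :: complex). if fst y \<in> carrier G \<and> snd y = v then Poly_Mapping.single (fst y) d else 0"
  let ?s = "\<lambda>x (c :: complex). Poly_Mapping.single (inv\<^bsub>G\<^esub> x) (cnj c)"
  have add_m: "Modules.additive (?m g c h)" for g c h
    by (rule Modules.additive.intro) (simp add: algebra_simps single_add)
  have add_s: "Modules.additive (?s g)" for g
    by (rule Modules.additive.intro) (simp add: single_add)
  have add_o: "Modules.additive (\<lambda>c. pm_sum (\<lambda>h d. Poly_Mapping.single (g \<otimes>\<^bsub>G\<^esub> h) (c * d :: complex)) b)" for g b
    by (rule Modules.additive.intro) (simp add: pm_sum_def algebra_simps single_add sum.distrib)
  have "ga_star G (row_entry G u a) = pm_sum (\<lambda>x c. pm_sum ?s (?f x c)) a"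
    unfolding ga_star_pm_sum row_entry_def case_prod_unfold by (rule pm_sum_pm_sum[OF add_s])
  also have "\<dots> = pm_sum (\<lambda>x c. if fst x \<in> carrier G \<and> snd x = u
      then Poly_Mapping.single (inv\<^bsub>G\<^esub> fst x) (cnj c) else 0) a"
    by (intro pm_sum_cong) (simp add: pm_sum_single)
  finally have star: "ga_star G (row_entry G u a) = \<dots>" .
  have "ga_mult G (ga_star G (row_entry G u a)) (row_entry G v a)
      = pm_sum (\<lambda>x c. pm_sum (\<lambda>g c. pm_sum (?m g c) (row_entry G v a))
          (if fst x \<in> carrier G \<and> snd x = u then Poly_Mapping.single (inv\<^bsub>G\<^esub> fst x) (cnj c) else 0)) a"
    unfolding star ga_mult_pm_sum by (rule pm_sum_pm_sum[OF add_o])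
  also have "\<dots> = pm_sum (\<lambda>x c. pm_sum (\<lambda>y d. if (fst x \<in> carrier G \<and> snd x = u) \<and> fst y \<in> carrier G \<and> snd y = v
      then Poly_Mapping.single (inv\<^bsub>G\<^esub> fst x \<otimes>\<^bsub>G\<^esub> fst y) (cnj c * d) else 0) a) a"
  proof (rule pm_sum_cong)
    fix x
    have row: "pm_sum (?m g c) (row_entry G v a) = pm_sum (\<lambda>y d. if fst y \<in> carrier G \<and> snd y = v
      then Poly_Mapping.single (g \<otimes>\<^bsub>G\<^esub> fst y) (c * d) else 0) a" for g c
      unfolding row_entry_def case_prod_unfold pm_sum_pm_sum[OF add_m]
      by (intro pm_sum_cong) (simp add: pm_sum_single)
    show "pm_sum (\<lambda>g c. pm_sum (?m g c) (row_entry G v a))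
          (if fst x \<in> carrier G \<and> snd x = u then Poly_Mapping.single (inv\<^bsub>G\<^esub> fst x) (cnj (Poly_Mapping.lookup a x)) else 0)
      = pm_sum (\<lambda>y d. if (fst x \<in> carrier G \<and> snd x = u) \<and> fst y \<in> carrier G \<and> snd y = v
      then Poly_Mapping.single (inv\<^bsub>G\<^esub> fst x \<otimes>\<^bsub>G\<^esub> fst y) (cnj (Poly_Mapping.lookup a x) * d) else 0) a"
    proof (cases "fst x \<in> carrier G \<and> snd x = u")
      case True
      have "pm_sum (\<lambda>g c. pm_sum (?m g c) (row_entry G v a))
          (Poly_Mapping.single (inv\<^bsub>G\<^esub> fst x) (cnj (Poly_Mapping.lookup a x)))
        = pm_sum (?m (inv\<^bsub>G\<^esub> fst x) (cnj (Poly_Mapping.lookup a x))) (row_entry G v a)"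
        by (intro pm_sum_single_additive add_o)
      then show ?thesis using True by (simp add: row)
    qed (auto simp: pm_sum_def)
  qed
  also have "\<dots> = matrix_entry u v (row_square G 1 a a)"
    unfolding row_square_def pm_sum_comp[OF linear_imp_additive[OF linear_matrix_entry]]
    by (intro pm_sum_cong)
      (auto simp: linear_0[OF linear_matrix_entry] matrix_entry_def pm_sum_single split: prod.split)
  finally show ?thesis by simp
qed

text \<open>Only finitely many vectors occur as labels in \<open>w\<close>. Enumerating them turns
  \<open>w\<close> into a finite matrix over the group algebra with entries supported in
  \<open>D\<close>, and pairing its image under \<Phi> with these same vectors gives the evaluation
  of \<open>w\<close>.\<close>

lemma completely_positive_square_cone:
  fixes G :: "('g, 'm) monoid_scheme" and \<Phi> :: "'g \<Rightarrow> 'h \<Rightarrow> 'h::chilbert_space"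
  assumes G: "group G"
    and cp: "completely_positive TYPE('u::chilbert_space) G
      {x \<in> group_algebra G. Poly_Mapping.keys x \<subseteq> D} (lin_ext \<Phi>)"
    and D: "D \<subseteq> carrier G"
    and w: "w \<in> square_cone G" "Poly_Mapping.keys w \<subseteq> D \<times> UNIV"
  shows "kernel_eval (\<lambda>g u v. cinner u (\<Phi> g v)) w \<in> \<real>\<^sub>\<ge>\<^sub>0"
proof -
  obtain n :: nat and a where w_sum: "w = (\<Sum>k<n. row_square G 1 (a k) (a k))"
    using w(1) by (rule square_cone_sum)
  define B where "B = (\<Union>(g, u, v)\<in>Poly_Mapping.keys w. {u, v})"
  have "finite B" by (auto simp: B_def)
  then obtain e where "bij_betw e {0..<card B} B" using ex_bij_betw_nat_finite by blast
  then obtain m where e: "bij_betw e {..<m} B" by (metis atLeast0LessThan)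
  \<comment> \<open>Row \<open>l\<close> of the factor comes from the square \<open>a l\<close>,
    column \<open>p\<close> from the vector \<open>e p\<close>. The definition of a positive matrix
    asks for a square factor, so this \<open>n\<close> by \<open>m\<close> array is padded with
    zeros to size \<open>n + m\<close>.\<close>
  define y where "y l p = (if l < n \<and> p < m then row_entry G (e p) (a l) else 0)" for l p
  define x where "x p q = (\<Sum>l<n + m. ga_mult G (ga_star G (y l p)) (y l q))" for p q
  have ga_0: "ga_star G 0 = 0" "ga_mult G 0 0 = 0" "ga_mult G b 0 = 0" "ga_mult G 0 b = 0" for b
    by (simp_all add: ga_star_def ga_mult_def)
  have x: "x p q = (if p < m \<and> q < m then matrix_entry (e p) (e q) w else 0)" for p q
  proof (cases "p < m \<and> q < m")
    case True
    have "x p q = (\<Sum>l<n. ga_mult G (ga_star G (y l p)) (y l q))"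
      unfolding x_def by (rule sum.mono_neutral_right) (auto simp: y_def ga_0)
    also have "\<dots> = (\<Sum>l<n. matrix_entry (e p) (e q) (row_square G 1 (a l) (a l)))"
      using True by (intro sum.cong refl) (simp add: y_def matrix_entry_row_square[OF G])
    finally show ?thesis using True by (simp add: w_sum linear_sum[OF linear_matrix_entry])
  qed (auto simp: x_def y_def ga_0)
  have "x p q \<in> {x \<in> group_algebra G. Poly_Mapping.keys x \<subseteq> D}" for p q
  proof -
    have "Poly_Mapping.keys (matrix_entry (e p) (e q) w) \<subseteq> D"
      unfolding matrix_entry_def using w(2)
      by (auto dest!: subsetD[OF keys_pm_sum] split: if_splits)
    then show ?thesis using D by (auto simp: x group_algebra_def)
  qed
  moreover have "ga_matrix_psd TYPE('u) G (n + m) x"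
    unfolding ga_matrix_psd_def
  \<comment> \<open>The factor already has entries in the group algebra, so constant Cauchy
    sequences represent it and every error is the norm of 0.\<close>
  proof (intro exI[of _ "\<lambda>l p k. y l p"] conjI allI impI)
    have "0 \<in> group_algebra G" by (simp add: group_algebra_def)
    then show "ga_Cauchy TYPE('u) G (\<lambda>k. y i j)" for i j
      by (auto simp: ga_Cauchy_def ga_norm_zero y_def row_entry_closed)
    show "(\<lambda>k. ga_norm TYPE('u) G (x i j - (\<Sum>l<n + m. ga_mult G (ga_star G (y l i)) (y l j)))) \<longlonglongrightarrow> 0"
      for i j
      by (simp add: x_def ga_norm_zero)
  qed
  ultimately have "op_matrix_psd (n + m) (\<lambda>p q. lin_ext \<Phi> (x p q))"
    using cp by (auto simp: completely_positive_def)
  \<comment> \<open>The test vectors are the labels themselves. For indices from \<open>m\<close>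
    on, \<open>e\<close> is arbitrary, but the padded entries of \<open>x\<close> are 0
    there.\<close>
  then have "(\<Sum>p<n + m. \<Sum>q<n + m. cinner (e p) (lin_ext \<Phi> (x p q) (e q))) \<in> \<real>\<^sub>\<ge>\<^sub>0"
    by (simp add: op_matrix_psd_def)
  also have "(\<Sum>p<n + m. \<Sum>q<n + m. cinner (e p) (lin_ext \<Phi> (x p q) (e q)))
      = (\<Sum>p<m. \<Sum>q<n + m. cinner (e p) (lin_ext \<Phi> (x p q) (e q)))"
    by (rule sum.mono_neutral_right) (auto simp: x lin_ext_def cinner.zero_right)
  also have "\<dots> = (\<Sum>p<m. \<Sum>q<m. cinner (e p) (lin_ext \<Phi> (matrix_entry (e p) (e q) w) (e q)))"
    by (intro sum.cong refl sum.mono_neutral_cong_right) (auto simp: x lin_ext_def cinner.zero_right)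
  also have "\<dots> = (\<Sum>p<m. \<Sum>v\<in>B. cinner (e p) (lin_ext \<Phi> (matrix_entry (e p) v w) v))"
    by (intro sum.cong refl sum.reindex_bij_betw[OF e])
  also have "\<dots> = (\<Sum>u\<in>B. \<Sum>v\<in>B. cinner u (lin_ext \<Phi> (matrix_entry u v w) v))"
    by (rule sum.reindex_bij_betw[OF e])
  also have "\<dots> = (\<Sum>u\<in>B. \<Sum>v\<in>B. pm_sum (\<lambda>(g, u', v') c.
      if u' = u \<and> v' = v then c * cinner u (\<Phi> g v) else 0) w)"
  proof (intro sum.cong refl)
    fix u v
    have "Modules.additive (\<lambda>x. cinner u (lin_ext \<Phi> x v))"
      by (rule Modules.additive.intro)
        (simp add: lin_ext_comb linear_add[OF linear_comb] cinner_add_right)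
    then have "cinner u (lin_ext \<Phi> (matrix_entry u v w) v)
        = pm_sum (\<lambda>x c. cinner u (lin_ext \<Phi> (case x of (g, u', v') \<Rightarrow>
            if u' = u \<and> v' = v then Poly_Mapping.single g c else 0) v)) w"
      unfolding matrix_entry_def by (subst pm_sum_comp) (simp_all add: case_prod_unfold)
    also have "\<dots> = pm_sum (\<lambda>(g, u', v') c. if u' = u \<and> v' = v then c * cinner u (\<Phi> g v) else 0) w"
      by (intro pm_sum_cong)
        (auto simp: lin_ext_comb comb_single cinner_scaleC_right cinner.zero_right linear_0[OF linear_comb] split: prod.split)
    finally show "cinner u (lin_ext \<Phi> (matrix_entry u v w) v) = \<dots>" .
  qed
  also have "\<dots> = pm_sum (\<lambda>x c. \<Sum>u\<in>B. \<Sum>v\<in>B. (case x of (g, u', v') \<Rightarrow> \<lambda>c.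
      if u' = u \<and> v' = v then c * cinner u (\<Phi> g v) else 0) c) w"
    unfolding pm_sum_sum ..
  also have "\<dots> = kernel_eval (\<lambda>g u v. cinner u (\<Phi> g v)) w"
    unfolding kernel_eval_def
  proof (rule pm_sum_cong)
    fix x assume x: "x \<in> Poly_Mapping.keys w"
    obtain g u v where guv: "x = (g, u, v)" by (cases x)
    have uv: "u \<in> B" "v \<in> B" using x by (auto simp: B_def guv)
    have "(\<Sum>u'\<in>B. \<Sum>v'\<in>B. if u = u' \<and> v = v' then c * cinner u' (\<Phi> g v') else 0)
        = c * cinner u (\<Phi> g v)" for c
    proof -
      have "(\<Sum>u'\<in>B. \<Sum>v'\<in>B. if u = u' \<and> v = v' then c * cinner u' (\<Phi> g v') else 0)
          = (\<Sum>u'\<in>B. if u = u' then c * cinner u' (\<Phi> g v) else 0)"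
        using uv \<open>finite B\<close> by (intro sum.cong refl) (simp add: sum.delta)
      then show ?thesis using uv \<open>finite B\<close> by (simp add: sum.delta)
    qed
    then show "(\<Sum>u\<in>B. \<Sum>v\<in>B. (case x of (g, u', v') \<Rightarrow> \<lambda>c.
        if u' = u \<and> v' = v then c * cinner u (\<Phi> g v) else 0) (Poly_Mapping.lookup w x))
      = (case x of (g, u, v) \<Rightarrow> \<lambda>c. c * cinner u (\<Phi> g v)) (Poly_Mapping.lookup w x)"
      by (simp add: guv)
  qed
  finally show ?thesis .
qed

text \<open>The squared norm of \<open>V (u + v) - (V u + V v)\<close> expands into inner products
  of values of \<open>V\<close> alone, and cancels as it would for the identity map; likewise for
  scalars.\<close>

lemma linear_isometryI_cinner:
  fixes V :: "'a::complex_inner \<Rightarrow> 'b::complex_inner"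
  assumes "\<And>u v. cinner (V u) (V v) = cinner u v"
  shows "linear_isometry V"
proof -
  have norm: "norm (V u) = norm u" for u
    using assms[of u u] unfolding cinner_self of_real_eq_iff by (simp add: power2_eq_iff_nonneg)
  have "V (u + v) = V u + V v" for u v
  proof -
    have "cinner (V (u + v) - (V u + V v)) (V (u + v) - (V u + V v)) = 0"
      by (simp add: cinner.diff_left cinner.diff_right cinner_add_left cinner_add_right assms)
    then show ?thesis by (simp add: cinner_self)
  qed
  moreover have "V (c *\<^sub>C u) = c *\<^sub>C V u" for c u
  proof -
    have "cinner (V (c *\<^sub>C u) - c *\<^sub>C V u) (V (c *\<^sub>C u) - c *\<^sub>C V u) = 0"
      by (simp add: cinner.diff_left cinner.diff_right cinner_scaleC_left cinner_scaleC_right assms)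
    then show ?thesis by (simp add: cinner_self)
  qed
  ultimately show ?thesis by (simp add: linear_isometry_def clinear_on_def norm)
qed

lemma cinner_linear_isometry:
  fixes V :: "'a::complex_inner \<Rightarrow> 'b::complex_inner"
  assumes "linear_isometry V"
  shows "cinner (V u) (V v) = cinner u v"
  using assms by (intro norm_preserving_cinner[of UNIV]) (auto simp: linear_isometry_def)

text \<open>The universe \<open>'u\<close> of the norm and the space \<open>'i ell2\<close> of the
  representation are unrelated here, because the positive matrices tested are exact sums of squares.
  The injection \<iota> provides one coordinate per generator.\<close>

lemma cp_definite_dilation:
  fixes G :: "('g, 'm) monoid_scheme" and H :: "'g set" and \<phi> :: "'g set \<Rightarrow> 'h \<Rightarrow> 'h::chilbert_space"
    and \<iota> :: "'g \<times> 'h \<Rightarrow> 'i"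
  assumes G: "group G" and H: "subgroup H G"
    and sym: "symmetric_cosets G H \<Gamma>" and arch: "archimedian_cosets G H \<Gamma>"
    and cp: "cp_definite TYPE('u::chilbert_space) G H \<Gamma> \<phi>" and id: "\<phi> (\<one>\<^bsub>G\<^esub> <#\<^bsub>G\<^esub> H) = id"
    and \<iota>: "inj \<iota>"
  obtains K :: "'i ell2 set" and \<pi> V where "unitary_rep G K \<pi>" "linear_isometry V"
    "range V \<subseteq> invariant_vectors H K \<pi>"
    "\<And>g. g \<in> carrier G \<Longrightarrow> g <#\<^bsub>G\<^esub> H \<in> \<Gamma> \<Longrightarrow> \<phi> (g <#\<^bsub>G\<^esub> H) = cadjoint V \<circ> \<pi> g \<circ> V"
proof -
  interpret group G by fact
  define D where "D = {g \<in> carrier G. g <#\<^bsub>G\<^esub> H \<in> \<Gamma>}"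
  have D: "D \<subseteq> carrier G" "\<one>\<^bsub>G\<^esub> \<in> D" "\<And>g. g \<in> D \<Longrightarrow> inv\<^bsub>G\<^esub> g \<in> D"
    using sym arch by (auto simp: D_def symmetric_cosets_def archimedian_cosets_def)
  have "coset_algebra G H \<Gamma> = {x \<in> group_algebra G. Poly_Mapping.keys x \<subseteq> D}"
    by (auto simp: coset_algebra_def group_algebra_def D_def)
  then have cp': "completely_positive TYPE('u) G {x \<in> group_algebra G. Poly_Mapping.keys x \<subseteq> D}
      (lin_ext (\<lambda>g. \<phi> (g <#\<^bsub>G\<^esub> H)))"
    using cp by (simp add: cp_definite_def)
  let ?K = "\<lambda>\<theta> (g, u) (h, v).
    if g \<in> carrier G \<and> h \<in> carrier G then (\<theta> (inv\<^bsub>G\<^esub> g \<otimes>\<^bsub>G\<^esub> h) u v :: complex) else 0"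
  obtain \<theta> :: "'g \<Rightarrow> 'h \<Rightarrow> 'h \<Rightarrow> complex"
    where \<theta>: "\<And>g u v. g \<in> D \<Longrightarrow> \<theta> g u v = cinner u (\<phi> (g <#\<^bsub>G\<^esub> H) v)"
    and psd: "psd_kernel (?K \<theta>)"
  proof (rule positive_kernel_extension[OF G D completely_positive_square_cone[OF G cp' D(1)]])
    fix \<theta> :: "'g \<Rightarrow> 'h \<Rightarrow> 'h \<Rightarrow> complex"
    assume "\<And>g u v. g \<in> D \<Longrightarrow> \<theta> g u v = cinner u (\<phi> (g <#\<^bsub>G\<^esub> H) v)" "psd_kernel (?K \<theta>)"
    then show thesis by (rule that)
  qed
  obtain \<xi> :: "'g \<times> 'h \<Rightarrow> 'i ell2" where \<xi>: "\<And>x y. cinner (\<xi> x) (\<xi> y) = ?K \<theta> x y"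
    using psd_kernel_gram[OF psd \<iota>] by blast
  have gram: "cinner (\<xi> (g, u)) (\<xi> (h, v)) = \<theta> (inv\<^bsub>G\<^esub> g \<otimes>\<^bsub>G\<^esub> h) u v"
    if "g \<in> carrier G" "h \<in> carrier G" for g h u v
    using that by (simp add: \<xi>)
  \<comment> \<open>Left translation of the group component. It leaves
    \<open>inv g \<otimes> h\<close> unchanged, hence also the kernel; labels outside the carrier
    stay fixed, and their kernel values are 0.\<close>
  define act where "act k x = (if fst x \<in> carrier G then (k \<otimes>\<^bsub>G\<^esub> fst x, snd x) else x)"
    for k and x :: "'g \<times> 'h"
  obtain K \<pi> where K: "unitary_rep G K \<pi>" "\<And>x. \<xi> x \<in> K"
    and \<pi>: "\<And>g x. g \<in> carrier G \<Longrightarrow> \<pi> g (\<xi> x) = \<xi> (act g x)"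
  proof (rule unitary_rep_of_invariant_gram[OF G, of act \<xi>])
    show "act (g \<otimes>\<^bsub>G\<^esub> h) x = act g (act h x)" if "g \<in> carrier G" "h \<in> carrier G" for g h x
      using that by (simp add: act_def m_assoc)
    show "act \<one>\<^bsub>G\<^esub> x = x" for x by (simp add: act_def)
    fix k x y assume k: "k \<in> carrier G"
    have "inv\<^bsub>G\<^esub> (k \<otimes>\<^bsub>G\<^esub> g) \<otimes>\<^bsub>G\<^esub> (k \<otimes>\<^bsub>G\<^esub> h) = inv\<^bsub>G\<^esub> g \<otimes>\<^bsub>G\<^esub> h" if "g \<in> carrier G" "h \<in> carrier G" for g h
      using that k by (simp add: inv_mult_group m_assoc) (simp add: m_assoc[symmetric])
    then show "cinner (\<xi> (act k x)) (\<xi> (act k y)) = cinner (\<xi> x) (\<xi> y)"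
      using k by (simp add: \<xi> act_def case_prod_unfold)
  next
    fix K \<pi> assume "unitary_rep G K \<pi>" "\<And>x. \<xi> x \<in> K" "\<And>g x. g \<in> carrier G \<Longrightarrow> \<pi> g (\<xi> x) = \<xi> (act g x)"
    then show thesis by (rule that)
  qed
  define V where "V u = \<xi> (\<one>\<^bsub>G\<^esub>, u)" for u
  have V: "linear_isometry V"
    using D by (intro linear_isometryI_cinner) (simp add: V_def gram \<theta> id)
  have \<pi>V: "\<pi> g (V u) = \<xi> (g, u)" if "g \<in> carrier G" for g u
    using that by (simp add: V_def \<pi> act_def)
  have H_eq: "h <#\<^bsub>G\<^esub> H = \<one>\<^bsub>G\<^esub> <#\<^bsub>G\<^esub> H" if "h \<in> H" for h
    using that H by (simp add: coset_join3 subgroup.mem_carrier[OF H] subgroup.one_closed)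
  have inv: "\<pi> h (V u) = V u" if "h \<in> H" for h u
  proof -
    have hG: "h \<in> carrier G" using H that by (rule subgroup.mem_carrier)
    have hD: "h \<in> D" "inv\<^bsub>G\<^esub> h \<in> D"
      using D hG H_eq[OF that] by (auto simp: D_def)
    have "inv\<^bsub>G\<^esub> h \<in> H" using H that by (rule subgroup.m_inv_closed)
    then have "\<theta> (inv\<^bsub>G\<^esub> h) u u = cinner u u" "\<theta> h u u = cinner u u" "\<theta> \<one>\<^bsub>G\<^esub> u u = cinner u u"
      using hD D by (simp_all add: \<theta> H_eq that id)
    then have "cinner (\<xi> (h, u) - V u) (\<xi> (h, u) - V u) = 0"
      using hG by (simp add: V_def cinner.diff_left cinner.diff_right gram)
    then show ?thesis using \<pi>V[OF hG] by (simp add: cinner_self)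
  qed
  show ?thesis
  proof (rule that[OF K(1) V])
    show "range V \<subseteq> invariant_vectors H K \<pi>"
      using inv K(2) by (auto simp: invariant_vectors_def V_def)
    fix g assume g: "g \<in> carrier G" "g <#\<^bsub>G\<^esub> H \<in> \<Gamma>"
    show "\<phi> (g <#\<^bsub>G\<^esub> H) = cadjoint V \<circ> \<pi> g \<circ> V"
    proof
      fix v
      have "cinner u (cadjoint V (\<pi> g (V v))) = cinner u (\<phi> (g <#\<^bsub>G\<^esub> H) v)" for u
      proof -
        have "cinner u (cadjoint V (\<pi> g (V v))) = cinner (V u) (\<pi> g (V v))"
          using cinner_cadjoint[OF linear_isometry_bounded_clinear[OF V]] by (metis cinner_commute)
        also have "\<dots> = cinner u (\<phi> (g <#\<^bsub>G\<^esub> H) v)"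
          using g unfolding \<pi>V[OF g(1)] by (simp add: V_def gram \<theta> D_def)
        finally show ?thesis .
      qed
      then have "cadjoint V (\<pi> g (V v)) = \<phi> (g <#\<^bsub>G\<^esub> H) v" by (rule cinner_ext)
      then show "\<phi> (g <#\<^bsub>G\<^esub> H) v = (cadjoint V \<circ> \<pi> g \<circ> V) v" by simp
    qed
  qed
qed

text \<open>Moving \<open>V\<close> across the inner product turns the form of \<phi> at the vectors
  \<open>u i\<close> into the form of \<pi> at \<open>V (u i)\<close>. In this direction the
  representation must live in the universe of the norm, which controls only the representations
  found there.\<close>

lemma dilation_cp_definite:
  fixes G :: "('g, 'm) monoid_scheme" and \<phi> :: "'g set \<Rightarrow> 'h \<Rightarrow> 'h::chilbert_space"
    and K :: "'u::chilbert_space set"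
  assumes G: "group G" and \<pi>: "unitary_rep G K \<pi>" and V: "linear_isometry V" and VK: "range V \<subseteq> K"
    and \<phi>: "\<And>g. g \<in> carrier G \<Longrightarrow> g <#\<^bsub>G\<^esub> H \<in> \<Gamma> \<Longrightarrow> \<phi> (g <#\<^bsub>G\<^esub> H) = cadjoint V \<circ> \<pi> g \<circ> V"
  shows "cp_definite TYPE('u) G H \<Gamma> \<phi>"
  unfolding cp_definite_def completely_positive_def op_matrix_psd_def
proof (intro allI impI, elim conjE)
  fix n x and u :: "nat \<Rightarrow> 'h"
  assume x: "\<forall>i<n. \<forall>j<n. x i j \<in> coset_algebra G H \<Gamma>" and psd: "ga_matrix_psd TYPE('u) G n x"
  have adj: "cinner u (cadjoint V w) = cinner (V u) w" for u w
    using cinner_cadjoint[OF linear_isometry_bounded_clinear[OF V]] by (metis cinner_commute)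
  have "(\<Sum>i<n. \<Sum>j<n. cinner (V (u i)) (lin_ext \<pi> (x i j) (V (u j)))) \<in> \<real>\<^sub>\<ge>\<^sub>0"
    using x VK by (intro unitary_rep_ga_matrix_psd[OF G \<pi> _ psd]) (auto simp: coset_algebra_def)
  also have "(\<Sum>i<n. \<Sum>j<n. cinner (V (u i)) (lin_ext \<pi> (x i j) (V (u j))))
      = (\<Sum>i<n. \<Sum>j<n. cinner (u i) (lin_ext (\<lambda>g. \<phi> (g <#\<^bsub>G\<^esub> H)) (x i j) (u j)))"
  proof (intro sum.cong refl)
    fix i j assume "i \<in> {..<n}" "j \<in> {..<n}"
    then have "x i j \<in> coset_algebra G H \<Gamma>" using x by simp
    then have "\<phi> (g <#\<^bsub>G\<^esub> H) = cadjoint V \<circ> \<pi> g \<circ> V" if "g \<in> Poly_Mapping.keys (x i j)" for g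
      using that by (intro \<phi>) (auto simp: coset_algebra_def group_algebra_def)
    then show "cinner (V (u i)) (lin_ext \<pi> (x i j) (V (u j)))
        = cinner (u i) (lin_ext (\<lambda>g. \<phi> (g <#\<^bsub>G\<^esub> H)) (x i j) (u j))"
      by (simp add: lin_ext_def cinner.sum_right cinner_scaleC_right adj)
  qed
  finally show "(\<Sum>i<n. \<Sum>j<n. cinner (u i) (lin_ext (\<lambda>g. \<phi> (g <#\<^bsub>G\<^esub> H)) (x i j) (u j))) \<in> \<real>\<^sub>\<ge>\<^sub>0" .
qed

theorem theorem7p5:
  fixes G :: "('g, 'b) monoid_scheme"
    and H :: "'g set"
    and \<Gamma> :: "'g set set"
    and \<phi> :: "'g set \<Rightarrow> 'h \<Rightarrow> 'h::chilbert_space"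
  assumes "group G"
    and "subgroup H G"
    and "\<Gamma> \<subseteq> left_cosets G H"
    and "symmetric_cosets G H \<Gamma>"
    and "archimedian_cosets G H \<Gamma>"
    and "\<forall>C\<in>\<Gamma>. bounded_clinear (\<phi> C)"
  shows "(cp_definite TYPE(('g, 'h, 'k) universe) G H \<Gamma> \<phi> \<and> \<phi> (\<one>\<^bsub>G\<^esub> <#\<^bsub>G\<^esub> H) = id)
    \<longleftrightarrow> (\<exists>(K :: ('g, 'h, 'k) universe set) \<pi> V.
          class_one_rep G H K \<pi> \<and> linear_isometry V \<and>
          range V \<subseteq> invariant_vectors H K \<pi> \<and>
          (\<forall>g\<in>carrier G. g <#\<^bsub>G\<^esub> H \<in> \<Gamma> \<longrightarrow>
            \<phi> (g <#\<^bsub>G\<^esub> H) = cadjoint V \<circ> \<pi> g \<circ> V))"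
    (is "?cp \<longleftrightarrow> ?dil")
proof
  assume ?cp
  show ?dil
  \<comment> \<open>A nonzero vector \<open>u\<close> gives the nonzero invariant vector
    \<open>V u\<close> that class one demands. Over the zero space such a vector has to come from
    elsewhere.\<close>
  proof (cases "\<exists>u :: 'h. u \<noteq> 0")
    case True
    have "inj (\<lambda>(g, u). (g, u, 0, undefined) :: 'g \<times> 'h \<times> nat \<times> 'k)"
      by (auto simp: inj_def)
    then obtain K :: "('g, 'h, 'k) universe set" and \<pi> V where *: "unitary_rep G K \<pi>"
      "linear_isometry V" "range V \<subseteq> invariant_vectors H K \<pi>"
      "\<And>g. g \<in> carrier G \<Longrightarrow> g <#\<^bsub>G\<^esub> H \<in> \<Gamma> \<Longrightarrow> \<phi> (g <#\<^bsub>G\<^esub> H) = cadjoint V \<circ> \<pi> g \<circ> V"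
    proof (rule cp_definite_dilation[OF assms(1,2,4,5) conjunct1[OF \<open>?cp\<close>] conjunct2[OF \<open>?cp\<close>]])
      fix K :: "('g, 'h, 'k) universe set" and \<pi> V
      assume "unitary_rep G K \<pi>" "linear_isometry V" "range V \<subseteq> invariant_vectors H K \<pi>"
        "\<And>g. g \<in> carrier G \<Longrightarrow> g <#\<^bsub>G\<^esub> H \<in> \<Gamma> \<Longrightarrow> \<phi> (g <#\<^bsub>G\<^esub> H) = cadjoint V \<circ> \<pi> g \<circ> V"
      then show thesis by (rule that)
    qed
    obtain u :: 'h where "u \<noteq> 0" using True by blast
    then have "V u \<noteq> 0" using *(2) by (metis linear_isometry_def norm_eq_zero)
    then have "invariant_vectors H K \<pi> \<noteq> {0}" using *(3) by blast
    then show ?thesis using * unfolding class_one_rep_def by blast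
  next
    case False
    then have eq: "u = v" for u v :: 'h by metis
    \<comment> \<open>The universe is nonzero whatever its index type, so its trivial representation
      has a nonzero fixed vector; the map 0 is an isometry from the zero space, and all operators on
      that space coincide.\<close>
    have "ell2_basis i \<noteq> 0" for i :: "'g \<times> 'h \<times> nat \<times> 'k"
      using cinner_ell2_basis[of i "ell2_basis i"] by (auto simp: ell2_basis.rep_eq cinner.zero_right)
    then have "ell2_basis undefined
        \<in> invariant_vectors H (UNIV :: ('g, 'h, 'k) universe set) (\<lambda>g v. v) - {0}"
      by (simp add: invariant_vectors_def)
    then have "invariant_vectors H (UNIV :: ('g, 'h, 'k) universe set) (\<lambda>g v. v) \<noteq> {0}" by auto
    then have "class_one_rep G H (UNIV :: ('g, 'h, 'k) universe set) (\<lambda>g v. v)"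
      using unitary_rep_trivial by (simp add: class_one_rep_def)
    moreover have "linear_isometry (\<lambda>u :: 'h. 0 :: ('g, 'h, 'k) universe)"
    proof (rule linear_isometryI_cinner)
      fix u v :: 'h
      have "u = 0" by (rule eq)
      then show "cinner (0 :: ('g, 'h, 'k) universe) 0 = cinner u v" by (simp add: cinner.zero_left)
    qed
    moreover have "\<phi> C = f" for C f by (rule ext) (rule eq)
    ultimately show ?thesis
      by (intro exI[of _ UNIV] exI[of _ "\<lambda>g v. v"] exI[of _ "\<lambda>u. 0"])
        (simp add: invariant_vectors_def image_subset_iff)
  qed
next
  assume ?dil
  then obtain K :: "('g, 'h, 'k) universe set" and \<pi> V where \<pi>: "unitary_rep G K \<pi>"
    and V: "linear_isometry V" and VK: "range V \<subseteq> invariant_vectors H K \<pi>"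
    and \<phi>: "\<And>g. g \<in> carrier G \<Longrightarrow> g <#\<^bsub>G\<^esub> H \<in> \<Gamma> \<Longrightarrow> \<phi> (g <#\<^bsub>G\<^esub> H) = cadjoint V \<circ> \<pi> g \<circ> V"
    unfolding class_one_rep_def by blast
  have VK': "range V \<subseteq> K" using VK by (auto simp: invariant_vectors_def)
  have "cp_definite TYPE(('g, 'h, 'k) universe) G H \<Gamma> \<phi>"
    using assms(1) \<pi> V VK' \<phi> by (rule dilation_cp_definite)
  \<comment> \<open>Normalization is \<open>V* V = 1\<close>, since the operator of the identity
    fixes the range of \<open>V\<close>.\<close>
  moreover have "\<phi> (\<one>\<^bsub>G\<^esub> <#\<^bsub>G\<^esub> H) = id"
  proof
    fix v
    have "\<phi> (\<one>\<^bsub>G\<^esub> <#\<^bsub>G\<^esub> H) v = cadjoint V (\<pi> \<one>\<^bsub>G\<^esub> (V v))"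
      using \<phi>[of "\<one>\<^bsub>G\<^esub>"] assms(1,5) by (simp add: archimedian_cosets_def group.is_monoid)
    also have "\<pi> \<one>\<^bsub>G\<^esub> (V v) = V v"
      using VK' by (intro unitary_rep_one[OF assms(1) \<pi>]) auto
    also have "cadjoint V (V v) = v"
    proof (rule cinner_ext)
      show "cinner u (cadjoint V (V v)) = cinner u v" for u
        using cinner_cadjoint[OF linear_isometry_bounded_clinear[OF V], of "V v" u]
          cinner_linear_isometry[OF V] by (metis cinner_commute)
    qed
    finally show "\<phi> (\<one>\<^bsub>G\<^esub> <#\<^bsub>G\<^esub> H) v = id v" by simp
  qed
  ultimately show ?cp by simp
qed

end
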